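(* For every integer $p\geq 4$, \textsc{Token Sliding} parameterized by $k$ (the number of tokens) is $W[1]$-hard on $\{C_4,\dots,C_p\}$-free graphs.
   Context: \textsc{Token Sliding}: given a graph $G$ and two independent sets $S,T$ of $G$ with $|S|=|T|=k\ge1$, decide whether there is a sequence $S=S_0,\dots,S_\ell=T$ of independent sets of size $k$ such that each $S_{i+1}$ is obtained from $S_i$ by replacing one vertex $u\in S_i$ by a vertex $w\notin S_i$ with $uw\in E(G)$. A graph is $\{C_4,\dots,C_p\}$-free if it contains no induced cycle of length $\ell$ for any $4\le \ell\le p$. *)

theory Defs
  imports Main
begin

section \<open>Algorithms: structured random access machines\<close>

text \<open>
  Programs operate on finitely many memory banks, each an unbounded array of natural numbers with
  indirect addressing. The arithmetic is that of the textbook RAM: addition and (truncated)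
  subtraction at unit cost, but no multiplication. Hence the numbers occurring after t steps have
  only polynomially many bits in t and the input size, and running times are polynomially
  related to those of Turing machines. Scalar variables are index 0 of a bank.
\<close>

type_synonym bank = string
type_synonym state = "bank \<Rightarrow> nat \<Rightarrow> nat"

datatype aexp = Const nat | Load bank aexp | Plus aexp aexp | Minus aexp aexp

fun aval :: "aexp \<Rightarrow> state \<Rightarrow> nat" where
  "aval (Const n) s = n"
| "aval (Load b a) s = s b (aval a s)"
| "aval (Plus a a') s = aval a s + aval a' s"
| "aval (Minus a a') s = aval a s - aval a' s"

datatype com = Skip | Store bank aexp aexp | Seq com com | Cond aexp com com | While aexp com

inductive exec :: "com \<Rightarrow> state \<Rightarrow> nat \<Rightarrow> state \<Rightarrow> bool" where
  Skip: "exec Skip s 1 s"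
| Store: "exec (Store b a a') s 1 (s(b := (s b)(aval a s := aval a' s)))"
| Seq: "exec c s t s' \<Longrightarrow> exec c' s' t' s'' \<Longrightarrow> exec (Seq c c') s (t + t') s''"
| CondTrue: "aval a s \<noteq> 0 \<Longrightarrow> exec c s t s' \<Longrightarrow> exec (Cond a c c') s (1 + t) s'"
| CondFalse: "aval a s = 0 \<Longrightarrow> exec c' s t s' \<Longrightarrow> exec (Cond a c c') s (1 + t) s'"
| WhileFalse: "aval a s = 0 \<Longrightarrow> exec (While a c) s 1 s"
| WhileTrue: "aval a s \<noteq> 0 \<Longrightarrow> exec c s t s' \<Longrightarrow> exec (While a c) s' t' s'' \<Longrightarrow>
    exec (While a c) s (1 + t + t') s''"

text \<open>
  A pair (x, k) of a bit string and a parameter is kept in the banks x (the bits), n (the length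
  of x) and k; the output is read off from the same banks.
\<close>

definition init_state :: "bool list \<Rightarrow> nat \<Rightarrow> state" where
  "init_state x k = (\<lambda>_ _. 0)(
     ''x'' := (\<lambda>i. if i < length x \<and> x ! i then 1 else 0),
     ''n'' := (\<lambda>_. 0)(0 := length x),
     ''k'' := (\<lambda>_. 0)(0 := k))"

definition holds_output :: "state \<Rightarrow> bool list \<Rightarrow> nat \<Rightarrow> bool" where
  "holds_output s y k \<longleftrightarrow> s ''n'' 0 = length y \<and> s ''k'' 0 = k \<and>
     (\<forall>i<length y. s ''x'' i = (if y ! i then 1 else 0))"

text \<open>
  The length of the output is charged to the running time. Without this, a program could announce
  an output of exponential length by storing a large number in bank n.
\<close>

definition transforms_within ::
  "com \<Rightarrow> bool list \<times> nat \<Rightarrow> bool list \<times> nat \<Rightarrow> nat \<Rightarrow> bool" where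
  "transforms_within c I J T \<longleftrightarrow>
     (\<exists>t s. exec c (init_state (fst I) (snd I)) t s \<and> holds_output s (fst J) (snd J) \<and>
            t + length (fst J) \<le> T)"

definition computable :: "(nat \<Rightarrow> nat) \<Rightarrow> bool" where
  "computable f \<longleftrightarrow> (\<exists>c. \<forall>k. \<exists>t s. exec c (init_state [] k) t s \<and> s ''k'' 0 = f k)"


section \<open>Parameterized problems and the W-hierarchy\<close>

text \<open>
  The set of legal instances is explicit, so that a reduction to a problem restricted to a class
  of graphs or circuits must only produce instances from that class (rather than, say, answering
  a no-instance by a graph outside the class). Unrestricted languages have all pairs as instances.
\<close>

record param_problem =
  instances :: "(bool list \<times> nat) set"
  yes_instances :: "(bool list \<times> nat) set"

definition fpt_reducible :: "param_problem \<Rightarrow> param_problem \<Rightarrow> bool" (infix "\<le>\<^sub>f\<^sub>p\<^sub>t" 50) where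
  "P \<le>\<^sub>f\<^sub>p\<^sub>t Q \<longleftrightarrow>
     (\<exists>c f g e. computable f \<and> computable g \<and>
        (\<forall>x k. (x, k) \<in> instances P \<longrightarrow>
          (\<exists>y k'. transforms_within c (x, k) (y, k') (f k * (length x + 1) ^ e) \<and>
                  k' \<le> g k \<and>
                  (y, k') \<in> instances Q \<and>
                  ((x, k) \<in> yes_instances P \<longleftrightarrow> (y, k') \<in> yes_instances Q))))"

text \<open>
  A Boolean circuit is a directed acyclic graph given in topological order: node i is the i-th
  gate of the list, its in-neighbours have smaller indices, and the last node is the output node.
\<close>

datatype gate = Input_Gate | Not_Gate nat | And_Gate "nat set" | Or_Gate "nat set"

type_synonym circuit = "gate list"

fun preds :: "gate \<Rightarrow> nat set" where
  "preds Input_Gate = {}"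
| "preds (Not_Gate j) = {j}"
| "preds (And_Gate J) = J"
| "preds (Or_Gate J) = J"

fun legal_fanin :: "gate \<Rightarrow> bool" where
  "legal_fanin (And_Gate J) = (card J \<ge> 2)"
| "legal_fanin (Or_Gate J) = (card J \<ge> 2)"
| "legal_fanin _ = True"

definition wf_circuit :: "circuit \<Rightarrow> bool" where
  "wf_circuit C \<longleftrightarrow> C \<noteq> [] \<and>
     (\<forall>i<length C. preds (C ! i) \<subseteq> {..<i} \<and> legal_fanin (C ! i))"

text \<open>The list of the values of all nodes, where f computes the value of a node from the list of
  values of the earlier nodes.\<close>

definition node_values :: "('v list \<Rightarrow> gate \<Rightarrow> 'v) \<Rightarrow> circuit \<Rightarrow> 'v list" where
  "node_values f C = foldl (\<lambda>vs g. vs @ [f vs g]) [] C"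

fun gate_value :: "nat set \<Rightarrow> bool list \<Rightarrow> gate \<Rightarrow> bool" where
  "gate_value A vs Input_Gate = (length vs \<in> A)"
| "gate_value A vs (Not_Gate j) = (\<not> vs ! j)"
| "gate_value A vs (And_Gate J) = (\<forall>j\<in>J. vs ! j)"
| "gate_value A vs (Or_Gate J) = (\<exists>j\<in>J. vs ! j)"

definition circuit_value :: "circuit \<Rightarrow> nat set \<Rightarrow> bool" where
  "circuit_value C A = last (node_values (gate_value A) C)"

text \<open>The depth is the maximum length of a path from an input node to the output node, the weft
  the maximum number of large nodes (in-degree more than 2) on such a path.\<close>

definition circuit_depth :: "circuit \<Rightarrow> nat" where
  "circuit_depth C = last (node_values
     (\<lambda>vs g. if g = Input_Gate then 0 else 1 + Max ((!) vs ` preds g)) C)"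

definition circuit_weft :: "circuit \<Rightarrow> nat" where
  "circuit_weft C = last (node_values
     (\<lambda>vs g. if g = Input_Gate then 0
             else (if card (preds g) > 2 then 1 else 0) + Max ((!) vs ` preds g)) C)"

definition input_nodes :: "circuit \<Rightarrow> nat set" where
  "input_nodes C = {i. i < length C \<and> C ! i = Input_Gate}"

fun gate_kind :: "gate \<Rightarrow> bool list" where
  "gate_kind Input_Gate = [False, False]"
| "gate_kind (Not_Gate _) = [False, True]"
| "gate_kind (And_Gate _) = [True, False]"
| "gate_kind (Or_Gate _) = [True, True]"

definition unary :: "nat \<Rightarrow> bool list" where
  "unary n = replicate n True @ [False]"

definition char_vector :: "nat \<Rightarrow> nat set \<Rightarrow> bool list" where
  "char_vector n S = map (\<lambda>i. i \<in> S) [0..<n]"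

definition encode_circuit :: "circuit \<Rightarrow> bool list" where
  "encode_circuit C = unary (length C) @
     concat (map (\<lambda>g. gate_kind g @ char_vector (length C) (preds g)) C)"

lemma unary_append_eq: "unary m @ xs = unary n @ ys \<longleftrightarrow> m = n \<and> xs = ys"
proof (induction m arbitrary: n)
  case 0
  then show ?case by (cases n) (auto simp: unary_def)
next
  case (Suc m)
  then show ?case by (cases n) (auto simp: unary_def)
qed

lemma length_char_vector [simp]: "length (char_vector n S) = n"
  by (simp add: char_vector_def)

lemma char_vector_eq: "char_vector n S = char_vector n S' \<longleftrightarrow> S \<inter> {..<n} = S' \<inter> {..<n}"
  unfolding char_vector_def map_eq_conv set_upt atLeast0LessThan by blast

lemma encode_circuit_inj:
  assumes "wf_circuit C" "wf_circuit D" "encode_circuit C = encode_circuit D"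
  shows "C = D"
proof -
  let ?row = "\<lambda>g. gate_kind g @ char_vector (length C) (preds g)"
  have len: "length C = length D" and rows: "concat (map ?row C) = concat (map ?row D)"
    using assms(3) by (auto simp: encode_circuit_def unary_append_eq)
  have "length (?row g) = length C + 2" for g
    by (cases g) auto
  then have "map ?row C = map ?row D"
    using rows len by (intro concat_injective) (auto simp: set_zip)
  then have nth: "map ?row C ! i = map ?row D ! i" for i
    by (rule arg_cong)
  have row: "?row (C ! i) = ?row (D ! i)" if "i < length C" for i
    using nth[of i] that that[unfolded len] by (simp only: nth_map)
  have "C ! i = D ! i" if i: "i < length C" for i
  proof -
    have sub: "preds (C ! i) \<subseteq> {..<length C}" "preds (D ! i) \<subseteq> {..<length C}"
      using assms(1,2) i len by (fastforce simp: wf_circuit_def)+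
    have kl: "length (gate_kind (C ! i)) = length (gate_kind (D ! i))"
      by (cases "C ! i"; cases "D ! i") auto
    have kind: "gate_kind (C ! i) = gate_kind (D ! i)"
      and "char_vector (length C) (preds (C ! i)) = char_vector (length C) (preds (D ! i))"
      using row[OF i] kl by auto
    then have "preds (C ! i) = preds (D ! i)"
      using sub by (auto simp: char_vector_eq Int_absorb2)
    with kind show ?thesis
      by (cases "C ! i"; cases "D ! i") auto
  qed
  then show ?thesis
    using len by (simp add: nth_equalityI)
qed

definition weighted_circuit_sat :: "nat \<Rightarrow> nat \<Rightarrow> param_problem" where
  "weighted_circuit_sat t d =
     \<lparr>instances = {(encode_circuit C, k) | C k.
        wf_circuit C \<and> circuit_weft C \<le> t \<and> circuit_depth C \<le> d},
      yes_instances = {(encode_circuit C, k) | C k.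
        wf_circuit C \<and> circuit_weft C \<le> t \<and> circuit_depth C \<le> d \<and>
        (\<exists>A \<subseteq> input_nodes C. card A = k \<and> circuit_value C A)}\<rparr>"

definition W_class :: "nat \<Rightarrow> param_problem set" where
  "W_class t = {P. \<exists>d\<ge>1. P \<le>\<^sub>f\<^sub>p\<^sub>t weighted_circuit_sat t d}"

definition W_hard :: "nat \<Rightarrow> param_problem \<Rightarrow> bool" where
  "W_hard t Q \<longleftrightarrow> (\<forall>P \<in> W_class t. P \<le>\<^sub>f\<^sub>p\<^sub>t Q)"


section \<open>Token sliding\<close>

definition simple_graph :: "'a set \<Rightarrow> 'a set set \<Rightarrow> bool" where
  "simple_graph V E \<longleftrightarrow> finite V \<and> (\<forall>e\<in>E. \<exists>u\<in>V. \<exists>v\<in>V. u \<noteq> v \<and> e = {u, v})"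

definition independent_set :: "'a set \<Rightarrow> 'a set set \<Rightarrow> 'a set \<Rightarrow> bool" where
  "independent_set V E S \<longleftrightarrow> S \<subseteq> V \<and> (\<forall>u\<in>S. \<forall>v\<in>S. {u, v} \<notin> E)"

definition induced_cycle :: "'a set \<Rightarrow> 'a set set \<Rightarrow> 'a list \<Rightarrow> bool" where
  "induced_cycle V E c \<longleftrightarrow> length c \<ge> 3 \<and> distinct c \<and> set c \<subseteq> V \<and>
     (\<forall>i<length c. \<forall>j<length c.
        {c ! i, c ! j} \<in> E \<longleftrightarrow> j = Suc i mod length c \<or> i = Suc j mod length c)"

definition C4_to_Cp_free :: "nat \<Rightarrow> 'a set \<Rightarrow> 'a set set \<Rightarrow> bool" where
  "C4_to_Cp_free p V E \<longleftrightarrow> (\<forall>l. 4 \<le> l \<and> l \<le> p \<longrightarrow> \<not> (\<exists>c. induced_cycle V E c \<and> length c = l))"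

definition slide :: "'a set set \<Rightarrow> 'a set \<Rightarrow> 'a set \<Rightarrow> bool" where
  "slide E I J \<longleftrightarrow> (\<exists>u w. u \<in> I \<and> w \<notin> I \<and> {u, w} \<in> E \<and> J = insert w (I - {u}))"

definition sliding_sequence ::
  "'a set \<Rightarrow> 'a set set \<Rightarrow> nat \<Rightarrow> 'a set \<Rightarrow> 'a set \<Rightarrow> nat \<Rightarrow> (nat \<Rightarrow> 'a set) \<Rightarrow> bool" where
  "sliding_sequence V E k S T l I \<longleftrightarrow> I 0 = S \<and> I l = T \<and>
     (\<forall>i\<le>l. independent_set V E (I i) \<and> card (I i) = k) \<and>
     (\<forall>i<l. slide E (I i) (I (Suc i)))"

text \<open>Graphs with vertex set {0, ..., n - 1} are encoded by n in unary and the rows of the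
  adjacency matrix.\<close>

definition encode_sliding :: "nat \<Rightarrow> nat set set \<Rightarrow> nat set \<Rightarrow> nat set \<Rightarrow> bool list" where
  "encode_sliding n E S T = unary n @
     concat (map (\<lambda>i. char_vector n {j. {i, j} \<in> E}) [0..<n]) @
     char_vector n S @ char_vector n T"

lemma encode_sliding_inj:
  assumes "simple_graph {..<n} E" "S \<subseteq> {..<n}" "T \<subseteq> {..<n}"
    and "simple_graph {..<n'} E'" "S' \<subseteq> {..<n'}" "T' \<subseteq> {..<n'}"
    and eq: "encode_sliding n E S T = encode_sliding n' E' S' T'"
  shows "n = n' \<and> E = E' \<and> S = S' \<and> T = T'"
proof -
  let ?rows = "\<lambda>E. map (\<lambda>i. char_vector n {j. {i, j} \<in> E}) [0..<n]"
  have n: "n' = n"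
    using eq by (simp add: encode_sliding_def unary_append_eq)
  have "length (concat (?rows E)) = length (concat (?rows E'))"
    by (simp add: length_concat o_def)
  then have rows: "concat (?rows E) = concat (?rows E')"
    and ST: "char_vector n S = char_vector n S'" "char_vector n T = char_vector n T'"
    using eq n by (auto simp: encode_sliding_def unary_append_eq)
  have "?rows E = ?rows E'"
    using rows by (intro concat_injective) (auto simp: set_zip)
  then have "{j. {i, j} \<in> E} \<inter> {..<n} = {j. {i, j} \<in> E'} \<inter> {..<n}" if "i < n" for i
    using that by (auto simp: char_vector_eq)
  then have adj: "{i, j} \<in> E \<longleftrightarrow> {i, j} \<in> E'" if "i < n" "j < n" for i j
    using that by blast
  have "e \<in> E \<longleftrightarrow> e \<in> E'" for e
  proof
    assume e: "e \<in> E"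
    with assms(1) obtain u v where "u < n" "v < n" "e = {u, v}"
      unfolding simple_graph_def by blast
    with e adj show "e \<in> E'" by blast
  next
    assume e: "e \<in> E'"
    with assms(4) obtain u v where "u < n" "v < n" "e = {u, v}"
      unfolding simple_graph_def n by blast
    with e adj show "e \<in> E" by blast
  qed
  then show ?thesis
    using ST assms(2,3,5,6) n by (auto simp: char_vector_eq Int_absorb2)
qed

definition sliding_instance ::
  "nat \<Rightarrow> nat \<Rightarrow> nat set set \<Rightarrow> nat set \<Rightarrow> nat set \<Rightarrow> nat \<Rightarrow> bool" where
  "sliding_instance p n E S T k \<longleftrightarrow>
     simple_graph {..<n} E \<and> C4_to_Cp_free p {..<n} E \<and>
     independent_set {..<n} E S \<and> independent_set {..<n} E T \<and>
     card S = k \<and> card T = k \<and> k \<ge> 1"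

definition token_sliding :: "nat \<Rightarrow> param_problem" where
  "token_sliding p =
     \<lparr>instances = {(encode_sliding n E S T, k) | n E S T k. sliding_instance p n E S T k},
      yes_instances = {(encode_sliding n E S T, k) | n E S T k.
        sliding_instance p n E S T k \<and> (\<exists>l I. sliding_sequence {..<n} E k S T l I)}\<rparr>"

end

theory Submission
  imports Defs
begin

text \<open>
  A satisfying input set of a weft 1 circuit can be certified locally. Write the chosen inputs in
  increasing order, and add for each of boundedly many positions above the large gates the child
  that makes a gate true or false. An input that is not chosen lies strictly between two
  consecutive chosen ones, so every violation is witnessed by a bounded number of the variables.
  Hence satisfiability amounts to finding values of polynomially (in the parameter) many variables
  such that every tuple of \<open>q\<close> of them, for a constant \<open>q\<close>, is consistent.

  Such a system is turned into a graph whose vertex set is partitioned into cliques, each holding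
  one token: a clique for each variable and each \<open>q\<close>-tuple of variables. A token can never leave
  its clique, since its new clique would contain two tokens. Equality of a variable with a component of a tuple
  is expressed by two inequalities, and each inequality is propagated along a path of more than \<open>p\<close> cliques
  in which a value conflicts with all smaller values in the next clique. The neighbourhoods between two
  cliques are nested, and the cliques are arranged in a graph of girth more than \<open>p\<close>, so no induced cycle of
  length \<open>4, \<dots>, p\<close> arises. The tuples start in a neutral position without constraints, and
  a key token, which has to move along a path on three vertices, can pass the middle vertex only
  while no tuple is neutral.

  All functions involved are built from constants, addition, subtraction and bounded sums, and any term of
  this form can be evaluated in polynomial time on a random access machine.
\<close>

section \<open>Evaluating terms on a random access machine\<close>

text \<open>The number of tokens may depend on the parameter only, so there cannot be a token for
  every gate or for every child of a large gate. This forces certificates of bounded size: the depth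
  bound \<open>d\<close> makes \<open>q\<close> a constant, so the number
  \<open>indices k ^ q\<close> of tuples depends on \<open>k\<close> alone, and whatever grows with
  the circuit goes into the sizes of the cliques. A constraint on \<open>q\<close> variables becomes
  a restriction on the values of one tuple clique, together with equalities. Two cliques in which
  different values conflict contain an induced C4, so equality cannot be enforced directly; a
  conflict of a value with all smaller ones gives nested neighbourhoods. The two opposite
  inequalities close a cycle of constraints, in which no order of moves would be safe. A tuple in
  its neutral position accepts everything, which cuts this cycle: indices, tuples and the key can be
  raised in this order. The term language takes care of the running time: no particular program has
  to be analysed, since every term has a polynomial bound by induction on its structure.\<close>

definition runs :: "com \<Rightarrow> state \<Rightarrow> nat \<Rightarrow> state \<Rightarrow> bool" where
  "runs c s B s' \<longleftrightarrow> (\<exists>T\<le>B. exec c s T s')"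

lemma runs_mono: "runs c s B s' \<Longrightarrow> B \<le> B' \<Longrightarrow> runs c s B' s'"
  unfolding runs_def by (meson le_trans)

lemma runs_Seq: "runs c s B s' \<Longrightarrow> runs c' s' B' s'' \<Longrightarrow> runs (Seq c c') s (B + B') s''"
  unfolding runs_def by (meson add_mono exec.Seq)

lemma runs_Store: "runs (Store b a a') s 1 (s(b := (s b)(aval a s := aval a' s)))"
  unfolding runs_def by (meson exec.Store order_refl)

lemma runs_Cond:
  assumes "aval a s \<noteq> 0 \<Longrightarrow> runs c s B s'" "aval a s = 0 \<Longrightarrow> runs c' s B s'"
  shows "runs (Cond a c c') s (Suc B) s'"
proof (cases "aval a s = 0")
  case True
  with assms(2) obtain T where "T \<le> B" "exec c' s T s'" by (auto simp: runs_def)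
  with True show ?thesis unfolding runs_def using exec.CondFalse by (intro exI[of _ "1 + T"]) auto
next
  case False
  with assms(1) obtain T where "T \<le> B" "exec c s T s'" by (auto simp: runs_def)
  with False show ?thesis unfolding runs_def using exec.CondTrue by (intro exI[of _ "1 + T"]) auto
qed

text \<open>The invariant carries the number of completed iterations, so the guard is known to hold
  exactly \<open>n\<close> times, and the cost is that of \<open>n\<close> bodies and
  \<open>n + 1\<close> tests.\<close>

lemma runs_While_count:
  assumes step: "\<And>j s. j < n \<Longrightarrow> Inv j s \<Longrightarrow> aval a s \<noteq> 0 \<and> (\<exists>s'. runs c s B s' \<and> Inv (Suc j) s')"
    and stop: "\<And>s. Inv n s \<Longrightarrow> aval a s = 0"
    and "Inv 0 s"
  shows "\<exists>s'. runs (While a c) s (n * (B + 1) + 1) s' \<and> Inv n s'"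
proof -
  have "Inv j s \<Longrightarrow> \<exists>s'. runs (While a c) s ((n - j) * (B + 1) + 1) s' \<and> Inv n s'" if "j \<le> n" for j s
    using that
  proof (induction j arbitrary: s rule: inc_induct)
    case base
    from base stop have "aval a s = 0" by blast
    then have "exec (While a c) s 1 s" by (rule exec.WhileFalse)
    then show ?case using base by (intro exI[of _ s]) (auto simp: runs_def)
  next
    case (step j)
    obtain s1 where nz: "aval a s \<noteq> 0" and s1: "runs c s B s1" "Inv (Suc j) s1"
      using assms(1)[OF step.hyps(2) step.prems] by blast
    from step.IH[OF s1(2)] obtain s2 T2 where s2: "Inv n s2" "exec (While a c) s1 T2 s2"
      "T2 \<le> (n - Suc j) * (B + 1) + 1" by (auto simp: runs_def)
    obtain T1 where T1: "T1 \<le> B" "exec c s T1 s1" using s1 by (auto simp: runs_def)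
    have "exec (While a c) s (1 + T1 + T2) s2" using nz T1(2) s2(2) by (rule exec.WhileTrue)
    moreover have "n - j = Suc (n - Suc j)" using step.hyps by simp
    then have "1 + T1 + T2 \<le> (n - j) * (B + 1) + 1" using T1(1) s2(3) by simp
    ultimately show ?case using s2(1) unfolding runs_def by blast
  qed
  from this[of 0 s] assms(3) show ?thesis by simp
qed

text \<open>
  Terms have de Bruijn indices: \<open>Sum t u\<close> binds variable \<open>0\<close> of \<open>u\<close>, and \<open>Pop t\<close> is \<open>t\<close> weakened by
  one variable. In \<open>compile t ad fr\<close>, the variable \<open>i\<close> is kept in register \<open>ad i\<close>, the registers from
  \<open>fr\<close> on are free, and the result is left in register \<open>fr\<close>.
\<close>

datatype tm = Var nat | Num nat | Len | Par | Bit tm | Add tm tm | Sub tm tm | Sum tm tm | Pop tm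

fun tval :: "bool list \<Rightarrow> nat \<Rightarrow> tm \<Rightarrow> (nat \<Rightarrow> nat) \<Rightarrow> nat" where
  "tval x k (Var i) e = e i"
| "tval x k (Num n) e = n"
| "tval x k Len e = length x"
| "tval x k Par e = k"
| "tval x k (Bit t) e = of_bool (tval x k t e < length x \<and> x ! tval x k t e)"
| "tval x k (Add t u) e = tval x k t e + tval x k u e"
| "tval x k (Sub t u) e = tval x k t e - tval x k u e"
| "tval x k (Sum t u) e = (\<Sum>i<tval x k t e. tval x k u (case_nat i e))"
| "tval x k (Pop t) e = tval x k t (\<lambda>i. e (Suc i))"

abbreviation reg :: "nat \<Rightarrow> aexp" where "reg i \<equiv> Load ''e'' (Const i)"
abbreviation set_reg :: "nat \<Rightarrow> aexp \<Rightarrow> com" where "set_reg i \<equiv> Store ''e'' (Const i)"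
abbreviation incr_reg :: "nat \<Rightarrow> com" where "incr_reg i \<equiv> set_reg i (Plus (reg i) (Const 1))"

fun compile :: "tm \<Rightarrow> (nat \<Rightarrow> nat) \<Rightarrow> nat \<Rightarrow> com" where
  "compile (Var i) ad fr = set_reg fr (reg (ad i))"
| "compile (Num n) ad fr = set_reg fr (Const n)"
| "compile Len ad fr = set_reg fr (Load ''n'' (Const 0))"
| "compile Par ad fr = set_reg fr (Load ''k'' (Const 0))"
| "compile (Bit t) ad fr = Seq (compile t ad fr)
     (Cond (Minus (Load ''n'' (Const 0)) (reg fr)) (set_reg fr (Load ''x'' (reg fr))) (set_reg fr (Const 0)))"
| "compile (Add t u) ad fr = Seq (compile t ad fr) (Seq (compile u ad (Suc fr)) (set_reg fr (Plus (reg fr) (reg (Suc fr)))))"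
| "compile (Sub t u) ad fr = Seq (compile t ad fr) (Seq (compile u ad (Suc fr)) (set_reg fr (Minus (reg fr) (reg (Suc fr)))))"
| "compile (Sum t u) ad fr =
     Seq (compile t ad fr) (Seq (set_reg (fr + 1) (Const 0)) (Seq (set_reg (fr + 2) (Const 0))
     (Seq (While (Minus (reg fr) (reg (fr + 1)))
        (Seq (compile u (case_nat (fr + 1) ad) (fr + 3))
        (Seq (set_reg (fr + 2) (Plus (reg (fr + 2)) (reg (fr + 3)))) (incr_reg (fr + 1)))))
     (set_reg fr (reg (fr + 2))))))"
| "compile (Pop t) ad fr = compile t (\<lambda>i. ad (Suc i)) fr"

text \<open>Every de Bruijn index needs a register below \<open>fr\<close>; later all but finitely
  many of them share one register that holds 0. Bank x is fixed only up to the length of the input,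
  because a program that ran before may have left other contents behind it. Hence the code for
  \<open>Bit\<close> tests the index against bank n.\<close>

definition represents :: "bool list \<Rightarrow> nat \<Rightarrow> (nat \<Rightarrow> nat) \<Rightarrow> (nat \<Rightarrow> nat) \<Rightarrow> nat \<Rightarrow> state \<Rightarrow> bool" where
  "represents x k e ad fr s \<longleftrightarrow> (\<forall>i. ad i < fr \<and> s ''e'' (ad i) = e i) \<and> s ''n'' 0 = length x \<and> s ''k'' 0 = k \<and>
     (\<forall>i<length x. s ''x'' i = of_bool (x ! i))"

definition extends :: "nat \<Rightarrow> state \<Rightarrow> state \<Rightarrow> bool" where
  "extends fr s s' \<longleftrightarrow> (\<forall>b. b \<noteq> ''e'' \<longrightarrow> s' b = s b) \<and> (\<forall>i<fr. s' ''e'' i = s ''e'' i)"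

lemma extends_refl: "extends fr s s" by (simp add: extends_def)

lemma extends_trans: "extends fr s s' \<Longrightarrow> extends fr' s' s'' \<Longrightarrow> fr \<le> fr' \<Longrightarrow> extends fr s s''"
  by (simp add: extends_def)

lemma extends_set_reg: "fr \<le> i \<Longrightarrow> extends fr s (s(''e'' := (s ''e'')(i := v)))"
  by (simp add: extends_def)

lemma represents_extends: "represents x k e ad fr s \<Longrightarrow> extends fr s s' \<Longrightarrow> fr \<le> fr' \<Longrightarrow> represents x k e ad fr' s'"
  unfolding represents_def extends_def by (auto intro: less_le_trans)

lemma represents_push:
  "represents x k e ad fr s \<Longrightarrow> i < fr' \<Longrightarrow> fr \<le> fr' \<Longrightarrow>
   represents x k (case_nat (s ''e'' i) e) (case_nat i ad) fr' s"
  unfolding represents_def by (auto split: nat.split intro: less_le_trans)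

lemma represents_pop: "represents x k e ad fr s \<Longrightarrow> represents x k (\<lambda>i. e (Suc i)) (\<lambda>i. ad (Suc i)) fr s"
  unfolding represents_def by auto

section \<open>Polynomial bounds for the evaluation of terms\<close>

text \<open>A single \<open>M\<close> dominates the input length plus the parameter and all
  variables, so that exponents compose: the bound variable of a sum is at most \<open>M ^ c\<close>,
  and the body is evaluated with \<open>M ^ c\<close> in place of \<open>M\<close>. Values and
  running times share one bound because the value of a term may be the number of iterations of a
  loop.\<close>

definition evaluates :: "tm \<Rightarrow> nat \<Rightarrow> bool" where
  "evaluates t c \<longleftrightarrow> (\<forall>x k e ad fr s M. M \<ge> 2 \<longrightarrow> length x + k \<le> M \<longrightarrow> (\<forall>i. e i \<le> M) \<longrightarrow> represents x k e ad fr s \<longrightarrow>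
     tval x k t e \<le> M ^ c \<and>
     (\<exists>s'. runs (compile t ad fr) s (M ^ c) s' \<and> extends fr s s' \<and> s' ''e'' fr = tval x k t e))"

lemma evaluatesD:
  assumes "evaluates t c" "M \<ge> 2" "length x + k \<le> M" "\<And>i. e i \<le> M" "represents x k e ad fr s"
  obtains s' where "tval x k t e \<le> M ^ c" "runs (compile t ad fr) s (M ^ c) s'" "extends fr s s'"
    "s' ''e'' fr = tval x k t e"
  using assms unfolding evaluates_def by blast

lemma evaluates_mono:
  assumes "evaluates t c" "c \<le> c'"
  shows "evaluates t c'"
  unfolding evaluates_def
proof (intro allI impI, goal_cases)
  case (1 x k e ad fr s M)
  obtain s' where "tval x k t e \<le> M ^ c" "runs (compile t ad fr) s (M ^ c) s'" "extends fr s s'"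
    "s' ''e'' fr = tval x k t e" using evaluatesD[OF assms(1) 1(1,2) _ 1(4)] 1(3) by metis
  moreover have "M ^ c \<le> M ^ c'" using assms(2) 1(1) by (intro power_increasing) auto
  ultimately show ?case by (meson le_trans runs_mono)
qed

lemma pow_bound:
  fixes M :: nat
  assumes "M \<ge> 2" "a \<le> M ^ c" "b \<le> M ^ c"
  shows "a + b \<le> M ^ Suc c" 
proof -
  have "a + b \<le> 2 * M ^ c" using assms by simp
  also have "\<dots> \<le> M * M ^ c" using assms by simp
  finally show ?thesis by simp
qed

lemma le_two_power: "(c::nat) \<le> 2 ^ c"
  using less_exp[of c] by simp

lemma const_bound: "M \<ge> 2 \<Longrightarrow> n \<le> M ^ n" for M n :: nat
  by (meson le_trans le_two_power power_mono zero_le_numeral)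

text \<open>Addition and truncated subtraction are both bounded by the sum of the arguments. As
  \<open>M\<close> is at least 2, adding two bounded quantities raises the exponent by one: once for
  the extra instruction, once for the two subterms.\<close>

lemma evaluates_Binop:
  assumes t: "evaluates t c" and u: "evaluates u c"
    and compile: "\<And>ad fr. compile v ad fr = Seq (compile t ad fr) (Seq (compile u ad (Suc fr)) (set_reg fr (f (reg fr) (reg (Suc fr)))))"
    and val: "\<And>x k e. tval x k v e = g (tval x k t e) (tval x k u e)"
    and f: "\<And>a b s. aval (f a b) s = g (aval a s) (aval b s)" and g: "\<And>a b. g a b \<le> a + b"
  shows "evaluates v (c + 2)"
  unfolding evaluates_def
proof (intro allI impI, goal_cases)
  case (1 x k e ad fr s M)
  obtain s1 where s1: "tval x k t e \<le> M ^ c" "runs (compile t ad fr) s (M ^ c) s1" "extends fr s s1"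
    "s1 ''e'' fr = tval x k t e" using evaluatesD[OF t 1(1,2) _ 1(4)] 1(3) by metis
  have "represents x k e ad (Suc fr) s1" using 1(4) s1(3) by (rule represents_extends) simp
  then obtain s2 where s2: "tval x k u e \<le> M ^ c" "runs (compile u ad (Suc fr)) s1 (M ^ c) s2" "extends (Suc fr) s1 s2"
    "s2 ''e'' (Suc fr) = tval x k u e" using evaluatesD[OF u 1(1,2)] 1(3) by metis
  define s3 where "s3 = s2(''e'' := (s2 ''e'')(fr := g (s2 ''e'' fr) (s2 ''e'' (Suc fr))))"
  have r3: "runs (set_reg fr (f (reg fr) (reg (Suc fr)))) s2 1 s3"
    using runs_Store[of "''e''" "Const fr" "f (reg fr) (reg (Suc fr))" s2] by (simp add: s3_def f)
  have p: "1 \<le> M ^ c" using 1(1) by simp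
  have "1 + M ^ c \<le> M ^ Suc c" using pow_bound[OF 1(1) p order_refl] .
  moreover have "M ^ c \<le> M ^ Suc c" using 1(1) by simp
  ultimately have "M ^ c + (1 + M ^ c) \<le> M ^ (c + 2)"
    using pow_bound[OF 1(1), of "M ^ c" "Suc c" "1 + M ^ c"] by simp
  then have "runs (compile v ad fr) s (M ^ (c + 2)) s3"
    using runs_Seq[OF s1(2) runs_Seq[OF s2(2) r3]] unfolding compile by (simp add: runs_mono add.commute add.left_commute)
  moreover have "extends fr s s3" unfolding s3_def
    using s1(3) s2(3) extends_set_reg[of fr fr] by (meson extends_trans order_refl le_SucI)
  moreover have "s2 ''e'' fr = tval x k t e" using s2(3) s1(4) by (simp add: extends_def)
  then have "s3 ''e'' fr = tval x k v e" using s2(4) by (simp add: s3_def val)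
  moreover have "tval x k v e \<le> M ^ (c + 2)"
    using g[of "tval x k t e" "tval x k u e"] s1(1) s2(1) \<open>M ^ c + (1 + M ^ c) \<le> M ^ (c + 2)\<close> by (simp add: val)
  ultimately show ?case by blast
qed

text \<open>There are at most \<open>M ^ c\<close> iterations, and a body costs
  \<open>(M ^ c) ^ c'\<close>, so the exponents multiply. The overhead is absorbed by a factor
  \<open>2 ^ 5\<close>, whence the summand 5. Register \<open>fr\<close> keeps the bound,
  \<open>fr + 1\<close> the counter and \<open>fr + 2\<close> the partial sum.\<close>

lemma evaluates_Sum:
  assumes t: "evaluates t c" and u: "evaluates u c'" and "c \<ge> 1"
  shows "evaluates (Sum t u) (c * c' + c + 5)"
  unfolding evaluates_def
proof (intro allI impI, goal_cases)
  case (1 x k e ad fr s M)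
  let ?n = "tval x k t e" and ?M = "M ^ c"
  obtain s1 where s1: "?n \<le> M ^ c" "runs (compile t ad fr) s (M ^ c) s1" "extends fr s s1"
    "s1 ''e'' fr = ?n" using evaluatesD[OF t 1(1,2) _ 1(4)] 1(3) by metis
  have MM: "M \<le> ?M" using \<open>c \<ge> 1\<close> 1(1) by (simp add: self_le_power)
  have M2: "?M \<ge> 2" and MK: "length x + k \<le> ?M" using MM 1(1,2) by simp_all
  define s2 where "s2 = s1(''e'' := (s1 ''e'')(fr + 1 := 0))"
  define s3 where "s3 = s2(''e'' := (s2 ''e'')(fr + 2 := 0))"
  have r23: "runs (set_reg (fr + 1) (Const 0)) s1 1 s2" "runs (set_reg (fr + 2) (Const 0)) s2 1 s3"
    using runs_Store[of "''e''" "Const (fr + 1)" "Const 0" s1] runs_Store[of "''e''" "Const (fr + 2)" "Const 0" s2]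
    by (simp_all add: s2_def s3_def)
  define F where "F j = (\<Sum>i<j. tval x k u (case_nat i e))" for j
  define Inv where "Inv j s' \<longleftrightarrow> j \<le> ?n \<and> extends fr s s' \<and> s' ''e'' fr = ?n \<and> s' ''e'' (fr + 1) = j \<and> s' ''e'' (fr + 2) = F j" for j s'
  let ?body = "Seq (compile u (case_nat (fr + 1) ad) (fr + 3))
        (Seq (set_reg (fr + 2) (Plus (reg (fr + 2)) (reg (fr + 3)))) (incr_reg (fr + 1)))"
  have Inv0: "Inv 0 s3" using s1(3,4) by (simp add: Inv_def s2_def s3_def extends_def F_def)
  have uval: "tval x k u (case_nat i e) \<le> ?M ^ c'" if "i < ?n" for i
  proof -
    have "case_nat i e l \<le> ?M" for l using that s1(1) 1(3) MM by (auto split: nat.split intro: le_trans)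
    \<comment> \<open>\<open>evaluates\<close> yields a bound on the value only by way of some state
      that represents the environment; storing \<open>i\<close> in register \<open>fr\<close>
      provides one.\<close>
    moreover have "represents x k e ad fr (s(''e'' := (s ''e'')(fr := i)))"
      using 1(4) extends_set_reg[OF order_refl] order_refl by (rule represents_extends)
    from represents_push[OF this, of fr "Suc fr"]
    have "represents x k (case_nat i e) (case_nat fr ad) (Suc fr) (s(''e'' := (s ''e'')(fr := i)))" by simp
    ultimately show ?thesis using evaluatesD[OF u M2 MK] by metis
  qed
  have "\<exists>s4. runs (While (Minus (reg fr) (reg (fr + 1))) ?body) s3 (?n * (?M ^ c' + (1 + 1) + 1) + 1) s4 \<and> Inv ?n s4"
  proof (rule runs_While_count[where Inv = Inv, OF _ _ Inv0])
    fix j s assume j: "j < ?n" and I: "Inv j s"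
    have "represents x k e ad fr s" using 1(4) I represents_extends by (auto simp: Inv_def)
    then have "represents x k (case_nat j e) (case_nat (fr + 1) ad) (fr + 3) s"
      using represents_push[of x k e ad fr s "fr + 1" "fr + 3"] I by (simp add: Inv_def)
    moreover have "case_nat j e l \<le> ?M" for l using j s1(1) 1(3) MM by (auto split: nat.split intro: le_trans)
    ultimately obtain s5 where s5: "runs (compile u (case_nat (fr + 1) ad) (fr + 3)) s (?M ^ c') s5"
      "extends (fr + 3) s s5" "s5 ''e'' (fr + 3) = tval x k u (case_nat j e)"
      using evaluatesD[OF u M2 MK] by metis
    define s6 where "s6 = s5(''e'' := (s5 ''e'')(fr + 2 := s5 ''e'' (fr + 2) + s5 ''e'' (fr + 3)))"
    define s7 where "s7 = s6(''e'' := (s6 ''e'')(fr + 1 := s6 ''e'' (fr + 1) + 1))"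
    have "runs (set_reg (fr + 2) (Plus (reg (fr + 2)) (reg (fr + 3)))) s5 1 s6"
      using runs_Store[of "''e''" "Const (fr + 2)" "Plus (reg (fr + 2)) (reg (fr + 3))" s5] by (simp add: s6_def)
    moreover have "runs (incr_reg (fr + 1)) s6 1 s7"
      using runs_Store[of "''e''" "Const (fr + 1)" "Plus (reg (fr + 1)) (Const 1)" s6] by (simp add: s7_def)
    ultimately have "runs ?body s (?M ^ c' + (1 + 1)) s7" using s5(1) by (intro runs_Seq)
    moreover have "Inv (Suc j) s7"
      using I s5(2,3) j by (simp add: Inv_def s7_def s6_def extends_def F_def)
    ultimately show "aval (Minus (reg fr) (reg (fr + 1))) s \<noteq> 0 \<and> (\<exists>s'. runs ?body s (?M ^ c' + (1 + 1)) s' \<and> Inv (Suc j) s')"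
      using I j by (auto simp: Inv_def)
  qed (simp add: Inv_def)
  then obtain s4 where s4: "runs (While (Minus (reg fr) (reg (fr + 1))) ?body) s3 (?n * (?M ^ c' + (1 + 1) + 1) + 1) s4"
    "Inv ?n s4" by blast
  define s8 where "s8 = s4(''e'' := (s4 ''e'')(fr := s4 ''e'' (fr + 2)))"
  have "runs (set_reg fr (reg (fr + 2))) s4 1 s8"
    using runs_Store[of "''e''" "Const fr" "reg (fr + 2)" s4] by (simp add: s8_def)
  then have r8: "runs (compile (Sum t u) ad fr) s (?M + (1 + (1 + ((?n * (?M ^ c' + (1 + 1) + 1) + 1) + 1)))) s8"
    unfolding compile.simps using runs_Seq[OF s1(2) runs_Seq[OF r23(1) runs_Seq[OF r23(2) runs_Seq[OF s4(1)]]]] by blast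
  have arith: "w \<le> r + 3 * q \<Longrightarrow> q \<le> r \<Longrightarrow> 1 \<le> r \<Longrightarrow> q + (1 + (1 + ((w + 1) + 1))) \<le> 2 ^ 5 * r"
    for w q r :: nat by simp
  define P where "P = M ^ (c * c' + c)"
  have P: "P = M ^ c * ?M ^ c'" by (simp add: P_def power_add power_mult mult.commute)
  have "M ^ c \<le> P" "1 \<le> P" using 1(1) by (auto simp: P_def intro: power_increasing)
  have "?n * (?M ^ c' + (1 + 1) + 1) \<le> M ^ c * (?M ^ c' + (1 + 1) + 1)" using s1(1) by (rule mult_le_mono1)
  also have "\<dots> = P + 3 * M ^ c" by (simp add: P distrib_left)
  finally have "?M + (1 + (1 + ((?n * (?M ^ c' + (1 + 1) + 1) + 1) + 1))) \<le> 2 ^ 5 * P"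
    using \<open>M ^ c \<le> P\<close> \<open>1 \<le> P\<close> arith by blast
  also have "2 ^ 5 * P \<le> M ^ 5 * P" using 1(1) by (intro mult_right_mono power_mono) auto
  also have "\<dots> = M ^ (c * c' + c + 5)" by (simp add: P_def power_add)
  finally have bound: "?M + (1 + (1 + ((?n * (?M ^ c' + (1 + 1) + 1) + 1) + 1))) \<le> M ^ (c * c' + c + 5)" .
  have "F ?n \<le> ?n * ?M ^ c'" unfolding F_def using sum_bounded_above[of "{..<?n}" "\<lambda>i. tval x k u (case_nat i e)" "?M ^ c'"] uval by simp
  also have "\<dots> \<le> ?n * (?M ^ c' + (1 + 1) + 1)" by simp
  also have "\<dots> \<le> M ^ (c * c' + c + 5)" using bound by (meson add_leD1 add_leD2 order_refl)
  finally have "tval x k (Sum t u) e \<le> M ^ (c * c' + c + 5)" by (simp add: F_def)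
  moreover have "runs (compile (Sum t u) ad fr) s (M ^ (c * c' + c + 5)) s8" using r8 bound by (rule runs_mono)
  moreover have "extends fr s s8" "s8 ''e'' fr = tval x k (Sum t u) e" using s4(2) by (auto simp: s8_def Inv_def extends_def F_def)
  ultimately show ?case by blast
qed

lemma evaluates_Bit:
  assumes t: "evaluates t c"
  shows "evaluates (Bit t) (c + 2)"
  unfolding evaluates_def
proof (intro allI impI, goal_cases)
  case (1 x k e ad fr s M)
  obtain s1 where s1: "tval x k t e \<le> M ^ c" "runs (compile t ad fr) s (M ^ c) s1" "extends fr s s1"
    "s1 ''e'' fr = tval x k t e" using evaluatesD[OF t 1(1,2) _ 1(4)] 1(3) by metis
  have rep: "represents x k e ad fr s1" using represents_extends[OF 1(4) s1(3)] by simp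
  define s2 where "s2 = s1(''e'' := (s1 ''e'')(fr := tval x k (Bit t) e))"
  let ?cond = "Cond (Minus (Load ''n'' (Const 0)) (reg fr)) (set_reg fr (Load ''x'' (reg fr))) (set_reg fr (Const 0))"
  have "runs ?cond s1 (Suc 1) s2"
    using runs_Store[of "''e''" "Const fr" "Load ''x'' (reg fr)" s1] runs_Store[of "''e''" "Const fr" "Const 0" s1] rep
    by (intro runs_Cond) (auto simp: s2_def s1(4) represents_def)
  then have r: "runs (compile (Bit t) ad fr) s (M ^ c + Suc 1) s2" using runs_Seq[OF s1(2)] unfolding compile.simps by blast
  have p: "1 \<le> M ^ c" using 1(1) by simp
  then have "M ^ c + Suc 1 \<le> 2 ^ 2 * M ^ c" by simp
  also have "\<dots> \<le> M ^ 2 * M ^ c" using 1(1) by (intro mult_right_mono power_mono) auto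
  finally have b: "M ^ c + Suc 1 \<le> M ^ (c + 2)" by (simp only: power_add mult.commute)
  have "runs (compile (Bit t) ad fr) s (M ^ (c + 2)) s2" using r b by (rule runs_mono)
  moreover have "extends fr s s2" using s1(3) by (auto simp: s2_def extends_def)
  moreover have "tval x k (Bit t) e \<le> M ^ (c + 2)" using b p 1(1) by (simp add: of_bool_def)
  ultimately show ?case by (auto simp: s2_def)
qed

lemma evaluates_set_reg:
  assumes "\<And>ad fr. compile t ad fr = set_reg fr (a ad)" "c \<ge> 1"
    and "\<And>x k e ad fr s. represents x k e ad fr s \<Longrightarrow> aval (a ad) s = tval x k t e"
    and "\<And>x k e M. 2 \<le> M \<Longrightarrow> length x + k \<le> M \<Longrightarrow> (\<And>i. e i \<le> M) \<Longrightarrow> tval x k t e \<le> M ^ c"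
  shows "\<exists>c\<ge>1. evaluates t c"
proof -
  have "evaluates t c"
    unfolding evaluates_def
  proof (intro allI impI, goal_cases)
    case (1 x k e ad fr s M)
    have "tval x k t e \<le> M ^ c" using assms(4)[OF 1(1,2)] 1(3) by blast
    moreover have "1 \<le> M ^ c" using 1(1) by simp
    then have "runs (compile t ad fr) s (M ^ c) (s(''e'' := (s ''e'')(fr := tval x k t e)))"
      using runs_Store[of "''e''" "Const fr" "a ad" s] by (simp add: assms(1) assms(3)[OF 1(4)] runs_mono)
    ultimately show ?case by (intro conjI exI[of _ "s(''e'' := (s ''e'')(fr := tval x k t e))"]) (auto simp: extends_def)
  qed
  with assms(2) show ?thesis by blast
qed

lemma evaluates_ex: "\<exists>c\<ge>1. evaluates t c"
proof (induction t)
  case (Var i)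
  show ?case by (rule evaluates_set_reg[of _ "\<lambda>ad. reg (ad i)" 1]) (auto simp: represents_def)
next
  case (Num n)
  \<comment> \<open>\<open>Suc n\<close> instead of \<open>n\<close> keeps the exponent positive for
    \<open>n = 0\<close>, as required by \<open>evaluates_Sum\<close>.\<close>
  have "n \<le> M ^ Suc n" if "2 \<le> M" for M :: nat using const_bound[OF that, of "Suc n"] by linarith
  then show ?case by (intro evaluates_set_reg[of _ "\<lambda>_. Const n" "Suc n"]) auto
next
  case Len
  show ?case by (rule evaluates_set_reg[of _ "\<lambda>_. Load ''n'' (Const 0)" 1]) (auto simp: represents_def)
next
  case Par
  show ?case by (rule evaluates_set_reg[of _ "\<lambda>_. Load ''k'' (Const 0)" 1]) (auto simp: represents_def)
next
  case (Bit t)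
  then show ?case using evaluates_Bit[of t] by (meson le_add2 le_trans one_le_numeral)
next
  case (Add t u)
  then obtain c c' where "evaluates t c" "evaluates u c'" by blast
  then have "evaluates t (c + c')" "evaluates u (c + c')" by (auto intro: evaluates_mono)
  then have "evaluates (Add t u) (c + c' + 2)" by (rule evaluates_Binop[where f = Plus]) auto
  then show ?case by (intro exI[of _ "c + c' + 2"]) simp
next
  case (Sub t u)
  then obtain c c' where "evaluates t c" "evaluates u c'" by blast
  then have "evaluates t (c + c')" "evaluates u (c + c')" by (auto intro: evaluates_mono)
  then have "evaluates (Sub t u) (c + c' + 2)" by (rule evaluates_Binop[where f = Minus]) auto
  then show ?case by (intro exI[of _ "c + c' + 2"]) simp
next
  case (Sum t u)
  then obtain c c' where "c \<ge> 1" "evaluates t c" "evaluates u c'" by blast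
  then show ?case using evaluates_Sum[of t c u c'] by (intro exI[of _ "c * c' + c + 5"]) simp
next
  case (Pop t)
  then obtain c where c: "c \<ge> 1" "evaluates t c" by blast
  have "evaluates (Pop t) c"
    unfolding evaluates_def
  proof (intro allI impI, goal_cases)
    case (1 x k e ad fr s M)
    have "\<And>i. e (Suc i) \<le> M" using 1(3) by blast
    from evaluatesD[OF c(2) 1(1,2) this represents_pop[OF 1(4)]] show ?case by auto
  qed
  with c(1) show ?case by blast
qed

section \<open>Programs that write a definable output\<close>

text \<open>The output is collected in a separate bank and copied at the end, because
  \<open>bt\<close> reads the input for every output position; for the same reason the new parameter
  is computed before banks n and k are overwritten. Register 0 holds 0 and stands for all variables
  except the output position in register 4.\<close>

definition output_prog :: "tm \<Rightarrow> tm \<Rightarrow> tm \<Rightarrow> com" where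
  "output_prog lt bt kt =
     Seq (set_reg 0 (Const 0)) (Seq (compile lt (\<lambda>_. 0) 3) (Seq (set_reg 4 (Const 0))
     (Seq (While (Minus (reg 3) (reg 4))
        (Seq (compile bt (case_nat 4 (\<lambda>_. 0)) 6) (Seq (Store ''out'' (reg 4) (reg 6)) (incr_reg 4))))
     (Seq (compile kt (\<lambda>_. 0) 5) (Seq (set_reg 4 (Const 0))
     (Seq (While (Minus (reg 3) (reg 4)) (Seq (Store ''x'' (reg 4) (Load ''out'' (reg 4))) (incr_reg 4)))
     (Seq (Store ''n'' (Const 0) (reg 3)) (Store ''k'' (Const 0) (reg 5)))))))))"

lemma runs_StoreI: "s' = s(b := (s b)(aval a s := aval a' s)) \<Longrightarrow> runs (Store b a a') s 1 s'"
  using runs_Store by simp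

text \<open>The precondition is \<open>holds_output\<close> and not \<open>init_state\<close>: the
  program runs after an arbitrary reduction and has to cope with whatever that leaves in the other
  banks and cells.\<close>

lemma output_prog_correct:
  "\<exists>c. \<forall>x k s y. holds_output s x k \<longrightarrow> length y = tval x k lt (\<lambda>_. 0) \<longrightarrow>
     (\<forall>i<length y. tval x k bt (case_nat i (\<lambda>_. 0)) = of_bool (y ! i)) \<longrightarrow>
     (\<exists>t s'. exec (output_prog lt bt kt) s t s' \<and> holds_output s' y (tval x k kt (\<lambda>_. 0)) \<and>
        t + length y \<le> (length x + k + 2) ^ c)"
proof -
  obtain cl cb ck where cl: "evaluates lt cl" "cl \<ge> 1" and cb: "evaluates bt cb" and ck: "evaluates kt ck"
    using evaluates_ex by metis
  define c where "c = (cl + cl * cb + ck) + 5"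
  have main: "\<exists>t s'. exec (output_prog lt bt kt) s t s' \<and> holds_output s' y (tval x k kt (\<lambda>_. 0)) \<and>
        t + length y \<le> (length x + k + 2) ^ c"
    if s: "holds_output s x k" and len: "length y = tval x k lt (\<lambda>_. 0)"
      and bits: "\<forall>i<length y. tval x k bt (case_nat i (\<lambda>_. 0)) = of_bool (y ! i)" for x k s y
  proof -
    define M where "M = length x + k + 2"
    let ?e = "\<lambda>_::nat. 0::nat" and ?n = "length y"
    have M2: "M \<ge> 2" by (simp add: M_def)
    have eM: "?e i \<le> M" for i :: nat by (simp add: M_def)
    have out: "s ''n'' 0 = length x" "s ''k'' 0 = k" "\<forall>i<length x. s ''x'' i = of_bool (x ! i)"
      using s by (auto simp: holds_output_def)
    have MK: "length x + k \<le> M" by (simp add: M_def)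
    define s1 where "s1 = s(''e'' := (s ''e'')(0 := 0))"
    have r1: "runs (set_reg 0 (Const 0)) s 1 s1" by (rule runs_StoreI) (simp add: s1_def)
    have rep1: "represents x k ?e (\<lambda>_. 0) 3 s1" by (simp add: represents_def s1_def out)
    obtain s2 where s2: "?n \<le> M ^ cl" "runs (compile lt (\<lambda>_. 0) 3) s1 (M ^ cl) s2" "extends 3 s1 s2" "s2 ''e'' 3 = ?n"
      using evaluatesD[OF cl(1) M2 MK eM rep1] unfolding len by blast
    define s3 where "s3 = s2(''e'' := (s2 ''e'')(4 := 0))"
    have r3: "runs (set_reg 4 (Const 0)) s2 1 s3" by (rule runs_StoreI) (simp add: s3_def)
    define Inv where "Inv j s' \<longleftrightarrow> j \<le> ?n \<and> represents x k ?e (\<lambda>_. 0) 3 s' \<and> s' ''e'' 3 = ?n \<and> s' ''e'' 4 = j \<and>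
      (\<forall>i<j. s' ''out'' i = of_bool (y ! i))" for j s'
    let ?body = "Seq (compile bt (case_nat 4 (\<lambda>_. 0)) 6) (Seq (Store ''out'' (reg 4) (reg 6)) (incr_reg 4))"
    have "represents x k ?e (\<lambda>_. 0) 3 s2" using rep1 s2(3) by (rule represents_extends) simp
    moreover have "extends 3 s2 s3" unfolding s3_def by (rule extends_set_reg) simp
    ultimately have "represents x k ?e (\<lambda>_. 0) 3 s3" by (rule represents_extends) simp
    then have Inv0: "Inv 0 s3" using s2(4) by (simp add: Inv_def s3_def)
    have MM: "M \<le> M ^ cl" using cl(2) M2 by (simp add: self_le_power)
    have "\<exists>s4. runs (While (Minus (reg 3) (reg 4)) ?body) s3 (?n * ((M ^ cl) ^ cb + (1 + 1) + 1) + 1) s4 \<and> Inv ?n s4"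
    proof (rule runs_While_count[where Inv = Inv, OF _ _ Inv0])
      fix j s assume j: "j < ?n" and I: "Inv j s"
      have rep: "represents x k (case_nat j ?e) (case_nat 4 (\<lambda>_. 0)) 6 s"
        using represents_push[of x k ?e "\<lambda>_. 0" 3 s 4 6] I by (simp add: Inv_def)
      have le: "case_nat j ?e l \<le> M ^ cl" for l
        using j s2(1) order_trans[OF eM MM] by (cases l) auto
      have "M ^ cl \<ge> 2" "length x + k \<le> M ^ cl" using M2 MK MM by (meson order_trans)+
      from evaluatesD[OF cb this le rep] obtain s5 where s5: "runs (compile bt (case_nat 4 (\<lambda>_. 0)) 6) s ((M ^ cl) ^ cb) s5"
        "extends 6 s s5" "s5 ''e'' 6 = tval x k bt (case_nat j ?e)" .
      have s5b: "s5 ''e'' 6 = of_bool (y ! j)" using s5(3) bits j by simp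
      define s6 where "s6 = s5(''out'' := (s5 ''out'')(j := of_bool (y ! j)))"
      define s7 where "s7 = s6(''e'' := (s6 ''e'')(4 := Suc j))"
      have j4: "s5 ''e'' 4 = j" "s6 ''e'' 4 = j" using s5(2) I by (auto simp: extends_def Inv_def s6_def)
      have "runs (Store ''out'' (reg 4) (reg 6)) s5 1 s6"
        by (rule runs_StoreI) (simp add: s6_def j4 s5b)
      moreover have "runs (incr_reg 4) s6 1 s7" by (rule runs_StoreI) (simp add: s7_def j4)
      ultimately have "runs ?body s ((M ^ cl) ^ cb + (1 + 1)) s7" using s5(1) by (intro runs_Seq)
      moreover have "Inv (Suc j) s7"
        using I s5(2) j by (auto simp: Inv_def s7_def s6_def extends_def represents_def less_Suc_eq)
      ultimately show "aval (Minus (reg 3) (reg 4)) s \<noteq> 0 \<and> (\<exists>s'. runs ?body s ((M ^ cl) ^ cb + (1 + 1)) s' \<and> Inv (Suc j) s')"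
        using I j by (auto simp: Inv_def)
    qed (simp add: Inv_def)
    then obtain s4 where s4: "runs (While (Minus (reg 3) (reg 4)) ?body) s3 (?n * ((M ^ cl) ^ cb + (1 + 1) + 1) + 1) s4"
      and I4: "Inv ?n s4" by blast
    have rep4: "represents x k ?e (\<lambda>_. 0) 5 s4" using I4 represents_extends[OF _ extends_refl, of x k ?e "\<lambda>_. 0" 3 s4 5] by (simp add: Inv_def)
    from evaluatesD[OF ck M2 MK eM rep4] obtain s5
      where s5: "runs (compile kt (\<lambda>_. 0) 5) s4 (M ^ ck) s5" "extends 5 s4 s5" "s5 ''e'' 5 = tval x k kt ?e" .
    define s6 where "s6 = s5(''e'' := (s5 ''e'')(4 := 0))"
    have r6: "runs (set_reg 4 (Const 0)) s5 1 s6" by (rule runs_StoreI) (simp add: s6_def)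
    define Jnv where "Jnv j s' \<longleftrightarrow> j \<le> ?n \<and> s' ''e'' 3 = ?n \<and> s' ''e'' 4 = j \<and> s' ''e'' 5 = tval x k kt ?e \<and>
      (\<forall>i<?n. s' ''out'' i = of_bool (y ! i)) \<and> (\<forall>i<j. s' ''x'' i = of_bool (y ! i))" for j s'
    have Jnv0: "Jnv 0 s6" using I4 s5(2,3) by (auto simp: Inv_def Jnv_def s6_def extends_def)
    let ?copy = "Seq (Store ''x'' (reg 4) (Load ''out'' (reg 4))) (incr_reg 4)"
    have "\<exists>s7. runs (While (Minus (reg 3) (reg 4)) ?copy) s6 (?n * ((1 + 1) + 1) + 1) s7 \<and> Jnv ?n s7"
    proof (rule runs_While_count[where Inv = Jnv, OF _ _ Jnv0])
      fix j s assume j: "j < ?n" and J: "Jnv j s"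
      define s7 where "s7 = s(''x'' := (s ''x'')(j := of_bool (y ! j)))"
      define s8 where "s8 = s7(''e'' := (s7 ''e'')(4 := Suc j))"
      have "runs (Store ''x'' (reg 4) (Load ''out'' (reg 4))) s 1 s7"
        by (rule runs_StoreI) (use J j in \<open>simp add: s7_def Jnv_def\<close>)
      moreover have "runs (incr_reg 4) s7 1 s8"
        by (rule runs_StoreI) (use J in \<open>simp add: s7_def s8_def Jnv_def\<close>)
      ultimately have "runs ?copy s (1 + 1) s8" by (rule runs_Seq)
      moreover have "Jnv (Suc j) s8" using J j by (auto simp: Jnv_def s7_def s8_def less_Suc_eq)
      ultimately show "aval (Minus (reg 3) (reg 4)) s \<noteq> 0 \<and> (\<exists>s'. runs ?copy s (1 + 1) s' \<and> Jnv (Suc j) s')"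
        using J j by (auto simp: Jnv_def)
    qed (simp add: Jnv_def)
    then obtain s7 where s7: "runs (While (Minus (reg 3) (reg 4)) ?copy) s6 (?n * ((1 + 1) + 1) + 1) s7" "Jnv ?n s7" by blast
    define s8 where "s8 = s7(''n'' := (s7 ''n'')(0 := ?n))"
    define s9 where "s9 = s8(''k'' := (s8 ''k'')(0 := tval x k kt ?e))"
    have r8: "runs (Store ''n'' (Const 0) (reg 3)) s7 1 s8" "runs (Store ''k'' (Const 0) (reg 5)) s8 1 s9"
      by (rule runs_StoreI; use s7(2) in \<open>simp add: s8_def s9_def Jnv_def\<close>)+
    let ?T = "1 + (M ^ cl + (1 + ((?n * ((M ^ cl) ^ cb + (1 + 1) + 1) + 1) + (M ^ ck + (1 + ((?n * ((1 + 1) + 1) + 1) + (1 + 1)))))))"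
    have "runs (output_prog lt bt kt) s ?T s9"
      unfolding output_prog_def
      using runs_Seq[OF r1 runs_Seq[OF s2(2) runs_Seq[OF r3 runs_Seq[OF s4 runs_Seq[OF s5(1) runs_Seq[OF r6 runs_Seq[OF s7(1) runs_Seq[OF r8]]]]]]]] by blast
    then obtain t where t: "t \<le> ?T" "exec (output_prog lt bt kt) s t s9" by (auto simp: runs_def)
    define P where "P = M ^ (cl + cl * cb + ck)"
    have "?n * ((M ^ cl) ^ cb + (1 + 1) + 1) \<le> M ^ cl * ((M ^ cl) ^ cb + (1 + 1) + 1)" using s2(1) by (rule mult_le_mono1)
    also have "\<dots> = M ^ cl * (M ^ cl) ^ cb + 3 * M ^ cl" by (simp add: distrib_left)
    finally have nQ: "?n * ((M ^ cl) ^ cb + (1 + 1) + 1) \<le> M ^ cl * (M ^ cl) ^ cb + 3 * M ^ cl" .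
    have "M ^ cl * (M ^ cl) ^ cb = M ^ (cl + cl * cb)" by (simp only: power_add power_mult)
    then have "M ^ cl * (M ^ cl) ^ cb \<le> P" "M ^ cl \<le> P" "M ^ ck \<le> P" "1 \<le> P"
      using M2 unfolding P_def by (simp_all add: power_increasing del: power_Suc)
    moreover have "a \<le> b + 3 * l \<Longrightarrow> n \<le> l \<Longrightarrow> b \<le> p \<Longrightarrow> l \<le> p \<Longrightarrow> d \<le> p \<Longrightarrow> 1 \<le> p \<Longrightarrow>
      1 + (l + (1 + ((a + 1) + (d + (1 + ((n * ((1 + 1) + 1) + 1) + (1 + 1))))))) + n \<le> 2 ^ 5 * p"
      for a b d l n p :: nat by simp
    ultimately have "?T + ?n \<le> 2 ^ 5 * P" using nQ s2(1) by blast
    also have "2 ^ 5 * P \<le> M ^ 5 * P" using M2 by (intro mult_right_mono power_mono) auto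
    also have "\<dots> = M ^ c" by (simp add: P_def c_def power_add)
    finally have "t + ?n \<le> M ^ c" using t(1) by (meson add_le_mono1 le_trans)
    moreover have "holds_output s9 y (tval x k kt ?e)"
      using s7(2) by (simp add: holds_output_def s8_def s9_def Jnv_def)
    ultimately show ?thesis using t(2) unfolding M_def by blast
  qed
  then show ?thesis by blast
qed

section \<open>Renaming of banks and combination of computable functions\<close>

fun rename_aexp :: "(bank \<Rightarrow> bank) \<Rightarrow> aexp \<Rightarrow> aexp" where
  "rename_aexp r (Const n) = Const n"
| "rename_aexp r (Load b a) = Load (r b) (rename_aexp r a)"
| "rename_aexp r (Plus a a') = Plus (rename_aexp r a) (rename_aexp r a')"
| "rename_aexp r (Minus a a') = Minus (rename_aexp r a) (rename_aexp r a')"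

fun rename_com :: "(bank \<Rightarrow> bank) \<Rightarrow> com \<Rightarrow> com" where
  "rename_com r Skip = Skip"
| "rename_com r (Store b a a') = Store (r b) (rename_aexp r a) (rename_aexp r a')"
| "rename_com r (Seq c c') = Seq (rename_com r c) (rename_com r c')"
| "rename_com r (Cond a c c') = Cond (rename_aexp r a) (rename_com r c) (rename_com r c')"
| "rename_com r (While a c) = While (rename_aexp r a) (rename_com r c)"

lemma aval_rename: "aval (rename_aexp r a) s = aval a (s \<circ> r)"
  by (induction a) auto

text \<open>The renamed program acts on \<open>range r\<close> as the original one acts on all
  banks. That it leaves the other banks alone allows two programs to run one after the other without
  interference.\<close>

lemma exec_rename:
  assumes "exec c s t s'" "inj r" "s = \<sigma> \<circ> r"
  shows "\<exists>\<sigma>'. exec (rename_com r c) \<sigma> t \<sigma>' \<and> s' = \<sigma>' \<circ> r \<and> (\<forall>b. b \<notin> range r \<longrightarrow> \<sigma>' b = \<sigma> b)"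
  using assms
proof (induction arbitrary: \<sigma> rule: exec.induct)
  case (Skip s)
  then show ?case by (intro exI[of _ \<sigma>] conjI) (simp_all add: exec.Skip del: One_nat_def)
next
  case (Store b a a' s)
  have "(s(b := (s b)(aval a s := aval a' s))) = (\<sigma>(r b := (\<sigma> (r b))(aval a s := aval a' s))) \<circ> r"
    using Store by (auto simp: fun_eq_iff inj_eq)
  moreover have "exec (rename_com r (Store b a a')) \<sigma> 1 (\<sigma>(r b := (\<sigma> (r b))(aval a s := aval a' s)))"
    using exec.Store[of "r b" "rename_aexp r a" "rename_aexp r a'" \<sigma>] Store by (simp add: aval_rename o_def)
  ultimately show ?case by force
next
  case (Seq c s t s' c' t' s'')
  obtain \<sigma>1 where 1: "exec (rename_com r c) \<sigma> t \<sigma>1" "s' = \<sigma>1 \<circ> r" "\<forall>b. b \<notin> range r \<longrightarrow> \<sigma>1 b = \<sigma> b"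
    using Seq by blast
  obtain \<sigma>2 where 2: "exec (rename_com r c') \<sigma>1 t' \<sigma>2" "s'' = \<sigma>2 \<circ> r" "\<forall>b. b \<notin> range r \<longrightarrow> \<sigma>2 b = \<sigma>1 b"
    using Seq.IH(2)[OF Seq.prems(1) 1(2)] by blast
  show ?case using exec.Seq[OF 1(1) 2(1)] 1(3) 2(2,3) by (intro exI[of _ \<sigma>2]) auto
next
  case (CondTrue a s c t s' c')
  then obtain \<sigma>1 where 1: "exec (rename_com r c) \<sigma> t \<sigma>1" "s' = \<sigma>1 \<circ> r" "\<forall>b. b \<notin> range r \<longrightarrow> \<sigma>1 b = \<sigma> b"
    by blast
  have "aval (rename_aexp r a) \<sigma> \<noteq> 0" using CondTrue by (simp add: aval_rename o_def)
  from exec.CondTrue[OF this 1(1)] show ?case using 1(2,3) by auto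
next
  case (CondFalse a s c' t s' c)
  then obtain \<sigma>1 where 1: "exec (rename_com r c') \<sigma> t \<sigma>1" "s' = \<sigma>1 \<circ> r" "\<forall>b. b \<notin> range r \<longrightarrow> \<sigma>1 b = \<sigma> b"
    by blast
  have "aval (rename_aexp r a) \<sigma> = 0" using CondFalse by (simp add: aval_rename o_def)
  from exec.CondFalse[OF this 1(1)] show ?case using 1(2,3) by auto
next
  case (WhileFalse a s c)
  have "aval (rename_aexp r a) \<sigma> = 0" using WhileFalse by (simp add: aval_rename o_def)
  from exec.WhileFalse[OF this] show ?case using WhileFalse by auto
next
  case (WhileTrue a s c t s' t' s'')
  obtain \<sigma>1 where 1: "exec (rename_com r c) \<sigma> t \<sigma>1" "s' = \<sigma>1 \<circ> r" "\<forall>b. b \<notin> range r \<longrightarrow> \<sigma>1 b = \<sigma> b"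
    using WhileTrue by blast
  obtain \<sigma>2 where 2: "exec (rename_com r (While a c)) \<sigma>1 t' \<sigma>2" "s'' = \<sigma>2 \<circ> r" "\<forall>b. b \<notin> range r \<longrightarrow> \<sigma>2 b = \<sigma>1 b"
    using WhileTrue.IH(2)[OF WhileTrue.prems(1) 1(2)] by blast
  have "aval (rename_aexp r a) \<sigma> \<noteq> 0" using WhileTrue by (simp add: aval_rename o_def)
  from exec.WhileTrue[OF this 1(1)] 2 1(3) show ?case by (intro exI[of _ \<sigma>2]) auto
qed

lemma inj_Cons: "inj ((#) c)" by (simp add: inj_def)

definition env0 :: "nat \<Rightarrow> nat \<Rightarrow> nat \<Rightarrow> nat" where
  "env0 a b = (\<lambda>_. 0)(0 := a, 1 := b)"

lemma represents_env0:
  assumes "s ''n'' 0 = 0" "s ''k'' 0 = k" "s ''e'' 0 = a" "s ''e'' 1 = b" "s ''e'' 2 = 0"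
  shows "represents [] k (env0 a b) (\<lambda>i. min i 2) 3 s"
  using assms unfolding represents_def
  by (auto simp: env0_def min_def numeral_2_eq_2 le_Suc_eq)

text \<open>Both programs need the initial state for \<open>k\<close>, which the first run would
  spoil. Prefixing all bank names by a or b separates the runs. Their results end up in banks ak and
  bk and become variables 0 and 1; all further variables read register 2, which holds 0.\<close>

lemma computable_combine:
  assumes f: "computable f" and g: "computable g"
  shows "computable (\<lambda>k. tval [] k t (env0 (f k) (g k)))"
proof -
  let ?a = "(#) CHR ''a'' :: bank \<Rightarrow> bank" and ?b = "(#) CHR ''b'' :: bank \<Rightarrow> bank"
  obtain cf where cf: "\<And>k. \<exists>t s. exec cf (init_state [] k) t s \<and> s ''k'' 0 = f k" using f by (auto simp: computable_def)
  obtain cg where cg: "\<And>k. \<exists>t s. exec cg (init_state [] k) t s \<and> s ''k'' 0 = g k" using g by (auto simp: computable_def)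
  let ?c = "Seq (Store ''ak'' (Const 0) (Load ''k'' (Const 0))) (Seq (Store ''bk'' (Const 0) (Load ''k'' (Const 0)))
    (Seq (rename_com ?a cf) (Seq (rename_com ?b cg) (Seq (set_reg 0 (Load ''ak'' (Const 0))) (Seq (set_reg 1 (Load ''bk'' (Const 0)))
    (Seq (set_reg 2 (Const 0)) (Seq (compile t (\<lambda>i. min i 2) 3) (Store ''k'' (Const 0) (reg 3)))))))))"
  obtain c where c: "evaluates t c" using evaluates_ex by blast
  have "\<exists>T s. exec ?c (init_state [] k) T s \<and> s ''k'' 0 = tval [] k t (env0 (f k) (g k))" for k
  proof -
    obtain Tf sf where sf: "exec cf (init_state [] k) Tf sf" "sf ''k'' 0 = f k" using cf by blast
    obtain Tg sg where sg: "exec cg (init_state [] k) Tg sg" "sg ''k'' 0 = g k" using cg by blast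
    define s1 where "s1 = (init_state [] k)(''ak'' := (\<lambda>_. 0)(0 := k))"
    define s2 where "s2 = s1(''bk'' := (\<lambda>_. 0)(0 := k))"
    have r1: "exec (Store ''ak'' (Const 0) (Load ''k'' (Const 0))) (init_state [] k) 1 s1"
      using exec.Store[of "''ak''" "Const 0" "Load ''k'' (Const 0)" "init_state [] k"] by (simp add: s1_def init_state_def)
    have r2: "exec (Store ''bk'' (Const 0) (Load ''k'' (Const 0))) s1 1 s2"
      using exec.Store[of "''bk''" "Const 0" "Load ''k'' (Const 0)" s1] by (simp add: s1_def s2_def init_state_def)
    \<comment> \<open>For the empty input only cell 0 of bank k can differ from 0, so a copy of
      \<open>k\<close> turns the banks with prefix a into an initial state.\<close>
    have "init_state [] k = s2 \<circ> ?a" by (simp add: fun_eq_iff s2_def s1_def init_state_def)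
    then obtain s3 where s3: "exec (rename_com ?a cf) s2 Tf s3" "sf = s3 \<circ> ?a" "\<forall>b. b \<notin> range ?a \<longrightarrow> s3 b = s2 b"
      using exec_rename[OF sf(1) inj_Cons] by blast
    have "?b x \<notin> range ?a" for x by auto
    then have "s3 (?b x) = s2 (?b x)" for x using s3(3) by blast
    then have "s3 \<circ> ?b = s2 \<circ> ?b" by (simp add: fun_eq_iff)
    also have "\<dots> = init_state [] k" by (simp add: fun_eq_iff s2_def s1_def init_state_def)
    finally have "init_state [] k = s3 \<circ> ?b" ..
    then obtain s4 where s4: "exec (rename_com ?b cg) s3 Tg s4" "sg = s4 \<circ> ?b" "\<forall>b. b \<notin> range ?b \<longrightarrow> s4 b = s3 b"
      using exec_rename[OF sg(1) inj_Cons] by blast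
    have "''ak'' \<notin> range ?b" by auto
    then have "s4 ''ak'' = s3 ''ak''" using s4(3) by blast
    then have ab: "s4 ''ak'' 0 = f k" "s4 ''bk'' 0 = g k" using s3(2) s4(2) sf(2) sg(2) by simp_all
    have "''n'' \<notin> range ?a" "''n'' \<notin> range ?b" by auto
    then have "s4 ''n'' = s3 ''n''" "s3 ''n'' = s2 ''n''" using s4(3) s3(3) by blast+
    then have n: "s4 ''n'' 0 = 0" by (simp add: s2_def s1_def init_state_def)
    have "''k'' \<notin> range ?a" "''k'' \<notin> range ?b" by auto
    then have "s4 ''k'' = s3 ''k''" "s3 ''k'' = s2 ''k''" using s4(3) s3(3) by blast+
    then have k: "s4 ''k'' 0 = k" by (simp add: s2_def s1_def init_state_def)
    define s5 where "s5 = s4(''e'' := (s4 ''e'')(0 := f k))"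
    define s6 where "s6 = s5(''e'' := (s5 ''e'')(1 := g k))"
    define s7 where "s7 = s6(''e'' := (s6 ''e'')(2 := 0))"
    have r5: "exec (set_reg 0 (Load ''ak'' (Const 0))) s4 1 s5"
      using exec.Store[of "''e''" "Const 0" "Load ''ak'' (Const 0)" s4] by (simp add: s5_def ab)
    have r6: "exec (set_reg 1 (Load ''bk'' (Const 0))) s5 1 s6"
      using exec.Store[of "''e''" "Const 1" "Load ''bk'' (Const 0)" s5] by (simp add: s5_def s6_def ab)
    have r7: "exec (set_reg 2 (Const 0)) s6 1 s7"
      using exec.Store[of "''e''" "Const 2" "Const 0" s6] by (simp add: s7_def)
    have rep: "represents [] k (env0 (f k) (g k)) (\<lambda>i. min i 2) 3 s7"
      by (rule represents_env0) (simp_all add: s7_def s6_def s5_def n k)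
    have M: "2 \<le> f k + g k + k + 2" "length [] + k \<le> f k + g k + k + 2" by simp_all
    have "env0 (f k) (g k) i \<le> f k + g k + k + 2" for i by (simp add: env0_def)
    from evaluatesD[OF c M this rep] obtain T8 s8
      where s8: "exec (compile t (\<lambda>i. min i 2) 3) s7 T8 s8" "s8 ''e'' 3 = tval [] k t (env0 (f k) (g k))"
      unfolding runs_def by blast
    have r9: "exec (Store ''k'' (Const 0) (reg 3)) s8 1 (s8(''k'' := (s8 ''k'')(0 := s8 ''e'' 3)))"
      using exec.Store[of "''k''" "Const 0" "reg 3" s8] by simp
    from exec.Seq[OF r1 exec.Seq[OF r2 exec.Seq[OF s3(1) exec.Seq[OF s4(1) exec.Seq[OF r5 exec.Seq[OF r6 exec.Seq[OF r7 exec.Seq[OF s8(1) r9]]]]]]]]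
    show ?thesis by (intro exI conjI) (assumption, simp add: s8(2))
  qed
  then show ?thesis unfolding computable_def by blast
qed

section \<open>Token sliding on chains of cliques\<close>

text \<open>The vertices before \<open>u 0\<close> and after \<open>u 1\<close> are not in
  \<open>X\<close>, as the clique \<open>X\<close> would provide a chord. So both are in
  \<open>Y\<close> and adjacent, which leaves only \<open>n = 4\<close>, and there the nested
  neighbourhoods between \<open>X\<close> and \<open>Y\<close> provide a chord.\<close>

lemma no_cycle_aux:
  fixes u :: "nat \<Rightarrow> 'v" and cls :: "'v \<Rightarrow> 'c"
  assumes n: "n \<ge> 4"
    and adj: "\<And>i j. i < n \<Longrightarrow> j < n \<Longrightarrow> {u i, u j} \<in> E \<longleftrightarrow> j = Suc i mod n \<or> i = Suc j mod n"
    and same: "\<And>i j. i < n \<Longrightarrow> j < n \<Longrightarrow> i \<noteq> j \<Longrightarrow> cls (u i) = cls (u j) \<Longrightarrow> {u i, u j} \<in> E"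
    and nb: "\<And>i j. i < n \<Longrightarrow> j < n \<Longrightarrow> cls (u i) = X \<Longrightarrow> {u i, u j} \<in> E \<Longrightarrow> cls (u j) \<in> {X, Y}"
    and chain: "\<And>i i' j j'. i < n \<Longrightarrow> i' < n \<Longrightarrow> j < n \<Longrightarrow> j' < n \<Longrightarrow> cls (u i) = cls (u i') \<Longrightarrow>
      cls (u j) = cls (u j') \<Longrightarrow> cls (u i) \<noteq> cls (u j) \<Longrightarrow> {u i, u j} \<in> E \<Longrightarrow> {u i', u j'} \<in> E \<Longrightarrow>
      {u i, u j'} \<in> E \<or> {u i', u j} \<in> E"
    and X: "cls (u 0) = X" "cls (u 1) = X"
  shows False
proof -
  have "cls (u 2) \<in> {X, Y}" using n by (intro nb[of 1]) (auto simp: adj X[simplified] X)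
  moreover have "cls (u 2) \<noteq> X" using same[of 0 2] n by (auto simp: adj X mod_Suc)
  ultimately have 2: "cls (u 2) = Y" "X \<noteq> Y" by auto
  have "cls (u (n - 1)) \<in> {X, Y}" using n by (intro nb[of 0]) (auto simp: adj X mod_Suc)
  moreover have "{u 1, u (n - 1)} \<notin> E" using n by (simp add: adj mod_Suc)
  then have "cls (u (n - 1)) \<noteq> X" using same[of 1 "n - 1"] n X by fastforce
  ultimately have "cls (u (n - 1)) = Y" by auto
  with 2 have "{u 2, u (n - 1)} \<in> E" using same[of 2 "n - 1"] n by auto
  with n have "n = 4" by (auto simp: adj mod_Suc split: if_splits)
  then have "{u 0, u 2} \<in> E \<or> {u 1, u 3} \<in> E"
    using chain[of 0 1 3 2] X 2 \<open>cls (u (n - 1)) = Y\<close> by (auto simp: adj mod_Suc)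
  with \<open>n = 4\<close> show False by (auto simp: adj mod_Suc)
qed

text \<open>Apply the previous lemma to a class of maximal height, after turning the cycle around if necessary.\<close>

lemma no_induced_cycle:
  fixes cls :: "'v \<Rightarrow> 'c" and h :: "'c \<Rightarrow> nat"
  assumes cyc: "induced_cycle V E c" and len: "length c \<ge> 4"
    and same: "\<And>x y. x \<in> set c \<Longrightarrow> y \<in> set c \<Longrightarrow> x \<noteq> y \<Longrightarrow> cls x = cls y \<Longrightarrow> {x, y} \<in> E"
    and nb: "\<And>X. X \<in> cls ` set c \<Longrightarrow> \<exists>Y. \<forall>x\<in>set c. \<forall>y\<in>set c. cls x = X \<longrightarrow> {x, y} \<in> E \<longrightarrow> h (cls y) \<le> h X \<longrightarrow> cls y \<in> {X, Y}"
    and chain: "\<And>x x' y y'. x \<in> set c \<Longrightarrow> x' \<in> set c \<Longrightarrow> y \<in> set c \<Longrightarrow> y' \<in> set c \<Longrightarrow> cls x = cls x' \<Longrightarrow>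
      cls y = cls y' \<Longrightarrow> cls x \<noteq> cls y \<Longrightarrow> {x, y} \<in> E \<Longrightarrow> {x', y'} \<in> E \<Longrightarrow> {x, y'} \<in> E \<or> {x', y} \<in> E"
  shows False
proof -
  define n where "n = length c"
  have n: "n \<ge> 4" using len by (simp add: n_def)
  have dist: "distinct c" and E: "\<And>i j. i < n \<Longrightarrow> j < n \<Longrightarrow> {c ! i, c ! j} \<in> E \<longleftrightarrow> j = Suc i mod n \<or> i = Suc j mod n"
    using cyc by (auto simp: induced_cycle_def n_def)
  have "finite (set c)" "set c \<noteq> {}" using n by (auto simp: n_def)
  then have "Max ((h \<circ> cls) ` set c) \<in> (h \<circ> cls) ` set c" by (intro Max_in) auto
  then obtain x where x: "x \<in> set c" "Max ((h \<circ> cls) ` set c) = h (cls x)" by auto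
  have max: "h (cls y) \<le> h (cls x)" if "y \<in> set c" for y
    unfolding x(2)[symmetric] using that by (intro Max_ge) auto
  define X where "X = cls x"
  obtain Y where Y: "\<And>x y. x \<in> set c \<Longrightarrow> y \<in> set c \<Longrightarrow> cls x = X \<Longrightarrow> {x, y} \<in> E \<Longrightarrow> cls y \<in> {X, Y}"
    using nb[of X] x(1) max unfolding X_def by blast
  obtain i0 where i0: "i0 < n" "c ! i0 = x" using x(1) by (auto simp: in_set_conv_nth n_def)
  define u where "u j = c ! ((i0 + j) mod n)" for j
  have mem: "u j \<in> set c" for j
  proof -
    have "(i0 + j) mod n < length c" using n unfolding n_def by (intro mod_less_divisor) linarith
    then show ?thesis unfolding u_def by (rule nth_mem)
  qed
  have add_mod: "(i0 + a) mod n = (if i0 + a < n then i0 + a else i0 + a - n)" if "a < n" for a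
    using that i0(1) by (simp add: le_mod_geq)
  have diff_mod: "(n - a) mod n = (if a = 0 then 0 else n - a)" if "a < n" for a
    using that by simp
  have uadj: "{u i, u j} \<in> E \<longleftrightarrow> j = Suc i mod n \<or> i = Suc j mod n" if "i < n" "j < n" for i j
  proof -
    have "(i0 + j) mod n = Suc ((i0 + i) mod n) mod n \<longleftrightarrow> j = Suc i mod n" if "i < n" "j < n" for i j
      using that i0(1) by (auto simp: mod_Suc add_mod)
    from this[OF that] this[OF that(2,1)] show ?thesis using n by (simp add: u_def E)
  qed
  have uinj: "u i \<noteq> u j" if "i < n" "j < n" "i \<noteq> j" for i j
    using that i0(1) dist by (auto simp: u_def nth_eq_iff_index_eq[OF dist] n_def[symmetric] add_mod)
  have u0: "u 0 = x" using i0 by (simp add: u_def)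
  define v where "v j = u ((n - j) mod n)" for j
  have vadj: "{v i, v j} \<in> E \<longleftrightarrow> j = Suc i mod n \<or> i = Suc j mod n" if "i < n" "j < n" for i j
  proof -
    have "(n - j) mod n = Suc ((n - i) mod n) mod n \<longleftrightarrow> i = Suc j mod n" if "i < n" "j < n" for i j
      using that n by (auto simp: mod_Suc diff_mod)
    then show ?thesis using that n by (auto simp: v_def uadj)
  qed
  have vinj: "v i \<noteq> v j" if "i < n" "j < n" "i \<noteq> j" for i j
    unfolding v_def by (rule uinj) (use that n in \<open>auto simp: diff_mod\<close>)
  have vmem: "v j \<in> set c" for j by (simp add: v_def mem)
  have v: "v 0 = u 0" "v 1 = u (n - 1)" using n by (auto simp: v_def)
  have nbr: "{u 0, u 1} \<in> E" "{u 0, u (n - 1)} \<in> E" "{u 1, u (n - 1)} \<notin> E" using n by (auto simp: uadj mod_Suc)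
  have "u 1 \<noteq> u (n - 1)" by (rule uinj) (use n in auto)
  \<comment> \<open>The two neighbours of \<open>u 0\<close> are not adjacent, hence in different
    classes. Only \<open>X\<close> and \<open>Y\<close> are available, so one of them is in
    \<open>X\<close>.\<close>
  then have "cls (u 1) \<noteq> cls (u (n - 1))" using same[OF mem mem] nbr(3) by blast
  moreover have "cls (u 0) = X" by (simp add: u0 X_def)
  then have "cls (u 1) \<in> {X, Y}" "cls (u (n - 1)) \<in> {X, Y}" using Y[OF mem mem] nbr(1,2) by blast+
  ultimately have *: "cls (u 1) = X \<or> cls (u (n - 1)) = X" by auto
  have fin: False
    if w: "\<And>i j. i < n \<Longrightarrow> j < n \<Longrightarrow> {w i, w j} \<in> E \<longleftrightarrow> j = Suc i mod n \<or> i = Suc j mod n"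
      "\<And>i j. i < n \<Longrightarrow> j < n \<Longrightarrow> i \<noteq> j \<Longrightarrow> w i \<noteq> w j" "\<And>j. w j \<in> set c" "cls (w 0) = X" "cls (w 1) = X" for w
  proof (rule no_cycle_aux[of n w E cls X Y])
    show "n \<ge> 4" by (rule n)
    show "{w i, w j} \<in> E \<longleftrightarrow> j = Suc i mod n \<or> i = Suc j mod n" if "i < n" "j < n" for i j
      using that by (rule w(1))
    show "{w i, w j} \<in> E" if "i < n" "j < n" "i \<noteq> j" "cls (w i) = cls (w j)" for i j
      using same[OF w(3) w(3) w(2)[OF that(1-3)] that(4)] .
    show "cls (w j) \<in> {X, Y}" if "i < n" "j < n" "cls (w i) = X" "{w i, w j} \<in> E" for i j
      using Y[OF w(3) w(3) that(3,4)] .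
    show "{w i, w j'} \<in> E \<or> {w i', w j} \<in> E"
      if "i < n" "i' < n" "j < n" "j' < n" "cls (w i) = cls (w i')" "cls (w j) = cls (w j')"
        "cls (w i) \<noteq> cls (w j)" "{w i, w j} \<in> E" "{w i', w j'} \<in> E" for i i' j j'
      using chain[OF w(3) w(3) w(3) w(3) that(5-9)] .
    show "cls (w 0) = X" "cls (w 1) = X" by (rule w)+
  qed
  show False using *
  proof
    assume "cls (u 1) = X"
    with uadj uinj mem \<open>cls (u 0) = X\<close> show False by (rule fin)
  next
    assume "cls (u (n - 1)) = X"
    then have "cls (v 0) = X" "cls (v 1) = X" using \<open>cls (u 0) = X\<close> v by simp_all
    with vadj vinj vmem show False by (rule fin)
  qed
qed

text \<open>
  The vertex \<open>c * D + a\<close> stands for the value \<open>a\<close> at node \<open>c\<close>. The nodes \<open>c < r\<close> are the main nodes, with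
  values restricted by \<open>ok\<close>, and each arc \<open>e\<close> is a path of \<open>L\<close> further nodes that enforces
  \<open>\<phi> e a \<le> \<psi> e b\<close> for the values \<open>a\<close>, \<open>b\<close> at its ends. Node \<open>0\<close> is the key, whose values \<open>0, 1, 2\<close> form a
  path; the values of any other node form a clique.
\<close>

locale token_graph =
  fixes r E L D :: nat and src dst :: "nat \<Rightarrow> nat" and \<phi> \<psi> :: "nat \<Rightarrow> nat \<Rightarrow> nat" and ok :: "nat \<Rightarrow> nat \<Rightarrow> bool"
  assumes r: "0 < r" and D: "3 \<le> D" and L: "2 \<le> L"
    and src: "e < E \<Longrightarrow> src e < r" and dst: "e < E \<Longrightarrow> dst e < r" "e < E \<Longrightarrow> dst e \<noteq> 0"
    and \<phi>_0: "e < E \<Longrightarrow> \<phi> e 0 = 0" and \<phi>_key: "e < E \<Longrightarrow> src e = 0 \<Longrightarrow> a \<noteq> 1 \<Longrightarrow> \<phi> e a = 0"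
    and \<phi>_less: "e < E \<Longrightarrow> a < D \<Longrightarrow> \<phi> e a < D"
    and ok_0: "c < r \<Longrightarrow> ok c 0" and ok_key: "ok 0 a \<longleftrightarrow> a < 3"
begin

section \<open>The graph and its links\<close>

definition K :: nat where "K = r + E * L"

definition node :: "nat \<Rightarrow> nat \<Rightarrow> nat" where
  "node e l = (if l = 0 then src e else if l \<le> L then r + e * L + (l - 1) else dst e)"

definition valid :: "nat \<Rightarrow> nat \<Rightarrow> bool" where
  "valid c a \<longleftrightarrow> a < D \<and> (c < r \<longrightarrow> ok c a)"

text \<open>\<open>\<phi>\<close> and \<open>\<psi>\<close> convert values at the two ends of an arc
  only; along its path the transported number is compared as it is.\<close>

definition out_val :: "nat \<Rightarrow> nat \<Rightarrow> nat \<Rightarrow> nat" where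
  "out_val e l a = (if l = 0 then \<phi> e a else a)"

definition in_val :: "nat \<Rightarrow> nat \<Rightarrow> nat \<Rightarrow> nat" where
  "in_val e l a = (if l \<le> L then a else \<psi> e a)"

definition conflict :: "nat \<Rightarrow> nat \<Rightarrow> nat \<Rightarrow> nat \<Rightarrow> bool" where
  "conflict c a c' a' \<longleftrightarrow>
     (\<exists>e<E. \<exists>l\<le>L. node e l = c \<and> node e (Suc l) = c' \<and> in_val e (Suc l) a' < out_val e l a)"

definition adj :: "nat \<Rightarrow> nat \<Rightarrow> nat \<Rightarrow> nat \<Rightarrow> bool" where
  "adj c a c' a' \<longleftrightarrow> valid c a \<and> valid c' a' \<and>
     (if c = c' then a \<noteq> a' \<and> (c = 0 \<longrightarrow> a = 1 \<or> a' = 1) else conflict c a c' a' \<or> conflict c' a' c a)"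

definition edges :: "nat set set" where
  "edges = {{v, w} | v w. v < K * D \<and> w < K * D \<and> adj (v div D) (v mod D) (w div D) (w mod D)}"

lemma adj_sym: "adj c a c' a' \<longleftrightarrow> adj c' a' c a"
  by (auto simp: adj_def)

lemma edges_iff:
  "{v, w} \<in> edges \<longleftrightarrow> v < K * D \<and> w < K * D \<and> adj (v div D) (v mod D) (w div D) (w mod D)"
  unfolding edges_def by (auto simp: doubleton_eq_iff adj_sym)

lemma simple_graph: "simple_graph {..<K * D} edges"
proof -
  have "v \<noteq> w" if "adj (v div D) (v mod D) (w div D) (w mod D)" for v w
    using that by (auto simp: adj_def)
  then show ?thesis unfolding simple_graph_def edges_def by fastforce
qed

lemma node_path: "0 < l \<Longrightarrow> l \<le> L \<Longrightarrow> node e l = r + e * L + (l - 1)"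
  by (simp add: node_def)

lemma node_main: "e < E \<Longrightarrow> l = 0 \<or> L < l \<Longrightarrow> node e l < r"
  using src dst by (auto simp: node_def)

lemma path_cases:
  assumes "r \<le> c" "c < K"
  obtains e l where "e < E" "0 < l" "l \<le> L" "c = node e l"
proof (rule that[of "(c - r) div L" "(c - r) mod L + 1"])
  show "(c - r) div L < E" using assms by (simp add: K_def less_mult_imp_div_less)
  show "(c - r) mod L + 1 \<le> L" using L by (simp add: Suc_leI)
  then show "c = node ((c - r) div L) ((c - r) mod L + 1)" using assms by (simp add: node_path)
qed simp

lemma path_index: "e < E \<Longrightarrow> 0 < l \<Longrightarrow> l \<le> L \<Longrightarrow> (node e l - r) div L = e \<and> (node e l - r) mod L = l - 1"
proof -
  assume "e < E" "0 < l" "l \<le> L"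
  then obtain m where "l = Suc m" "m < L" by (cases l) auto
  then show ?thesis by (simp add: node_def)
qed

lemma node_inj:
  assumes "e < E" "0 < l" "l \<le> L" "e' < E" "node e l = node e' l'"
  shows "e' = e \<and> l' = l"
proof -
  have "r \<le> node e l" using assms by (simp add: node_path)
  then have l': "0 < l'" "l' \<le> L" using node_main[of e' l'] assms by force+
  then show ?thesis using path_index[of e l] path_index[of e' l'] assms by auto
qed

lemma node_less_K: "e < E \<Longrightarrow> node e l < K"
proof (cases "l = 0 \<or> L < l")
  case True
  then show "e < E \<Longrightarrow> node e l < K" using node_main[of e l] by (auto simp: K_def)
next
  case False
  assume e: "e < E"
  have "e * L + (l - 1) < Suc e * L" using False by auto
  also have "\<dots> \<le> E * L" using e by (intro mult_right_mono) auto
  finally show ?thesis using False by (simp add: node_path K_def)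
qed

lemma node_neq: "e < E \<Longrightarrow> l \<le> L \<Longrightarrow> node e l \<noteq> node e (Suc l)"
proof (cases "l = 0")
  case True
  assume e: "e < E"
  show ?thesis using node_inj[OF e, of 1 e 0] L e True by auto
next
  case False
  assume e: "e < E" "l \<le> L"
  show ?thesis using node_inj[OF e(1), of l e "Suc l"] e False by auto
qed

text \<open>One end of every link is a path node, which determines both the arc and the
  position.\<close>

lemma link_unique:
  assumes "e < E" "l \<le> L" "e' < E" "l' \<le> L" "node e l = node e' l'" "node e (Suc l) = node e' (Suc l')"
  shows "e' = e \<and> l' = l"
proof (cases "l = 0")
  case True
  then show ?thesis using node_inj[of e "Suc l" e' "Suc l'"] assms L by auto
next
  case False
  then show ?thesis using node_inj[of e l e' l'] assms by auto
qed

text \<open>If a path consisted of a single node, an arc from a node to itself would pass the same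
  pair of nodes in both directions. \<open>L\<close> being at least 2 excludes this.\<close>

lemma link_not_reversed:
  assumes "e < E" "l \<le> L" "e' < E" "l' \<le> L" "node e l = node e' (Suc l')" "node e (Suc l) = node e' l'"
  shows False
proof (cases "l = 0")
  case True
  then have "e' = e \<and> l' = Suc 0" using node_inj[of e "Suc l" e' l'] assms L by auto
  then show False using node_inj[of e "Suc (Suc 0)" e 0] assms True L by auto
next
  case False
  then have "e' = e \<and> Suc l' = l" using node_inj[of e l e' "Suc l'"] assms by auto
  then show False using node_inj[of e "l'" e "Suc l"] node_inj[of e "Suc l" e l'] assms False L
    by (cases "l' = 0") auto
qed

text \<open>A single link joins the two nodes, and its conflicts compare two numbers. So whichever
  of \<open>a\<close> and \<open>a'\<close> has the larger \<open>out_val\<close> conflicts with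
  both \<open>b\<close> and \<open>b'\<close>: the neighbourhoods are nested.\<close>

lemma conflict_chain:
  assumes "conflict c a c' b" "conflict c a' c' b'"
  shows "conflict c a c' b' \<or> conflict c a' c' b"
proof -
  obtain e l where 1: "e < E" "l \<le> L" "node e l = c" "node e (Suc l) = c'" "in_val e (Suc l) b < out_val e l a"
    using assms(1) by (auto simp: conflict_def)
  obtain e' l' where 2: "e' < E" "l' \<le> L" "node e' l' = c" "node e' (Suc l') = c'" "in_val e' (Suc l') b' < out_val e' l' a'"
    using assms(2) by (auto simp: conflict_def)
  have "e' = e \<and> l' = l" using link_unique[OF 1(1,2) 2(1,2)] 1 2 by auto
  then have "in_val e (Suc l) b' < out_val e l a \<or> in_val e (Suc l) b < out_val e l a'" using 1(5) 2(5) by auto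
  then show ?thesis using 1 unfolding conflict_def by blast
qed

lemma conflict_not_reversed: "conflict c a c' b \<Longrightarrow> \<not> conflict c' b' c a'"
  unfolding conflict_def using link_not_reversed by metis

lemma conflict_main: "conflict c a c' a' \<Longrightarrow> \<not> (c < r \<and> c' < r)"
proof -
  assume "conflict c a c' a'"
  then obtain e l where 1: "e < E" "l \<le> L" "node e l = c" "node e (Suc l) = c'" by (auto simp: conflict_def)
  then show ?thesis using L by (cases "l = 0") (auto simp: node_path)
qed

lemma conflict_path:
  assumes "e < E" "0 < l" "l \<le> L" "conflict (node e l) a c' a' \<or> conflict c' a' (node e l) a"
  shows "c' = node e (l - 1) \<or> c' = node e (Suc l)"
  using assms(4)
proof
  assume "conflict (node e l) a c' a'"
  then obtain e' l' where "e' < E" "node e' l' = node e l" "node e' (Suc l') = c'" by (auto simp: conflict_def)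
  then show ?thesis using node_inj[OF assms(1-3), of e' l'] by auto
next
  assume "conflict c' a' (node e l) a"
  then obtain e' l' where "e' < E" "node e' (Suc l') = node e l" "node e' l' = c'" by (auto simp: conflict_def)
  then show ?thesis using node_inj[OF assms(1-3), of e' "Suc l'"] by auto
qed

text \<open>No arc ends at the key, and the arcs that start there carry 0 unless the key is at 1. So
  an end of the key path is adjacent to the middle vertex only.\<close>

lemma key_end_conflict:
  assumes "a \<noteq> 1" shows "\<not> conflict 0 a c' a'" "\<not> conflict c' a' 0 a"
proof -
  have False if "e < E" "l \<le> L" "node e l = 0" "in_val e (Suc l) b < out_val e l a" for e l b
    using that r \<phi>_key[OF that(1) _ assms] by (cases "l = 0") (auto simp: node_def out_val_def)
  then show "\<not> conflict 0 a c' a'" by (auto simp: conflict_def)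
  have False if "e < E" "l \<le> L" "node e (Suc l) = 0" for e l
    using dst(2)[OF that(1)] that r by (auto simp: node_def split: if_splits)
  then show "\<not> conflict c' a' 0 a" by (auto simp: conflict_def)
qed

section \<open>Absence of short induced cycles\<close>

text \<open>A cycle of at most \<open>p\<close> vertices cannot meet all \<open>L\<close> path
  classes of an arc. Cutting every arc at a missed class leaves subdivided stars around the main
  nodes. With the distance from the centre as height, a visited class of maximal height has at most
  one visited neighbour class, as needed for \<open>no_induced_cycle\<close>.\<close>

lemma C4_to_Cp_free:
  assumes "p < L"
  shows "C4_to_Cp_free p {..<K * D} edges"
  unfolding C4_to_Cp_free_def
proof (intro allI impI notI, elim conjE exE)
  fix len c assume len: "4 \<le> len" "len \<le> p" "induced_cycle {..<K * D} edges c" "length c = len"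
  let ?cls = "\<lambda>v. v div D" and ?val = "\<lambda>v. v mod D"
  have dist: "distinct c" using len by (simp add: induced_cycle_def)
  have nbs: "\<exists>y\<in>set c. \<exists>z\<in>set c. y \<noteq> z \<and> {x, y} \<in> edges \<and> {x, z} \<in> edges" if x: "x \<in> set c" for x
  proof -
    obtain i where i: "i < len" "x = c ! i" using x len by (auto simp: in_set_conv_nth)
    let ?i = "Suc i mod len" and ?j = "(if i = 0 then len - 1 else i - 1)"
    have j: "?i < len" "?j < len" "?i \<noteq> ?j" "i = Suc ?j mod len" using i len by (auto simp: mod_Suc)
    then have "{x, c ! ?i} \<in> edges" "{x, c ! ?j} \<in> edges" using len(3,4) i unfolding induced_cycle_def by auto
    moreover have "c ! ?i \<noteq> c ! ?j" using nth_eq_iff_index_eq[OF dist, of ?i ?j] j(1-3) len(4) by simp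
    ultimately show ?thesis using j len(4) by (metis nth_mem)
  qed
  have valid: "valid (?cls x) (?val x)" "x < K * D" if "x \<in> set c" for x
    using nbs[OF that] by (auto simp: edges_iff adj_def)
  \<comment> \<open>An end of the key path has vertex 1 as its only neighbour and thus lies on no
    cycle. So the key class, which is not a clique, meets the cycle in at most one vertex.\<close>
  have key: "?val x = 1" if "x \<in> set c" "?cls x = 0" for x
  proof (rule ccontr)
    assume v: "?val x \<noteq> 1"
    have "?cls y = 0 \<and> ?val y = 1" if "{x, y} \<in> edges" for y
      using that v \<open>?cls x = 0\<close> key_end_conflict[OF v] by (auto simp: edges_iff adj_def split: if_splits)
    then have "y = 1" if "{x, y} \<in> edges" for y using that by (metis div_mult_mod_eq mult_0 add_0)
    then show False using nbs[OF that(1)] by blast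
  qed
  let ?T = "?cls ` set c"
  have "\<exists>g. 0 < g \<and> g \<le> L \<and> node e g \<notin> ?T" if e: "e < E" for e
  proof (rule ccontr)
    assume "\<not> ?thesis"
    then have sub: "node e ` {1..L} \<subseteq> ?T" by auto
    have "inj_on (node e) {1..L}" using node_inj[OF e] e by (auto simp: inj_on_def)
    then have "L = card (node e ` {1..L})" by (simp add: card_image)
    also have "\<dots> \<le> card ?T" by (rule card_mono[OF _ sub]) simp
    also have "\<dots> \<le> length c" using card_image_le[of "set c" ?cls] card_length[of c] by (meson List.finite_set le_trans)
    finally show False using len assms by simp
  qed
  then obtain g where g: "\<And>e. e < E \<Longrightarrow> 0 < g e \<and> g e \<le> L \<and> node e (g e) \<notin> ?T" by metis
  define h where "h C = (if C < r then 0 else let e = (C - r) div L; l = (C - r) mod L + 1 in if l < g e then l else Suc L - l)" for C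
  have h_path: "h (node e l) = (if l < g e then l else Suc L - l)" if "e < E" "0 < l" "l \<le> L" for e l
  proof -
    have "\<not> node e l < r" using that by (simp add: node_def)
    then show ?thesis using path_index[OF that] that by (simp add: h_def Let_def)
  qed
  show False
  proof (rule no_induced_cycle[OF len(3), of ?cls h])
    show "4 \<le> length c" using len by simp
  next
    fix x y assume xy: "x \<in> set c" "y \<in> set c" "x \<noteq> y" "?cls x = ?cls y"
    then have "?val x \<noteq> ?val y" by (metis div_mult_mod_eq)
    then show "{x, y} \<in> edges" using valid[OF xy(1)] valid[OF xy(2)] key[OF xy(1)] key[OF xy(2)] xy(4)
      by (auto simp: edges_iff adj_def)
  next
    fix X assume X: "X \<in> ?T"
    show "\<exists>Y. \<forall>x\<in>set c. \<forall>y\<in>set c. ?cls x = X \<longrightarrow> {x, y} \<in> edges \<longrightarrow> h (?cls y) \<le> h X \<longrightarrow> ?cls y \<in> {X, Y}"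
    proof (cases "X < r")
      case True
      have "?cls y = X" if y: "y \<in> set c" "?cls x = X" "{x, y} \<in> edges" "h (?cls y) \<le> h X" for x y
      proof (rule ccontr)
        assume neq: "?cls y \<noteq> X"
        have "?cls y < r"
        proof (rule ccontr)
          assume "\<not> ?cls y < r"
          moreover have "?cls y < K" using valid(2)[OF y(1)] by (simp add: less_mult_imp_div_less)
          ultimately obtain e l where "e < E" "0 < l" "l \<le> L" "?cls y = node e l" using path_cases[of "?cls y"] by auto
          then have "0 < h (?cls y)" by (simp add: h_path)
          moreover have "h X = 0" using True by (simp add: h_def)
          ultimately show False using y(4) by simp
        qed
        then show False using y(2,3) neq True conflict_main by (auto simp: edges_iff adj_def split: if_splits)
      qed
      then show ?thesis by blast
    next
      case False
      have "X < K" using X valid(2) by (auto simp: less_mult_imp_div_less)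
      then obtain e l where el: "e < E" "0 < l" "l \<le> L" "X = node e l" using path_cases[of X] False by auto
      have ge: "0 < g e" "g e \<le> L" "node e (g e) \<notin> ?T" using g[OF el(1)] by auto
      have "l \<noteq> g e" using X ge el by auto
      define Y where "Y = (if l < g e then node e (l - 1) else node e (Suc l))"
      have "?cls y \<in> {X, Y}" if y: "y \<in> set c" "?cls x = X" "{x, y} \<in> edges" "h (?cls y) \<le> h X" for x y
      proof (rule ccontr)
        have yT: "?cls y \<in> ?T" using y(1) by (rule imageI)
        assume neq: "?cls y \<notin> {X, Y}"
        then have "conflict X (?val x) (?cls y) (?val y) \<or> conflict (?cls y) (?val y) X (?val x)"
          using y(2,3) by (auto simp: edges_iff adj_def split: if_splits)
        then have c: "?cls y = node e (l - 1) \<or> ?cls y = node e (Suc l)"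
          using conflict_path[OF el(1-3)] el(4) by blast
        show False
        proof (cases "l < g e")
          case True
          then have cy: "?cls y = node e (Suc l)" using c neq by (auto simp: Y_def)
          then have "Suc l \<noteq> g e" using ge(3) yT by auto
          then have "h (?cls y) = Suc l" "h X = l" using True ge el cy by (auto simp: h_path)
          then show False using y(4) by simp
        next
          case False
          then have cy: "?cls y = node e (l - 1)" using c neq by (auto simp: Y_def)
          then have "l - 1 \<noteq> g e" using ge(3) yT by auto
          then have "h (?cls y) = Suc L - (l - 1)" "h X = Suc L - l" using False \<open>l \<noteq> g e\<close> ge el cy by (auto simp: h_path)
          then show False using y(4) el by simp
        qed
      qed
      then show ?thesis by blast
    qed
  next
    fix x x' y y' assume xy: "x \<in> set c" "x' \<in> set c" "y \<in> set c" "y' \<in> set c" "?cls x = ?cls x'" "?cls y = ?cls y'"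
      "?cls x \<noteq> ?cls y" "{x, y} \<in> edges" "{x', y'} \<in> edges"
    let ?C = "?cls x'" and ?C' = "?cls y'"
    have "conflict ?C (?val x) ?C' (?val y) \<or> conflict ?C' (?val y) ?C (?val x)"
      "conflict ?C (?val x') ?C' (?val y') \<or> conflict ?C' (?val y') ?C (?val x')"
      using xy by (auto simp: edges_iff adj_def)
    then have "conflict ?C (?val x) ?C' (?val y') \<or> conflict ?C' (?val y') ?C (?val x) \<or>
       conflict ?C (?val x') ?C' (?val y) \<or> conflict ?C' (?val y) ?C (?val x')"
      using conflict_chain conflict_not_reversed by meson
    then show "{x, y'} \<in> edges \<or> {x', y} \<in> edges"
      using xy valid by (auto simp: edges_iff adj_def)
  qed
qed


section \<open>Configurations with one token per clique and their moves\<close>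

definition good :: "(nat \<Rightarrow> nat) \<Rightarrow> bool" where
  "good \<sigma> \<longleftrightarrow> (\<forall>c<K. valid c (\<sigma> c)) \<and>
     (\<forall>e<E. \<forall>l\<le>L. out_val e l (\<sigma> (node e l)) \<le> in_val e (Suc l) (\<sigma> (node e (Suc l))))"

definition tokens :: "(nat \<Rightarrow> nat) \<Rightarrow> nat set" where
  "tokens \<sigma> = (\<lambda>c. c * D + \<sigma> c) ` {..<K}"

lemma vertex_less: "c < K \<Longrightarrow> a < D \<Longrightarrow> c * D + a < K * D"
proof -
  assume "c < K" "a < D"
  then have "c * D + a < Suc c * D" by simp
  also have "\<dots> \<le> K * D" using \<open>c < K\<close> by (intro mult_right_mono) auto
  finally show ?thesis .
qed

lemma good_less: "good \<sigma> \<Longrightarrow> c < K \<Longrightarrow> \<sigma> c < D"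
  by (simp add: good_def valid_def)

lemma in_tokens_iff: "good \<sigma> \<Longrightarrow> v \<in> tokens \<sigma> \<longleftrightarrow> v div D < K \<and> v mod D = \<sigma> (v div D)"
proof
  assume "good \<sigma>" "v \<in> tokens \<sigma>"
  then obtain c where "v = c * D + \<sigma> c" "c < K" "\<sigma> c < D" using good_less by (auto simp: tokens_def)
  then show "v div D < K \<and> v mod D = \<sigma> (v div D)" by simp
next
  assume v: "v div D < K \<and> v mod D = \<sigma> (v div D)"
  have "v = v div D * D + v mod D" by simp
  with v have "v = v div D * D + \<sigma> (v div D)" by simp
  then show "v \<in> tokens \<sigma>" unfolding tokens_def using v by (intro image_eqI[of _ _ "v div D"]) auto
qed

lemma good_no_conflict: "good \<sigma> \<Longrightarrow> \<not> conflict c (\<sigma> c) c' (\<sigma> c')"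
  unfolding good_def conflict_def by (auto simp: not_less)

lemma independent_tokens:
  assumes "good \<sigma>"
  shows "independent_set {..<K * D} edges (tokens \<sigma>)"
  unfolding independent_set_def
proof (intro conjI ballI)
  show "tokens \<sigma> \<subseteq> {..<K * D}"
    using good_less[OF assms] vertex_less by (auto simp: tokens_def)
next
  fix u v assume uv: "u \<in> tokens \<sigma>" "v \<in> tokens \<sigma>"
  then have "u mod D = \<sigma> (u div D)" "v mod D = \<sigma> (v div D)" by (auto simp: in_tokens_iff[OF assms])
  then show "{u, v} \<notin> edges" using good_no_conflict[OF assms] by (auto simp: edges_iff adj_def)
qed

lemma card_tokens: "good \<sigma> \<Longrightarrow> card (tokens \<sigma>) = K"
proof -
  assume g: "good \<sigma>"
  have "inj_on (\<lambda>c. c * D + \<sigma> c) {..<K}"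
  proof (rule inj_onI)
    fix c c' assume "c \<in> {..<K}" "c' \<in> {..<K}" "c * D + \<sigma> c = c' * D + \<sigma> c'"
    then have "(c * D + \<sigma> c) div D = (c' * D + \<sigma> c') div D" "\<sigma> c < D" "\<sigma> c' < D" using good_less[OF g] by auto
    then show "c = c'" by simp
  qed
  then show ?thesis by (simp add: tokens_def card_image)
qed

definition move :: "(nat \<Rightarrow> nat) \<Rightarrow> (nat \<Rightarrow> nat) \<Rightarrow> bool" where
  "move \<sigma> \<tau> \<longleftrightarrow> good \<sigma> \<and> good \<tau> \<and>
     (\<exists>c<K. \<tau> = \<sigma>(c := \<tau> c) \<and> \<sigma> c \<noteq> \<tau> c \<and> (c = 0 \<longrightarrow> \<sigma> c = 1 \<or> \<tau> c = 1))"

lemma move_sym: "move \<sigma> \<tau> \<Longrightarrow> move \<tau> \<sigma>"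
  unfolding move_def by (metis fun_upd_triv fun_upd_upd)

lemma move_slide:
  assumes "move \<sigma> \<tau>" shows "slide edges (tokens \<sigma>) (tokens \<tau>)"
proof -
  obtain c where c: "good \<sigma>" "good \<tau>" "c < K" "\<tau> = \<sigma>(c := \<tau> c)" "\<sigma> c \<noteq> \<tau> c" "c = 0 \<longrightarrow> \<sigma> c = 1 \<or> \<tau> c = 1"
    using assms by (auto simp: move_def)
  have eq: "\<tau> c' = \<sigma> c'" if "c' \<noteq> c" for c' using c(4) that by (metis fun_upd_other)
  have D': "\<sigma> c < D" "\<tau> c < D" using good_less c by auto
  let ?u = "c * D + \<sigma> c" and ?w = "c * D + \<tau> c"
  have u: "?u div D = c" "?u mod D = \<sigma> c" "?w div D = c" "?w mod D = \<tau> c" using D' by auto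
  have iff: "v = c * D + a \<longleftrightarrow> v div D = c \<and> v mod D = a" if "a < D" for v a
    using that by (auto simp: div_mult_mod_eq[symmetric])
  have "{?u, ?w} \<in> edges" unfolding edges_iff u
    using c D' vertex_less by (auto simp: adj_def good_def)
  moreover have "?u \<in> tokens \<sigma>" "?w \<notin> tokens \<sigma>" unfolding in_tokens_iff[OF c(1)] u using c by auto
  moreover have "v \<in> tokens \<tau> \<longleftrightarrow> v \<in> insert ?w (tokens \<sigma> - {?u})" for v
    unfolding in_tokens_iff[OF c(1)] in_tokens_iff[OF c(2)] insert_iff Diff_iff singleton_iff iff[OF D'(1)] iff[OF D'(2)]
    using c eq by (cases "v div D = c") auto
  then have "tokens \<tau> = insert ?w (tokens \<sigma> - {?u})" by blast
  ultimately show ?thesis unfolding slide_def by blast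
qed

lemma moves_sliding_sequence:
  assumes "move\<^sup>*\<^sup>* \<sigma> \<tau>" "good \<sigma>"
  shows "\<exists>l I. sliding_sequence {..<K * D} edges K (tokens \<sigma>) (tokens \<tau>) l I"
  using assms
proof (induction rule: rtranclp_induct)
  case base
  then show ?case using independent_tokens card_tokens
    by (intro exI[of _ 0] exI[of _ "\<lambda>_. tokens \<sigma>"]) (simp add: sliding_sequence_def)
next
  case (step \<tau> \<tau>')
  then obtain l I where I: "sliding_sequence {..<K * D} edges K (tokens \<sigma>) (tokens \<tau>) l I" by blast
  have "good \<tau>'" using step by (simp add: move_def)
  then have "sliding_sequence {..<K * D} edges K (tokens \<sigma>) (tokens \<tau>') (Suc l) (I(Suc l := tokens \<tau>'))"
    using I move_slide[OF step.hyps(2)] independent_tokens card_tokens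
    by (auto simp: sliding_sequence_def le_Suc_eq less_Suc_eq)
  then show ?case by blast
qed

text \<open>Raising all values one by one in order of increasing rank never creates a conflict.\<close>

lemma moves_raise:
  fixes rank :: "nat \<Rightarrow> nat"
  assumes \<tau>: "good \<tau>" "\<tau> 0 = 1"
    and \<iota>: "\<iota> 0 = 0 \<or> \<iota> 0 = 2" "\<And>c. 0 < c \<Longrightarrow> c < K \<Longrightarrow> \<iota> c = 0"
    and rank: "\<And>e l. e < E \<Longrightarrow> l \<le> L \<Longrightarrow> rank (node e (Suc l)) < rank (node e l) \<or> l = L \<and> D \<le> \<psi> e 0"
  shows "S \<subseteq> {..<K} \<Longrightarrow> (\<forall>c\<in>S. \<forall>c'<K. rank c' < rank c \<longrightarrow> c' \<in> S) \<Longrightarrow>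
    move\<^sup>*\<^sup>* (\<lambda>c. if c < K then \<iota> c else \<tau> c) (\<lambda>c. if c \<in> S \<or> K \<le> c then \<tau> c else \<iota> c)"
proof (induction "card S" arbitrary: S)
  case 0
  have "finite S" using 0(2) by (rule finite_subset) simp
  then have "S = {}" using 0(1) by simp
  then have "(\<lambda>c. if c < K then \<iota> c else \<tau> c) = (\<lambda>c. if c \<in> S \<or> K \<le> c then \<tau> c else \<iota> c)" by auto
  then show ?case by simp
next
  case (Suc n)
  let ?mix = "\<lambda>S c. if c \<in> S \<or> K \<le> c then \<tau> c else \<iota> c"
  have fin: "finite S" using Suc.prems finite_subset by blast
  have good_mix: "good (?mix S)" if S: "S \<subseteq> {..<K}" "\<forall>c\<in>S. \<forall>c'<K. rank c' < rank c \<longrightarrow> c' \<in> S" for S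
    unfolding good_def
  proof (intro conjI allI impI)
    fix c assume "c < K"
    moreover have "valid c (\<iota> c)" if "c < K"
      using that \<iota> ok_0[of c] ok_key D by (cases "c = 0") (auto simp: valid_def)
    ultimately show "valid c (?mix S c)" using \<tau> by (simp add: good_def)
  next
    fix e l assume el: "e < E" "l \<le> L"
    let ?x = "node e l" and ?y = "node e (Suc l)"
    have xy: "?x < K" "?y < K" using node_less_K el by auto
    show "out_val e l (?mix S ?x) \<le> in_val e (Suc l) (?mix S ?y)"
    proof (cases "?x \<in> S")
      case False
      have "out_val e l (\<iota> ?x) = 0"
      proof (cases "?x = 0")
        case True
        then have "l = 0" using el r by (auto simp: node_def split: if_splits)
        then show ?thesis using True \<iota>(1) \<phi>_key[OF el(1)] by (auto simp: out_val_def node_def)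
      next
        case False
        then show ?thesis using \<iota>(2) xy \<phi>_0[OF el(1)] by (simp add: out_val_def)
      qed
      then show ?thesis using False xy by simp
    next
      case x: True
      show ?thesis
      proof (cases "?y \<in> S")
        case True
        then show ?thesis using x \<tau>(1) el by (simp add: good_def)
      next
        case False
        \<comment> \<open>A successor of smaller rank than a raised node is already in
          \<open>S\<close>. The only exception is a last link into a node still at 0, where
          \<open>\<psi>\<close> is at least \<open>D\<close> and cannot be exceeded.\<close>
        then have l: "l = L" "D \<le> \<psi> e 0" using rank[OF el] S(2) x xy by auto
        then have "?y = dst e" by (simp add: node_def)
        then have "\<iota> ?y = 0" using \<iota>(2) xy dst(2)[OF el(1)] by simp
        moreover have "out_val e l (\<tau> ?x) < D"
          using good_less[OF \<tau>(1) xy(1)] \<phi>_less[OF el(1), of "\<tau> ?x"] by (cases "l = 0") (simp_all add: out_val_def)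
        ultimately show ?thesis using False x xy l by (simp add: in_val_def)
      qed
    qed
  qed
  have "S \<noteq> {}" using Suc.hyps(2) by auto
  then have "Max (rank ` S) \<in> rank ` S" using fin by (intro Max_in) auto
  then obtain c where c: "c \<in> S" "Max (rank ` S) = rank c" by auto
  have max: "rank c' \<le> rank c" if "c' \<in> S" for c'
    unfolding c(2)[symmetric] using that fin by (intro Max_ge) auto
  \<comment> \<open>Removing a node of maximal rank keeps \<open>S\<close> closed under smaller
    rank; this node is the one raised last.\<close>
  let ?S = "S - {c}"
  have S': "?S \<subseteq> {..<K}" "\<forall>c\<in>?S. \<forall>c'<K. rank c' < rank c \<longrightarrow> c' \<in> ?S"
  proof -
    show "?S \<subseteq> {..<K}" using Suc.prems(1) by blast
    show "\<forall>c\<in>?S. \<forall>c'<K. rank c' < rank c \<longrightarrow> c' \<in> ?S"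
    proof (intro ballI allI impI)
      fix d c' assume d: "d \<in> ?S" "c' < K" "rank c' < rank d"
      then have "c' \<in> S" using Suc.prems(2) by blast
      moreover have "rank d \<le> rank c" using d(1) max by blast
      then have "c' \<noteq> c" using d(3) by auto
      ultimately show "c' \<in> ?S" by blast
    qed
  qed
  have IH: "move\<^sup>*\<^sup>* (\<lambda>c. if c < K then \<iota> c else \<tau> c) (?mix ?S)"
  proof (rule Suc.hyps(1)[OF _ S'])
    show "n = card ?S" using Suc.hyps(2) c(1) fin by simp
  qed
  have cK: "c < K" using c(1) Suc.prems by auto
  show ?case
  proof (cases "\<iota> c = \<tau> c")
    case True
    then have "?mix S = ?mix ?S" using cK by auto
    then show ?thesis using IH by simp
  next
    case False
    have "?mix S = (?mix ?S)(c := ?mix S c)" using c(1) by auto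
    then have "move (?mix ?S) (?mix S)" unfolding move_def
      using good_mix[OF S'] good_mix[OF Suc.prems] cK c(1) False \<tau>(2)
      by (intro conjI exI[of _ c]) auto
    then show ?thesis using IH by (rule rtranclp.rtrancl_into_rtrancl[rotated])
  qed
qed

section \<open>From a solution to a sliding sequence\<close>

definition start :: "nat set" where "start = tokens (\<lambda>_. 0)"
definition target :: "nat set" where "target = tokens ((\<lambda>_. 0)(0 := 2))"

text \<open>Only main nodes occur, since the inequalities along a path compose to one between its
  ends. The key is at its middle vertex, which it has to pass on the way from 0 to 2.\<close>

definition solution :: "(nat \<Rightarrow> nat) \<Rightarrow> bool" where
  "solution y \<longleftrightarrow> (\<forall>c<r. valid c (y c)) \<and> y 0 = 1 \<and> (\<forall>e<E. \<phi> e (y (src e)) \<le> \<psi> e (y (dst e)))"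

text \<open>All values sent along arcs are 0: from a node at 0 by \<open>\<phi>_0\<close>, and from
  the key at 0 or 2 by \<open>\<phi>_key\<close>.\<close>

lemma good_start:
  assumes "\<sigma> = (\<lambda>_. 0) \<or> \<sigma> = (\<lambda>_. 0)(0 := 2)"
  shows "good \<sigma>"
proof -
  have \<sigma>: "\<sigma> 0 = 0 \<or> \<sigma> 0 = 2" "\<And>c. c \<noteq> 0 \<Longrightarrow> \<sigma> c = 0" using assms by auto
  have "valid c (\<sigma> c)" for c
  proof (cases "c = 0")
    case True
    have "valid 0 0" "valid 0 2" using ok_key D by (simp_all add: valid_def)
    with True \<sigma>(1) show ?thesis by metis
  next
    case False
    have "valid c 0" using ok_0[of c] D by (simp add: valid_def)
    with False \<sigma>(2) show ?thesis by metis
  qed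
  moreover have "out_val e l (\<sigma> (node e l)) = 0" if el: "e < E" "l \<le> L" for e l
  proof (cases "node e l = 0")
    case True
    then have "l = 0" "src e = 0" using el r by (auto simp: node_def split: if_splits)
    moreover have "\<phi> e (\<sigma> 0) = 0" using \<sigma>(1) \<phi>_key[OF el(1)] \<open>src e = 0\<close> by auto
    ultimately show ?thesis by (simp add: out_val_def node_def)
  next
    case False
    then show ?thesis using \<sigma>(2) \<phi>_0[OF el(1)] by (simp add: out_val_def)
  qed
  ultimately show ?thesis by (simp add: good_def)
qed

text \<open>Fill every path with the number sent by its source. Both \<open>start\<close> and
  \<open>target\<close> can be raised to this configuration, and since moves are symmetric, the
  second run leads back to \<open>target\<close>. The ranks \<open>rk\<close> of main nodes and
  \<open>ar\<close> of arcs express that the constraints are acyclic up to the arcs that a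
  destination at 0 cannot violate.\<close>

lemma solution_imp_sequence:
  fixes rk ar :: "nat \<Rightarrow> nat"
  assumes y: "solution y"
    and rk: "\<And>e. e < E \<Longrightarrow> rk (dst e) \<le> ar e \<or> D \<le> \<psi> e 0" "\<And>e. e < E \<Longrightarrow> ar e + L < rk (src e)"
  shows "\<exists>l I. sliding_sequence {..<K * D} edges K start target l I"
proof -
  define \<tau> where "\<tau> c = (if c < r then y c else if c < K then \<phi> ((c - r) div L) (y (src ((c - r) div L))) else 0)" for c
  have \<tau>_path: "\<tau> (node e l) = \<phi> e (y (src e))" if "e < E" "0 < l" "l \<le> L" for e l
  proof -
    have "\<not> node e l < r" using that by (simp add: node_def)
    then show ?thesis using path_index[OF that] node_less_K that by (simp add: \<tau>_def)
  qed
  have \<tau>_src: "\<tau> (src e) = y (src e)" "\<tau> (dst e) = y (dst e)" if "e < E" for e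
    using src dst that by (simp_all add: \<tau>_def)
  have \<tau>: "good \<tau>" unfolding good_def
  proof (intro conjI allI impI)
    fix c assume c: "c < K"
    show "valid c (\<tau> c)"
    proof (cases "c < r")
      case True
      then show ?thesis using y by (simp add: \<tau>_def solution_def)
    next
      case False
      then obtain e l where el: "e < E" "0 < l" "l \<le> L" "c = node e l" using path_cases[of c] c by auto
      have "y (src e) < D" using y src el by (auto simp: solution_def valid_def)
      then show ?thesis using False el \<phi>_less by (simp add: valid_def \<tau>_path)
    qed
  next
    fix e l assume el: "e < E" "l \<le> L"
    have "out_val e l (\<tau> (node e l)) = \<phi> e (y (src e))"
      using el \<tau>_src \<tau>_path by (cases "l = 0") (auto simp: out_val_def node_def)
    moreover have "\<phi> e (y (src e)) \<le> in_val e (Suc l) (\<tau> (node e (Suc l)))"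
    proof (cases "l = L")
      case True
      then show ?thesis using y el \<tau>_src by (simp add: in_val_def node_def solution_def)
    next
      case False
      then show ?thesis using el \<tau>_path by (simp add: in_val_def)
    qed
    ultimately show "out_val e l (\<tau> (node e l)) \<le> in_val e (Suc l) (\<tau> (node e (Suc l)))" by simp
  qed
  \<comment> \<open>Ranks fall by one from node to node along a path and reach
    \<open>ar e + 1\<close> at its last node, still above the rank of the destination unless the arc
    is exempt.\<close>
  define rank where "rank c = (if c < r then rk c else ar ((c - r) div L) + (L - (c - r) mod L))" for c
  have rank_path: "rank (node e l) = ar e + (Suc L - l)" if "e < E" "0 < l" "l \<le> L" for e l
  proof -
    have "\<not> node e l < r" using that by (simp add: node_def)
    then show ?thesis using path_index[OF that] that by (simp add: rank_def)
  qed
  have rank_main: "rank (src e) = rk (src e)" "rank (dst e) = rk (dst e)" if "e < E" for e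
    using src dst that by (simp_all add: rank_def)
  have rank: "rank (node e (Suc l)) < rank (node e l) \<or> l = L \<and> D \<le> \<psi> e 0" if el: "e < E" "l \<le> L" for e l
  proof -
    consider "l = 0" | "0 < l" "l < L" | "l = L" "0 < l" using el L by linarith
    then show ?thesis
    proof cases
      case 1
      then have "node e l = src e" by (simp add: node_def)
      then show ?thesis using 1 rk(2)[OF el(1)] rank_main(1)[OF el(1)] rank_path[OF el(1), of 1] L by simp
    next
      case 2
      then show ?thesis using rank_path[OF el(1)] by simp
    next
      case 3
      then have "node e (Suc l) = dst e" by (simp add: node_def)
      then show ?thesis using 3 rk(1)[OF el(1)] rank_main(2)[OF el(1)] rank_path[OF el(1), of L] by auto
    qed
  qed
  have "0 < K" using r by (simp add: K_def)
  have "\<tau> 0 = 1" using r y by (simp add: \<tau>_def solution_def)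
  have reach: "move\<^sup>*\<^sup>* \<iota> \<tau>" if "\<iota> = (\<lambda>_. 0) \<or> \<iota> = (\<lambda>_. 0)(0 := 2)" for \<iota>
  proof -
    have "\<iota> 0 = 0 \<or> \<iota> 0 = 2" "\<And>c. 0 < c \<Longrightarrow> c < K \<Longrightarrow> \<iota> c = 0" using that by auto
    from moves_raise[where \<iota> = \<iota> and rank = rank and S = "{..<K}", OF \<tau> \<open>\<tau> 0 = 1\<close> this rank]
    have "move\<^sup>*\<^sup>* (\<lambda>c. if c < K then \<iota> c else \<tau> c) (\<lambda>c. if c \<in> {..<K} \<or> K \<le> c then \<tau> c else \<iota> c)" by simp
    moreover have "(\<lambda>c. if c < K then \<iota> c else \<tau> c) = \<iota>"
      using that r \<open>0 < K\<close> by (auto simp: \<tau>_def K_def fun_eq_iff)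
    moreover have "(\<lambda>c. if c \<in> {..<K} \<or> K \<le> c then \<tau> c else \<iota> c) = \<tau>" by auto
    ultimately show ?thesis by simp
  qed
  have "move\<inverse>\<inverse> = move" using move_sym by blast
  then have "move\<^sup>*\<^sup>* \<tau> ((\<lambda>_. 0)(0 := 2))"
    using reach[of "(\<lambda>_. 0)(0 := 2)"] by (metis rtranclp_converseI)
  then have "move\<^sup>*\<^sup>* (\<lambda>_. 0) ((\<lambda>_. 0)(0 := 2))" using reach[of "\<lambda>_. 0"] by (meson rtranclp_trans)
  then show ?thesis unfolding start_def target_def using moves_sliding_sequence good_start by blast
qed

section \<open>From a sliding sequence to a solution\<close>

text \<open>A sliding sequence consists of arbitrary vertex sets. This is the invariant that permits
  reading off one value per node.\<close>

definition one_each :: "nat set \<Rightarrow> bool" where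
  "one_each I \<longleftrightarrow> (\<forall>c<K. \<exists>!v. v \<in> I \<and> v div D = c) \<and> (\<forall>v\<in>I. v < K * D \<and> valid (v div D) (v mod D))"

lemma one_each_tokens: "good \<sigma> \<Longrightarrow> one_each (tokens \<sigma>)"
proof -
  assume g: "good \<sigma>"
  have "\<exists>!v. v \<in> tokens \<sigma> \<and> v div D = c" if c: "c < K" for c
  proof (rule ex1I[of _ "c * D + \<sigma> c"])
    show "c * D + \<sigma> c \<in> tokens \<sigma> \<and> (c * D + \<sigma> c) div D = c"
      using c good_less[OF g c] by (auto simp: tokens_def)
    show "v = c * D + \<sigma> c" if "v \<in> tokens \<sigma> \<and> v div D = c" for v
      using that by (auto simp: in_tokens_iff[OF g]) (metis div_mult_mod_eq)
  qed
  moreover have "v < K * D \<and> valid (v div D) (v mod D)" if "v \<in> tokens \<sigma>" for v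
    using that g independent_tokens[OF g] by (auto simp: in_tokens_iff independent_set_def good_def)
  ultimately show ?thesis by (auto simp: one_each_def)
qed

lemma key_end_neighbour: "{v, w} \<in> edges \<Longrightarrow> v div D = 0 \<Longrightarrow> v mod D \<noteq> 1 \<Longrightarrow> w = 1"
proof -
  assume "{v, w} \<in> edges" "v div D = 0" "v mod D \<noteq> 1"
  then have "w div D = 0 \<and> w mod D = 1"
    using key_end_conflict by (auto simp: edges_iff adj_def split: if_splits)
  then show ?thesis by (metis div_mult_mod_eq mult_0 add_0)
qed

text \<open>A token that enters another clique would be adjacent to the token already there. The key
  class is no clique, but its ends can be entered from its own middle vertex only. For the same
  reason the key token can leave 0 only for 1.\<close>

lemma one_each_slide:
  assumes I: "one_each I" and J: "independent_set {..<K * D} edges J" and s: "slide edges I J"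
  shows "one_each J" "0 \<in> I \<Longrightarrow> 1 \<notin> J \<Longrightarrow> 0 \<in> J"
proof -
  obtain u w where uw: "u \<in> I" "w \<notin> I" "{u, w} \<in> edges" "J = insert w (I - {u})" using s by (auto simp: slide_def)
  have wK: "w div D < K" "valid (w div D) (w mod D)" "w < K * D"
    using uw(3) by (auto simp: edges_iff adj_def less_mult_imp_div_less)
  have same: "w div D = u div D"
  proof (rule ccontr)
    assume neq: "w div D \<noteq> u div D"
    have "\<exists>!v. v \<in> I \<and> v div D = w div D" using I wK(1) by (simp add: one_each_def)
    then obtain v where v: "v \<in> I" "v div D = w div D" by blast
    have "v \<noteq> w" using v(1) uw(2) by blast
    have "v \<noteq> u" using v(2) neq by metis
    then have "v \<in> J" "w \<in> J" using v(1) uw(4) by blast+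
    then have "{w, v} \<notin> edges" using J by (auto simp: independent_set_def)
    moreover have "valid (v div D) (v mod D)" "v < K * D" using I v by (auto simp: one_each_def)
    ultimately have "\<not> adj (w div D) (w mod D) (w div D) (v mod D)" "valid (w div D) (v mod D)"
      using wK(3) v(2) by (simp_all add: edges_iff)
    moreover have "v mod D \<noteq> w mod D"
    proof
      assume "v mod D = w mod D"
      then have "v div D * D + v mod D = w div D * D + w mod D" by (simp only: v(2))
      then show False using \<open>v \<noteq> w\<close> by simp
    qed
    ultimately have "w div D = 0 \<and> w mod D \<noteq> 1" using wK(2) unfolding adj_def by metis
    then have "w div D = 0" "w mod D \<noteq> 1" by blast+
    moreover have "{w, u} \<in> edges" using uw(3) by (simp add: insert_commute)
    ultimately have "u = 1" using key_end_neighbour by blast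
    moreover have "1 div D = 0" using D by (intro div_less) linarith
    ultimately show False using neq \<open>w div D = 0\<close> by metis
  qed
  have "\<exists>!v. v \<in> J \<and> v div D = c" if c: "c < K" for c
  proof (cases "c = u div D")
    case True
    have "\<exists>!v. v \<in> I \<and> v div D = c" using I c by (simp add: one_each_def)
    then have "v = u" if "v \<in> I" "v div D = c" for v using that uw(1) True by metis
    then have "v = w" if "v \<in> J" "v div D = c" for v using that uw(4) by blast
    moreover have "w \<in> J" "w div D = c" using uw(4) same True by auto
    ultimately show ?thesis by blast
  next
    case False
    have ex1: "\<exists>!v. v \<in> I \<and> v div D = c" using I c by (simp add: one_each_def)
    have "v' \<in> J \<longleftrightarrow> v' \<in> I" if "v' div D = c" for v' using False same uw(4) that by auto
    then have "v' \<in> J \<and> v' div D = c \<longleftrightarrow> v' \<in> I \<and> v' div D = c" for v' by blast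
    then show ?thesis using ex1 by simp
  qed
  moreover have "\<forall>v\<in>J. v < K * D \<and> valid (v div D) (v mod D)" using I wK uw(4) by (auto simp: one_each_def)
  ultimately show "one_each J" by (simp add: one_each_def)
  show "0 \<in> J" if "0 \<in> I" "1 \<notin> J"
  proof (rule ccontr)
    assume "0 \<notin> J"
    then have "u = 0" using that uw by auto
    then have "w = 1" using key_end_neighbour[of u w] uw by simp
    then show False using that uw by simp
  qed
qed

text \<open>The key cannot get from 0 to 2 without standing at 1. At such a moment independence
  turns every link into an inequality, and these compose along the paths.\<close>

lemma sequence_imp_solution:
  assumes "sliding_sequence {..<K * D} edges K start target l I"
  shows "\<exists>y. solution y"
proof -
  have I: "I 0 = start" "I l = target" "\<And>i. i \<le> l \<Longrightarrow> independent_set {..<K * D} edges (I i)"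
    "\<And>i. i < l \<Longrightarrow> slide edges (I i) (I (Suc i))" using assms by (auto simp: sliding_sequence_def)
  have K: "0 < K" using r by (simp add: K_def)
  have one: "one_each (I i)" if "i \<le> l" for i
    using that
  proof (induction i)
    case 0
    show ?case unfolding I(1) start_def by (intro one_each_tokens good_start) simp
  next
    case (Suc i)
    then show ?case using one_each_slide(1)[OF _ I(3) I(4)] by simp
  qed
  have "\<exists>i\<le>l. 1 \<in> I i"
  proof (rule ccontr)
    assume none: "\<not> ?thesis"
    have "0 \<in> I i" if "i \<le> l" for i
      using that
    proof (induction i)
      case 0
      show ?case using K unfolding I(1) start_def tokens_def by force
    next
      case (Suc i)
      then show ?case using one_each_slide(2)[OF one I(3) I(4)] none by simp
    qed
    then have "0 \<in> tokens ((\<lambda>_. 0)(0 := 2))" using I(2) by (auto simp: target_def)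
    then show False by (simp add: in_tokens_iff good_start)
  qed
  then obtain i where i: "i \<le> l" "1 \<in> I i" by blast
  let ?I = "I i"
  define v where "v c = (THE v. v \<in> ?I \<and> v div D = c)" for c
  have v: "v c \<in> ?I \<and> v c div D = c" if "c < K" for c
    unfolding v_def by (rule theI') (use one[OF i(1)] that in \<open>simp add: one_each_def\<close>)
  define y where "y c = v c mod D" for c
  have valid: "valid c (y c)" if "c < K" for c using v[OF that] one[OF i(1)] by (auto simp: one_each_def y_def)
  have "v 0 = 1" using v[OF K] i(2) one[OF i(1)] K D unfolding one_each_def by (metis div_less less_le_trans one_less_numeral_iff semiring_norm(77))
  then have "y 0 = 1" using D by (simp add: y_def)
  have link: "out_val e l (y (node e l)) \<le> in_val e (Suc l) (y (node e (Suc l)))" if el: "e < E" "l \<le> L" for e l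
  proof (rule ccontr)
    assume not: "\<not> ?thesis"
    let ?c = "node e l" and ?c' = "node e (Suc l)"
    have cK: "?c < K" "?c' < K" using node_less_K el by auto
    have "conflict ?c (y ?c) ?c' (y ?c')" unfolding conflict_def using el not by (intro exI[of _ e] exI[of _ l] conjI) auto
    then have "adj ?c (y ?c) ?c' (y ?c')" using cK valid node_neq[OF el] by (simp add: adj_def)
    moreover have "v ?c < K * D" "v ?c' < K * D" using v cK one[OF i(1)] by (auto simp: one_each_def)
    ultimately have "{v ?c, v ?c'} \<in> edges" using v[OF cK(1)] v[OF cK(2)] by (simp add: edges_iff y_def)
    then show False using I(3)[OF i(1)] v cK by (auto simp: independent_set_def)
  qed
  have "\<phi> e (y (src e)) \<le> \<psi> e (y (dst e))" if e: "e < E" for e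
  proof -
    have "\<phi> e (y (src e)) \<le> y (node e (Suc j))" if "j < L" for j
      using that
    proof (induction j)
      case 0
      then show ?case using link[OF e, of 0] by (simp add: out_val_def in_val_def node_def)
    next
      case (Suc j)
      then show ?case using link[OF e, of "Suc j"] by (simp add: out_val_def in_val_def)
    qed
    from this[of "L - 1"] have "\<phi> e (y (src e)) \<le> y (node e L)" using L by simp
    also have "\<dots> \<le> \<psi> e (y (dst e))" using link[OF e, of L] L by (simp add: out_val_def in_val_def node_def)
    finally show ?thesis .
  qed
  then have "solution y" using valid \<open>y 0 = 1\<close> by (auto simp: solution_def K_def)
  then show ?thesis by blast
qed

end

section \<open>Circuits of weft 1 as constraint systems\<close>

text \<open>The part of \<open>Y\<close> that is visible at the indices in \<open>Q\<close>. It is a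
  relation, and not a partial function, to be comparable with the pairs read off from a token, where
  an index may occur twice with different values.\<close>

definition info :: "(nat \<Rightarrow> nat) \<Rightarrow> nat list \<Rightarrow> nat \<Rightarrow> nat \<Rightarrow> bool" where
  "info Y Q i v \<longleftrightarrow> i \<in> set Q \<and> v = Y i"

lemma info_mono: "set Q \<subseteq> set Q' \<Longrightarrow> info Y Q \<le> info Y Q'"
  by (auto simp: info_def le_fun_def)

text \<open>
  A partial assignment \<open>\<rho>\<close> relates indices to values. The indices \<open>0, \<dots>, k + 1\<close> hold
  \<open>0\<close>, the chosen inputs (plus 1) in increasing order, and \<open>m + 1\<close>, so that an input is known not
  to be chosen once it lies strictly between two consecutive known values. The index \<open>k + 2 + c\<close> holds
  the child chosen as a witness at position \<open>c\<close> of the unfolding of the circuit. If \<open>q\<close> ranges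
  over heap indices of a subtree, then \<open>a * q + c\<close> ranges over the positions of the subtree in
  the whole tree.
\<close>

locale circ =
  fixes m k :: nat and inp neg con :: "nat \<Rightarrow> bool" and prd :: "nat \<Rightarrow> nat \<Rightarrow> bool"
begin

section \<open>Certified values and local checks\<close>

definition chosen :: "(nat \<Rightarrow> nat \<Rightarrow> bool) \<Rightarrow> nat \<Rightarrow> bool" where
  "chosen \<rho> y \<longleftrightarrow> (\<exists>i. 1 \<le> i \<and> i \<le> k \<and> \<rho> i (y + 1))"

definition unchosen :: "(nat \<Rightarrow> nat \<Rightarrow> bool) \<Rightarrow> nat \<Rightarrow> bool" where
  "unchosen \<rho> y \<longleftrightarrow> (\<exists>i v v'. i \<le> k \<and> \<rho> i v \<and> \<rho> (Suc i) v' \<and> v < y + 1 \<and> y + 1 < v')"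

text \<open>Only what \<open>\<rho>\<close> proves about the value of a node counts, and nothing is
  proved once the fuel is used up. This makes the notion monotone in \<open>\<rho>\<close>.\<close>

primrec forced :: "nat \<Rightarrow> (nat \<Rightarrow> nat \<Rightarrow> bool) \<Rightarrow> nat \<Rightarrow> bool \<Rightarrow> bool" where
  "forced 0 \<rho> v b = False"
| "forced (Suc n) \<rho> v b =
     (if inp v then (if b then chosen \<rho> v else unchosen \<rho> v)
      else if neg v then \<exists>j<m. prd v j \<and> forced n \<rho> j (\<not> b)
      else if con v = b then \<forall>j<m. prd v j \<longrightarrow> forced n \<rho> j b
      else \<exists>j<m. prd v j \<and> forced n \<rho> j b)"

definition fanin :: "nat \<Rightarrow> nat" where "fanin v = card {j. j < m \<and> prd v j}"

text \<open>Dually, a check fails only if \<open>\<rho>\<close> exhibits a violation, and it passes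
  once the fuel is used up. Gates with \<open>con v = b\<close> need all children to have value
  \<open>b\<close>, the remaining ones a witness. Below a large gate of the first kind the weft is
  0, so \<open>forced\<close> can replace the recursion, which would need unboundedly many witness
  positions. The pairs \<open>2 * a, a + c\<close> and \<open>2 * a, 2 * a + c\<close> correspond to
  replacing the heap index \<open>q\<close> by \<open>2 * q + 1\<close> and
  \<open>2 * q + 2\<close>.\<close>

primrec check :: "nat \<Rightarrow> (nat \<Rightarrow> nat \<Rightarrow> bool) \<Rightarrow> nat \<Rightarrow> bool \<Rightarrow> nat \<Rightarrow> nat \<Rightarrow> bool" where
  "check 0 \<rho> v b a c = True"
| "check (Suc n) \<rho> v b a c =
     (if inp v then (if b then \<not> unchosen \<rho> v else \<not> chosen \<rho> v)
      else if neg v then \<forall>j<m. prd v j \<longrightarrow> check n \<rho> j (\<not> b) (2 * a) (a + c)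
      else if con v = b then
        (if fanin v \<le> 2 then
           \<forall>j<m. prd v j \<longrightarrow> (if \<exists>j'<j. prd v j' then check n \<rho> j b (2 * a) (2 * a + c)
                                                 else check n \<rho> j b (2 * a) (a + c))
         else \<forall>j<m. prd v j \<longrightarrow> \<not> forced n \<rho> j (\<not> b))
      else \<forall>w. \<rho> (k + 2 + c) w \<longrightarrow> w < m \<and> prd v w \<and> check n \<rho> w b (2 * a) (a + c))"

definition ok_info :: "nat \<Rightarrow> (nat \<Rightarrow> nat \<Rightarrow> bool) \<Rightarrow> bool" where
  "ok_info n \<rho> \<longleftrightarrow>
     (\<forall>i v. \<rho> i v \<longrightarrow> (\<forall>i' v'. \<rho> i' v' \<longrightarrow> i < i' \<longrightarrow> i' \<le> k + 1 \<longrightarrow> v < v')) \<and>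
     (\<forall>i v. \<rho> i v \<longrightarrow> (i = 0 \<longrightarrow> v = 0) \<and> (i = k + 1 \<longrightarrow> v = m + 1) \<and>
        (1 \<le> i \<and> i \<le> k \<longrightarrow> 1 \<le> v \<and> v \<le> m \<and> inp (v - 1))) \<and>
     check n \<rho> (m - 1) True 1 0"

lemma chosen_mono: "\<rho> \<le> \<rho>' \<Longrightarrow> chosen \<rho> y \<Longrightarrow> chosen \<rho>' y"
  unfolding chosen_def le_fun_def le_bool_def by blast

lemma unchosen_mono: "\<rho> \<le> \<rho>' \<Longrightarrow> unchosen \<rho> y \<Longrightarrow> unchosen \<rho>' y"
  unfolding unchosen_def le_fun_def le_bool_def by metis

lemma forced_mono: "\<rho> \<le> \<rho>' \<Longrightarrow> forced n \<rho> v b \<Longrightarrow> forced n \<rho>' v b"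
proof (induction n arbitrary: v b)
  case (Suc n)
  note IH = Suc.IH[OF Suc.prems(1)]
  consider "inp v" | "\<not> inp v" "neg v" | "\<not> inp v" "\<not> neg v" "con v = b" | "\<not> inp v" "\<not> neg v" "con v \<noteq> b" by blast
  then show ?case
  proof cases
    case 1
    then show ?thesis using Suc.prems(2) chosen_mono[OF Suc.prems(1)] unchosen_mono[OF Suc.prems(1)] by (cases b) simp_all
  next
    case 2
    then show ?thesis using Suc.prems(2) IH[of _ "\<not> b"] by auto
  next
    case 3
    then show ?thesis using Suc.prems(2) IH[of _ b] by simp
  next
    case 4
    then show ?thesis using Suc.prems(2) IH[of _ b] by auto
  qed
qed simp

lemma check_antimono: "\<rho> \<le> \<rho>' \<Longrightarrow> check n \<rho>' v b a c \<Longrightarrow> check n \<rho> v b a c"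
proof (induction n arbitrary: v b a c)
  case (Suc n)
  note IH = Suc.IH[OF Suc.prems(1)]
  have le: "\<rho> i w \<Longrightarrow> \<rho>' i w" for i w using Suc.prems(1) by (auto simp: le_fun_def)
  note mono = chosen_mono[OF Suc.prems(1)] unchosen_mono[OF Suc.prems(1)] forced_mono[OF Suc.prems(1)]
  consider "inp v" | "\<not> inp v" "neg v" | "\<not> inp v" "\<not> neg v" "con v = b" "fanin v \<le> 2"
    | "\<not> inp v" "\<not> neg v" "con v = b" "\<not> fanin v \<le> 2" | "\<not> inp v" "\<not> neg v" "con v \<noteq> b" by blast
  then show ?case
  proof cases
    case 1
    then show ?thesis using Suc.prems(2) mono(1,2)[of v] by (cases b) auto
  next
    case 2
    then show ?thesis using Suc.prems(2) IH[of _ "\<not> b"] by simp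
  next
    case 3
    then have "check (Suc n) \<rho>0 v b a c \<longleftrightarrow> (\<forall>j<m. prd v j \<longrightarrow>
      (if \<exists>j'<j. prd v j' then check n \<rho>0 j b (2 * a) (2 * a + c) else check n \<rho>0 j b (2 * a) (a + c)))" for \<rho>0 by simp
    then show ?thesis using Suc.prems(2) IH by presburger
  next
    case 4
    then have "check (Suc n) \<rho>' v b a c \<longleftrightarrow> (\<forall>j<m. prd v j \<longrightarrow> \<not> forced n \<rho>' j (\<not> b))"
      "check (Suc n) \<rho> v b a c \<longleftrightarrow> (\<forall>j<m. prd v j \<longrightarrow> \<not> forced n \<rho> j (\<not> b))" by simp_all
    then show ?thesis using Suc.prems(2) mono(3) by metis
  next
    case 5
    then have "check (Suc n) \<rho>0 v b a c \<longleftrightarrow> (\<forall>w. \<rho>0 (k + 2 + c) w \<longrightarrow> w < m \<and> prd v w \<and> check n \<rho>0 w b (2 * a) (a + c))" for \<rho>0 by simp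
    then show ?thesis using Suc.prems(2) IH le by metis
  qed
qed simp

lemma ok_infoD:
  assumes "ok_info n \<rho>" "\<rho> i v"
  shows "(i = 0 \<longrightarrow> v = 0) \<and> (i = k + 1 \<longrightarrow> v = m + 1) \<and> (1 \<le> i \<and> i \<le> k \<longrightarrow> 1 \<le> v \<and> v \<le> m \<and> inp (v - 1))"
  using assms(1)[unfolded ok_info_def, THEN conjunct2, THEN conjunct1, THEN spec, THEN spec, THEN mp, OF assms(2)] .

lemma ok_info_antimono: "\<rho> \<le> \<rho>' \<Longrightarrow> ok_info n \<rho>' \<Longrightarrow> ok_info n \<rho>"
proof -
  assume le: "\<rho> \<le> \<rho>'" and ok: "ok_info n \<rho>'"
  have "\<rho> i w \<Longrightarrow> \<rho>' i w" for i w using le by (auto simp: le_fun_def)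
  moreover have "check n \<rho> (m - 1) True 1 0" using ok check_antimono[OF le] by (simp add: ok_info_def)
  moreover have "\<rho> i v \<Longrightarrow> \<rho> i' v' \<Longrightarrow> i < i' \<Longrightarrow> i' \<le> k + 1 \<Longrightarrow> v < v'" for i v i' v'
    using ok calculation(1) unfolding ok_info_def by blast
  moreover have "\<rho> i v \<Longrightarrow> (i = 0 \<longrightarrow> v = 0) \<and> (i = k + 1 \<longrightarrow> v = m + 1) \<and>
        (1 \<le> i \<and> i \<le> k \<longrightarrow> 1 \<le> v \<and> v \<le> m \<and> inp (v - 1))" for i v
  proof -
    assume "\<rho> i v"
    then have "\<rho>' i v" by (rule calculation(1))
    then show ?thesis by (rule ok_infoD[OF ok])
  qed
  ultimately show ?thesis unfolding ok_info_def by simp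
qed

end

section \<open>Soundness and completeness of the local checks\<close>

text \<open>Joins two families of witnesses at a new root; odd heap positions belong to the left
  subtree, positive even ones to the right.\<close>

fun branch :: "'a \<Rightarrow> (nat \<Rightarrow> 'a) \<Rightarrow> (nat \<Rightarrow> 'a) \<Rightarrow> nat \<Rightarrow> 'a" where
  "branch x f g q = (if q = 0 then x else if odd q then f (q div 2) else g (q div 2 - 1))"

lemma branch_simps: "branch x f g 0 = x" "branch x f g (2 * q + 1) = f q" "branch x f g (2 * q + 2) = g q"
  by simp_all

locale circ_sem = circ +
  fixes dep wft :: "nat \<Rightarrow> nat"
  assumes prd_less: "v < m \<Longrightarrow> prd v j \<Longrightarrow> j < m"
    and neg_prd: "v < m \<Longrightarrow> \<not> inp v \<Longrightarrow> neg v \<Longrightarrow> \<exists>j. \<forall>j'. prd v j' \<longleftrightarrow> j' = j"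
    and prd_ex: "v < m \<Longrightarrow> \<not> inp v \<Longrightarrow> \<exists>j. prd v j"
    and dep: "v < m \<Longrightarrow> \<not> inp v \<Longrightarrow> prd v j \<Longrightarrow> dep j < dep v"
    and wft: "v < m \<Longrightarrow> \<not> inp v \<Longrightarrow> prd v j \<Longrightarrow> wft j \<le> wft v"
    and wft_large: "v < m \<Longrightarrow> \<not> inp v \<Longrightarrow> 2 < fanin v \<Longrightarrow> prd v j \<Longrightarrow> wft j < wft v"
begin

definition is_val :: "nat set \<Rightarrow> (nat \<Rightarrow> bool) \<Rightarrow> bool" where
  "is_val A f \<longleftrightarrow> (\<forall>v<m. f v \<longleftrightarrow> (if inp v then v \<in> A else if neg v then \<exists>j. prd v j \<and> \<not> f j
     else if con v then \<forall>j. prd v j \<longrightarrow> f j else \<exists>j. prd v j \<and> f j))"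

definition encodes :: "nat set \<Rightarrow> (nat \<Rightarrow> nat) \<Rightarrow> bool" where
  "encodes A Y \<longleftrightarrow> (\<forall>i i'. i < i' \<longrightarrow> i' \<le> k + 1 \<longrightarrow> Y i < Y i') \<and> Y 0 = 0 \<and> Y (k + 1) = m + 1 \<and>
     A = {y. \<exists>i. 1 \<le> i \<and> i \<le> k \<and> Y i = y + 1}"

lemma is_valD:
  assumes "is_val A f" "v < m"
  shows "inp v \<Longrightarrow> f v \<longleftrightarrow> v \<in> A"
    and "\<not> inp v \<Longrightarrow> neg v \<Longrightarrow> f v = b \<longleftrightarrow> (\<exists>j. prd v j \<and> f j = (\<not> b))"
    and "\<not> inp v \<Longrightarrow> neg v \<Longrightarrow> f v = b \<longleftrightarrow> (\<forall>j. prd v j \<longrightarrow> f j = (\<not> b))"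
    and "\<not> inp v \<Longrightarrow> \<not> neg v \<Longrightarrow> con v = b \<Longrightarrow> f v = b \<longleftrightarrow> (\<forall>j. prd v j \<longrightarrow> f j = b)"
    and "\<not> inp v \<Longrightarrow> \<not> neg v \<Longrightarrow> con v \<noteq> b \<Longrightarrow> f v = b \<longleftrightarrow> (\<exists>j. prd v j \<and> f j = b)"
proof -
  have *: "f v \<longleftrightarrow> (if inp v then v \<in> A else if neg v then \<exists>j. prd v j \<and> \<not> f j
     else if con v then \<forall>j. prd v j \<longrightarrow> f j else \<exists>j. prd v j \<and> f j)"
    using assms unfolding is_val_def by blast
  show "inp v \<Longrightarrow> f v \<longleftrightarrow> v \<in> A" using * by simp
  show "\<not> inp v \<Longrightarrow> neg v \<Longrightarrow> f v = b \<longleftrightarrow> (\<exists>j. prd v j \<and> f j = (\<not> b))"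
    "\<not> inp v \<Longrightarrow> neg v \<Longrightarrow> f v = b \<longleftrightarrow> (\<forall>j. prd v j \<longrightarrow> f j = (\<not> b))"
    using * neg_prd[OF assms(2)] by auto
  show "\<not> inp v \<Longrightarrow> \<not> neg v \<Longrightarrow> con v = b \<Longrightarrow> f v = b \<longleftrightarrow> (\<forall>j. prd v j \<longrightarrow> f j = b)"
    "\<not> inp v \<Longrightarrow> \<not> neg v \<Longrightarrow> con v \<noteq> b \<Longrightarrow> f v = b \<longleftrightarrow> (\<exists>j. prd v j \<and> f j = b)"
    using * by (cases b; auto)+
qed

lemma chosen_sound:
  assumes "encodes A Y" "\<rho> \<le> (\<lambda>i v. v = Y i)" "chosen \<rho> y"
  shows "y \<in> A"
proof -
  obtain i where "1 \<le> i" "i \<le> k" "\<rho> i (y + 1)" using assms(3) by (auto simp: chosen_def)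
  moreover from this have "Y i = y + 1" using assms(2) by (auto simp: le_fun_def)
  ultimately show ?thesis using assms(1) unfolding encodes_def by blast
qed

text \<open>As \<open>Y\<close> is increasing, none of its values up to index \<open>k + 1\<close>
  lies strictly between two consecutive ones.\<close>

lemma unchosen_sound:
  assumes "encodes A Y" "\<rho> \<le> (\<lambda>i v. v = Y i)" "unchosen \<rho> y"
  shows "y \<notin> A"
proof
  assume "y \<in> A"
  have mono: "\<And>i i'. i < i' \<Longrightarrow> i' \<le> k + 1 \<Longrightarrow> Y i < Y i'" using assms(1) by (simp add: encodes_def)
  obtain j where j: "j \<le> k" "Y j = y + 1" using assms(1) \<open>y \<in> A\<close> by (auto simp: encodes_def)
  obtain i v v' where "i \<le> k" "\<rho> i v" "\<rho> (Suc i) v'" "v < y + 1" "y + 1 < v'" using assms(3) by (auto simp: unchosen_def)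
  then have i: "i \<le> k" "Y i < Y j" "Y j < Y (Suc i)" using assms(2) j by (auto simp: le_fun_def)
  show False
  proof (cases "j \<le> i")
    case True
    then have "Y j \<le> Y i" using mono[of j i] i by (cases "j = i") auto
    then show False using i by simp
  next
    case False
    then have "Y (Suc i) \<le> Y j" using mono[of "Suc i" j] j by (cases "Suc i = j") auto
    then show False using i by simp
  qed
qed

text \<open>One index shows that an input is chosen, two show that it is not. For the latter take
  the first \<open>j\<close> with \<open>Y j\<close> at least \<open>v + 1\<close>: the end value
  \<open>m + 1\<close> ensures that it exists, the initial 0 that it is positive, and equality would
  make \<open>v\<close> chosen.\<close>

lemma input_complete:
  assumes "encodes A Y" "v < m" "(v \<in> A) = b"
  shows "\<exists>Q. length Q \<le> 2 \<and> set Q \<subseteq> {..k + 1} \<and> (if b then chosen (info Y Q) v else unchosen (info Y Q) v)"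
proof (cases b)
  case True
  then obtain i where "1 \<le> i" "i \<le> k" "Y i = v + 1" using assms(1,3) by (auto simp: encodes_def)
  then show ?thesis using True by (intro exI[of _ "[i]"]) (auto simp: chosen_def info_def)
next
  case False
  have "\<not> Y (k + 1) < v + 1" using assms(1,2) by (simp add: encodes_def)
  then obtain j where j: "j \<le> k + 1" "\<And>i. i < j \<Longrightarrow> Y i < v + 1" "\<not> Y j < v + 1"
    using ex_least_nat_le[of "\<lambda>j. \<not> Y j < v + 1" "k + 1"] by blast
  have "Y 0 = 0" using assms(1) by (simp add: encodes_def)
  then have "j \<noteq> 0" using j(3) by (cases j) auto
  then obtain i where i: "j = Suc i" by (cases j) auto
  have "Y j \<noteq> v + 1"
  proof
    assume eq: "Y j = v + 1"
    have "Y (k + 1) = m + 1" using assms(1) by (simp add: encodes_def)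
    then have "j \<noteq> k + 1" using eq assms(2) by auto
    then have "1 \<le> j" "j \<le> k" using j(1) i by auto
    then have "\<exists>i. 1 \<le> i \<and> i \<le> k \<and> Y i = v + 1" using eq by blast
    then have "v \<in> A" using assms(1) by (simp add: encodes_def)
    then show False using assms(3) False by simp
  qed
  then have "v + 1 < Y (Suc i)" "Y i < v + 1" "i \<le> k" using j i by auto
  then have "unchosen (info Y [i, Suc i]) v" unfolding unchosen_def info_def by auto
  then show ?thesis using False \<open>i \<le> k\<close> by (intro exI[of _ "[i, Suc i]"]) auto
qed

lemma forced_sound:
  assumes "encodes A Y" "\<rho> \<le> (\<lambda>i v. v = Y i)" "is_val A f"
  shows "v < m \<Longrightarrow> forced n \<rho> v b \<Longrightarrow> f v = b"
proof (induction n arbitrary: v b)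
  case (Suc n)
  note val = is_valD[OF assms(3) Suc.prems(1)]
  consider "inp v" | "\<not> inp v" "neg v" | "\<not> inp v" "\<not> neg v" "con v = b" | "\<not> inp v" "\<not> neg v" "con v \<noteq> b" by blast
  then show ?case
  proof cases
    case 1
    then show ?thesis using Suc.prems(2) chosen_sound[OF assms(1,2)] unchosen_sound[OF assms(1,2)] val(1)
      by (cases b) auto
  next
    case 2
    then obtain j where "j < m" "prd v j" "forced n \<rho> j (\<not> b)" using Suc.prems(2) by auto
    then show ?thesis using Suc.IH val(2)[OF 2] by blast
  next
    case 3
    then have "\<forall>j<m. prd v j \<longrightarrow> forced n \<rho> j b" using Suc.prems(2) by simp
    then show ?thesis using Suc.IH val(4)[OF 3] prd_less[OF Suc.prems(1)] by blast
  next
    case 4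
    then obtain j where "j < m" "prd v j" "forced n \<rho> j b" using Suc.prems(2) by auto
    then show ?thesis using Suc.IH val(5)[OF 4] by blast
  qed
qed simp

lemma fanin_two:
  assumes "v < m" "fanin v \<le> 2"
  shows "\<exists>j1 j2. \<forall>j. prd v j \<longrightarrow> j = j1 \<or> j = j2"
proof (rule ccontr)
  assume not: "\<not> ?thesis"
  then obtain j1 where j1: "prd v j1" by blast
  obtain j2 where j2: "prd v j2" "j2 \<noteq> j1" using not by blast
  obtain j3 where j3: "prd v j3" "j3 \<noteq> j1" "j3 \<noteq> j2" using not by blast
  have "card {j1, j2, j3} \<le> fanin v" unfolding fanin_def
    by (rule card_mono) (use j1 j2 j3 prd_less[OF assms(1)] in auto)
  then show False using j2 j3 assms(2) by simp
qed

text \<open>Weft 0 bounds the fan-in by 2 throughout, so the unfolding is a binary tree of depth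
  below \<open>n\<close>. The bound is \<open>2 ^ n\<close> and not \<open>2 ^ (n - 1)\<close>
  because an input may take two indices.\<close>

lemma forced_complete:
  assumes "encodes A Y" "is_val A f"
  shows "v < m \<Longrightarrow> wft v = 0 \<Longrightarrow> dep v < n \<Longrightarrow> f v = b \<Longrightarrow>
    \<exists>Q. length Q \<le> 2 ^ n \<and> set Q \<subseteq> {..k + 1} \<and> forced n (info Y Q) v b"
proof (induction n arbitrary: v b)
  case (Suc n)
  note val = is_valD[OF assms(2) Suc.prems(1)]
  have child: "\<exists>Q. length Q \<le> 2 ^ n \<and> set Q \<subseteq> {..k + 1} \<and> forced n (info Y Q) j b'"
    if "\<not> inp v" "prd v j" "f j = b'" for j b'
    using Suc.IH[OF prd_less[OF Suc.prems(1) that(2)] _ _ that(3)] wft[OF Suc.prems(1) that(1,2)]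
      dep[OF Suc.prems(1) that(1,2)] Suc.prems(2,3) by simp
  have two: "(2::nat) \<le> 2 ^ Suc n" by simp
  consider "inp v" | "\<not> inp v" "neg v" | "\<not> inp v" "\<not> neg v" "con v = b" | "\<not> inp v" "\<not> neg v" "con v \<noteq> b" by blast
  then show ?case
  proof cases
    case 1
    then have "(v \<in> A) = b" using val(1) Suc.prems(4) by simp
    from input_complete[OF assms(1) Suc.prems(1) this] obtain Q where "length Q \<le> 2" "set Q \<subseteq> {..k + 1}"
      "if b then chosen (info Y Q) v else unchosen (info Y Q) v" by blast
    moreover from this have "length Q \<le> 2 ^ Suc n" using two by linarith
    ultimately show ?thesis using 1 by (intro exI[of _ Q]) auto
  next
    case 2
    have "\<exists>j. prd v j \<and> f j = (\<not> b)" using val(2)[OF 2, of b] Suc.prems(4) by simp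
    then obtain j where j: "prd v j" "f j = (\<not> b)" by blast
    from child[OF 2(1) j] obtain Q where "length Q \<le> 2 ^ n" "set Q \<subseteq> {..k + 1}" "forced n (info Y Q) j (\<not> b)" by blast
    then show ?thesis using 2 j prd_less[OF Suc.prems(1) j(1)] by (intro exI[of _ Q]) auto
  next
    case 3
    have "\<not> 2 < fanin v" using wft_large[OF Suc.prems(1) 3(1)] prd_ex[OF Suc.prems(1) 3(1)] Suc.prems(2) by auto
    then obtain j1 j2 where j12: "\<And>j. prd v j \<Longrightarrow> j = j1 \<or> j = j2" using fanin_two[OF Suc.prems(1)] by auto
    have all: "\<And>j. prd v j \<Longrightarrow> f j = b" using val(4)[OF 3] Suc.prems(4) by blast
    have Q: "\<exists>Q. length Q \<le> 2 ^ n \<and> set Q \<subseteq> {..k + 1} \<and> (prd v j \<longrightarrow> forced n (info Y Q) j b)" for j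
      using child[OF 3(1) _ all, of j] by (cases "prd v j") (auto intro: exI[of _ "[]"])
    obtain Q1 where Q1: "length Q1 \<le> 2 ^ n" "set Q1 \<subseteq> {..k + 1}" "prd v j1 \<longrightarrow> forced n (info Y Q1) j1 b" using Q by blast
    obtain Q2 where Q2: "length Q2 \<le> 2 ^ n" "set Q2 \<subseteq> {..k + 1}" "prd v j2 \<longrightarrow> forced n (info Y Q2) j2 b" using Q by blast
    have "forced n (info Y (Q1 @ Q2)) j b" if "prd v j" for j
      using j12[OF that] that Q1(3) Q2(3) forced_mono[OF info_mono[of Q1 "Q1 @ Q2" Y]] forced_mono[OF info_mono[of Q2 "Q1 @ Q2" Y]]
      by auto
    then show ?thesis using 3 Q1 Q2 by (intro exI[of _ "Q1 @ Q2"]) auto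
  next
    case 4
    then obtain j where j: "prd v j" "f j = b" using val(5) Suc.prems(4) by blast
    then obtain Q where "length Q \<le> 2 ^ n" "set Q \<subseteq> {..k + 1}" "forced n (info Y Q) j b" using child 4 by blast
    then show ?thesis using 4 j prd_less[OF Suc.prems(1) j(1)] by (intro exI[of _ Q]) auto
  qed
qed simp

text \<open>A wrong value is followed down a single branch: at most \<open>n\<close> indices are
  spent on witnesses along the way, and at most \<open>2 ^ n\<close> on a certificate at its end.
  The condition on \<open>c\<close> says that \<open>c\<close> plus \<open>2 * a\<close> times
  \<open>2 ^ n - 1\<close> is at most \<open>B\<close>. It survives doubling \<open>a\<close> and
  adding up to \<open>2 * a\<close> to \<open>c\<close> at the cost of one level, and it keeps the
  witness positions below \<open>B\<close>.\<close>

lemma check_sound: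
  assumes "encodes A Y" "is_val A f"
  shows "v < m \<Longrightarrow> wft v \<le> 1 \<Longrightarrow> dep v < n \<Longrightarrow> f v \<noteq> b \<Longrightarrow> 1 \<le> a \<Longrightarrow> c + 2 * a * 2 ^ n \<le> B + 2 * a \<Longrightarrow>
    \<exists>Q. length Q \<le> n + 2 ^ n \<and> set Q \<subseteq> {..<k + 2 + B} \<and> \<not> check n (info Y Q) v b a c"
proof (induction n arbitrary: v b a c)
  case (Suc n)
  note val = is_valD[OF assms(2) Suc.prems(1)]
  have fv: "f v = (\<not> b)" using Suc.prems(4) by auto
  have pos: "(1::nat) \<le> 2 ^ n" by simp
  have "2 * a * 2 \<le> 2 * a * 2 ^ Suc n" by (intro mult_left_mono) auto
  then have cB: "c < B" using Suc.prems(5,6) by linarith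
  have child: "\<exists>Q. length Q \<le> n + 2 ^ n \<and> set Q \<subseteq> {..<k + 2 + B} \<and> \<not> check n (info Y Q) j b' (2 * a) (s + c)"
    if "\<not> inp v" "prd v j" "f j \<noteq> b'" "s = a \<or> s = 2 * a" for j b' s
  proof (rule Suc.IH)
    show "j < m" "f j \<noteq> b'" using prd_less[OF Suc.prems(1)] that by auto
    show "wft j \<le> 1" "dep j < n" using wft[OF Suc.prems(1) that(1,2)] dep[OF Suc.prems(1) that(1,2)] Suc.prems(2,3) by simp_all
    show "1 \<le> 2 * a" using Suc.prems(5) by simp
    have "s + c + 2 * (2 * a) * 2 ^ n \<le> 2 * a + (c + 2 * a * 2 ^ Suc n)" using that(4) by auto
    then show "s + c + 2 * (2 * a) * 2 ^ n \<le> B + 2 * (2 * a)" using Suc.prems(6) by simp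
  qed
  have mono: "length Q \<le> n + 2 ^ n \<Longrightarrow> length Q \<le> Suc n + 2 ^ Suc n" for Q :: "nat list" by simp
  consider "inp v" | "\<not> inp v" "neg v" | "\<not> inp v" "\<not> neg v" "con v = b" "fanin v \<le> 2"
    | "\<not> inp v" "\<not> neg v" "con v = b" "2 < fanin v" | "\<not> inp v" "\<not> neg v" "con v \<noteq> b" by linarith
  then show ?case
  proof cases
    case 1
    then have "(v \<in> A) = (\<not> b)" using val(1) fv by simp
    from input_complete[OF assms(1) Suc.prems(1) this] obtain Q where Q: "length Q \<le> 2" "set Q \<subseteq> {..k + 1}"
      "if \<not> b then chosen (info Y Q) v else unchosen (info Y Q) v" by blast
    have "(2::nat) ^ Suc n = 2 * 2 ^ n" by simp
    then have "length Q \<le> Suc n + 2 ^ Suc n" using Q(1) pos by linarith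
    moreover have "set Q \<subseteq> {..<k + 2 + B}" using Q(2) by force
    ultimately show ?thesis using 1 Q(3) by (intro exI[of _ Q]) auto
  next
    case 2
    then obtain j where j: "prd v j" "f j = b" using val(2)[of "\<not> b"] fv by auto
    then obtain Q where "length Q \<le> n + 2 ^ n" "set Q \<subseteq> {..<k + 2 + B}" "\<not> check n (info Y Q) j (\<not> b) (2 * a) (a + c)"
      using child[OF 2(1) j(1), of "\<not> b" a] by auto
    then show ?thesis using 2 j prd_less[OF Suc.prems(1) j(1)] mono by (intro exI[of _ Q]) auto
  next
    case 3
    then obtain j where j: "prd v j" "f j \<noteq> b" using val(4)[of b] fv by auto
    let ?s = "if \<exists>j'<j. prd v j' then 2 * a else a"
    have s: "?s = a \<or> ?s = 2 * a" by simp
    obtain Q where "length Q \<le> n + 2 ^ n" "set Q \<subseteq> {..<k + 2 + B}" "\<not> check n (info Y Q) j b (2 * a) (?s + c)"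
      using child[OF 3(1) j s] by blast
    then show ?thesis using 3 j prd_less[OF Suc.prems(1) j(1)] mono[of Q] by (intro exI[of _ Q]) (auto split: if_splits)
  next
    case 4
    then obtain j where j: "prd v j" "f j = (\<not> b)" using val(4)[of b] fv by auto
    have "wft j = 0" using wft_large[OF Suc.prems(1) 4(1,4) j(1)] Suc.prems(2) by simp
    moreover have "dep j < n" using dep[OF Suc.prems(1) 4(1) j(1)] Suc.prems(3) by simp
    ultimately obtain Q where Q: "length Q \<le> 2 ^ n" "set Q \<subseteq> {..k + 1}" "forced n (info Y Q) j (\<not> b)"
      using forced_complete[OF assms prd_less[OF Suc.prems(1) j(1)] _ _ j(2)] by blast
    have "length Q \<le> Suc n + 2 ^ Suc n" using Q(1) by simp
    moreover have "set Q \<subseteq> {..<k + 2 + B}" using Q(2) by force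
    moreover have "\<not> check (Suc n) (info Y Q) v b a c" using 4 j(1) prd_less[OF Suc.prems(1) j(1)] Q(3) by auto
    ultimately show ?thesis by blast
  next
    case 5
    have children: "f j \<noteq> b" if "prd v j" for j using val(5)[OF 5] fv that by blast
    let ?i = "k + 2 + c"
    show ?thesis
    proof (cases "Y ?i < m \<and> prd v (Y ?i)")
      case True
      then obtain Q where Q: "length Q \<le> n + 2 ^ n" "set Q \<subseteq> {..<k + 2 + B}" "\<not> check n (info Y Q) (Y ?i) b (2 * a) (a + c)"
        using child[OF 5(1) _ children, of "Y ?i" a] by auto
      have "\<not> check n (info Y (?i # Q)) (Y ?i) b (2 * a) (a + c)"
      proof -
        have "info Y Q \<le> info Y (?i # Q)" by (rule info_mono) auto
        then show ?thesis using Q(3) check_antimono by blast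
      qed
      then have "\<not> check (Suc n) (info Y (?i # Q)) v b a c" using 5 by (auto simp: info_def)
      moreover have "length (?i # Q) \<le> Suc n + 2 ^ Suc n" using Q(1) by simp
      moreover have "set (?i # Q) \<subseteq> {..<k + 2 + B}" using Q(2) cB by simp
      ultimately show ?thesis by blast
    next
      case False
      \<comment> \<open>A stored value that names no child of \<open>v\<close> violates the check by
        itself.\<close>
      then have "\<not> check (Suc n) (info Y [?i]) v b a c" using 5 by (auto simp: info_def)
      then show ?thesis using cB by (intro exI[of _ "[?i]"]) simp
    qed
  qed
qed simp

text \<open>The witnesses are chosen before \<open>\<rho>\<close>, \<open>Y\<close>,
  \<open>a\<close> and \<open>c\<close>, so the families for subtrees can be placed anywhere in the
  heap and joined by \<open>branch\<close>.\<close>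

lemma check_complete:
  assumes "is_val A f" "0 < m"
  shows "v < m \<Longrightarrow> f v = b \<Longrightarrow> \<exists>w. (\<forall>q. w q < m) \<and> (\<forall>\<rho> Y a c. encodes A Y \<longrightarrow> \<rho> \<le> (\<lambda>i v. v = Y i) \<longrightarrow>
    (\<forall>q. Y (k + 2 + (a * q + c)) = w q) \<longrightarrow> check n \<rho> v b a c)"
proof (induction n arbitrary: v b)
  case 0
  then show ?case using assms(2) by auto
next
  case (Suc n)
  note val = is_valD[OF assms(1) Suc.prems(1)]
  define good where "good j b' w \<longleftrightarrow> (\<forall>q. w q < m) \<and> (\<forall>\<rho> Y a c. encodes A Y \<longrightarrow> \<rho> \<le> (\<lambda>i v. v = Y i) \<longrightarrow>
    (\<forall>q. Y (k + 2 + (a * q + c)) = w q) \<longrightarrow> check n \<rho> j b' a c)" for j b' w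
  have child: "\<exists>w. good j b' w" if "prd v j" "f j = b'" for j b'
    unfolding good_def by (rule Suc.IH) (use prd_less[OF Suc.prems(1) that(1)] that(2) in auto)
  have left: "check n \<rho> j b' (2 * a) (a + c)"
    if "good j b' w1" "encodes A Y" "\<rho> \<le> (\<lambda>i v. v = Y i)" "\<forall>q. Y (k + 2 + (a * q + c)) = branch x w1 w2 q" for j b' w1 w2 x \<rho> Y a c
  proof -
    have "Y (k + 2 + (2 * a * q + (a + c))) = w1 q" for q
      using that(4)[rule_format, of "2 * q + 1"] unfolding branch_simps by (simp add: algebra_simps)
    then show ?thesis using that(1-3) unfolding good_def by blast
  qed
  have right: "check n \<rho> j b' (2 * a) (2 * a + c)"
    if "good j b' w2" "encodes A Y" "\<rho> \<le> (\<lambda>i v. v = Y i)" "\<forall>q. Y (k + 2 + (a * q + c)) = branch x w1 w2 q" for j b' w1 w2 x \<rho> Y a c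
  proof -
    have "Y (k + 2 + (2 * a * q + (2 * a + c))) = w2 q" for q
      using that(4)[rule_format, of "2 * q + 2"] unfolding branch_simps by (simp add: algebra_simps)
    then show ?thesis using that(1-3) unfolding good_def by blast
  qed
  have bound: "\<forall>q. branch x w1 w2 q < m" if "x < m" "\<And>q. w1 q < m" "\<And>q. w2 q < m" for x w1 w2
    using that by simp
  have zero: "(\<lambda>_::nat. 0::nat) q < m" for q using assms(2) by simp
  consider "inp v" | "\<not> inp v" "neg v" | "\<not> inp v" "\<not> neg v" "con v = b" "fanin v \<le> 2"
    | "\<not> inp v" "\<not> neg v" "con v = b" "2 < fanin v" | "\<not> inp v" "\<not> neg v" "con v \<noteq> b" by linarith
  then show ?case
  proof cases
    case 1
    have "check (Suc n) \<rho> v b a c" if "encodes A Y" "\<rho> \<le> (\<lambda>i v. v = Y i)" for \<rho> Y a c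
      using 1 val(1) Suc.prems(2) chosen_sound[OF that, of v] unchosen_sound[OF that, of v] by (cases b) auto
    then show ?thesis using zero by (intro exI[of _ "\<lambda>_. 0"]) blast
  next
    case 2
    obtain j where j: "\<And>j'. prd v j' \<longleftrightarrow> j' = j" using neg_prd[OF Suc.prems(1) 2] by blast
    have fj: "f j = (\<not> b)" using val(3)[OF 2, of b] Suc.prems(2) j[of j] by simp
    then obtain w where w: "good j (\<not> b) w" using child[OF _ fj] j[of j] by blast
    have "check (Suc n) \<rho> v b a c" if "encodes A Y" "\<rho> \<le> (\<lambda>i v. v = Y i)" "\<forall>q. Y (k + 2 + (a * q + c)) = branch 0 w w q" for \<rho> Y a c
      using left[OF w that] 2 j by simp
    moreover have "\<forall>q. branch 0 w w q < m" by (rule bound) (use w assms(2) in \<open>simp_all add: good_def\<close>)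
    ultimately show ?thesis by blast
  next
    case 3
    \<comment> \<open>\<open>check\<close> sends the least child to the left and every other one to
      the right. With at most two children, the other one is unique if it exists.\<close>
    define first where "first = (LEAST j. prd v j)"
    define second where "second = (SOME j. prd v j \<and> j \<noteq> first)"
    have snd: "j = second" if "prd v j" "j \<noteq> first" for j
    proof -
      have s: "prd v second \<and> second \<noteq> first" unfolding second_def by (rule someI[of _ j]) (use that in auto)
      have "prd v first" unfolding first_def using that(1) by (rule LeastI)
      obtain j1 j2 where "\<And>j. prd v j \<Longrightarrow> j = j1 \<or> j = j2" using fanin_two[OF Suc.prems(1) 3(4)] by auto
      then show ?thesis using s that \<open>prd v first\<close> by metis
    qed
    have all: "f j = b" if "prd v j" for j using val(4)[OF 3(1-3)] Suc.prems(2) that by blast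
    have wit: "\<exists>w. (\<forall>q. w q < m) \<and> (prd v j \<longrightarrow> good j b w)" for j
    proof (cases "prd v j")
      case True
      then show ?thesis using child[OF True all[OF True]] by (auto simp: good_def)
    next
      case False
      then show ?thesis using zero by (intro exI[of _ "\<lambda>_. 0"]) blast
    qed
    obtain w1 where w1: "\<And>q. w1 q < m" "prd v first \<Longrightarrow> good first b w1" using wit by blast
    obtain w2 where w2: "\<And>q. w2 q < m" "prd v second \<Longrightarrow> good second b w2" using wit by blast
    have "check (Suc n) \<rho> v b a c"
      if Y: "encodes A Y" "\<rho> \<le> (\<lambda>i v. v = Y i)" "\<forall>q. Y (k + 2 + (a * q + c)) = branch 0 w1 w2 q" for \<rho> Y a c
    proof -
      have "if \<exists>j'<j. prd v j' then check n \<rho> j b (2 * a) (2 * a + c) else check n \<rho> j b (2 * a) (a + c)" if j: "prd v j" for j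
      proof (cases "j = first")
        case True
        then have "(\<exists>j'<j. prd v j') = False" using not_less_Least[of _ "prd v"] unfolding first_def by blast
        moreover have "check n \<rho> j b (2 * a) (a + c)" using left[OF w1(2) Y] True j by simp
        ultimately show ?thesis by (simp only: if_False)
      next
        case False
        have "prd v first" "first \<le> j" unfolding first_def using j by (rule LeastI, rule Least_le)
        then have "(\<exists>j'<j. prd v j') = True" using False by (auto intro!: exI[of _ first])
        moreover have "check n \<rho> j b (2 * a) (2 * a + c)" using right[OF w2(2) Y] snd[OF j False] j by simp
        ultimately show ?thesis by (simp only: if_True)
      qed
      then show ?thesis using 3 by simp
    qed
    moreover have "\<forall>q. branch 0 w1 w2 q < m" by (rule bound) (use w1(1) w2(1) assms(2) in simp_all)
    ultimately show ?thesis by blast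
  next
    case 4
    have all: "f j = b" if "prd v j" for j using val(4)[OF 4(1-3)] Suc.prems(2) that by blast
    have "check (Suc n) \<rho> v b a c" if Y: "encodes A Y" "\<rho> \<le> (\<lambda>i v. v = Y i)" for \<rho> Y a c
    proof -
      have "\<not> forced n \<rho> j (\<not> b)" if "prd v j" for j
        using forced_sound[OF Y assms(1) prd_less[OF Suc.prems(1) that], of n "\<not> b"] all[OF that] by blast
      then show ?thesis using 4 by simp
    qed
    then show ?thesis using zero by (intro exI[of _ "\<lambda>_. 0"]) blast
  next
    case 5
    then obtain j where j: "prd v j" "f j = b" using val(5)[OF 5] Suc.prems(2) by blast
    then obtain w where w: "good j b w" using child by blast
    have jm: "j < m" using prd_less[OF Suc.prems(1) j(1)] .
    have "check (Suc n) \<rho> v b a c"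
      if Y: "encodes A Y" "\<rho> \<le> (\<lambda>i v. v = Y i)" "\<forall>q. Y (k + 2 + (a * q + c)) = branch j w w q" for \<rho> Y a c
    proof -
      have "Y (k + 2 + c) = j" using Y(3)[rule_format, of 0] by simp
      then have "u = j" if "\<rho> (k + 2 + c) u" for u using Y(2) that by (auto simp: le_fun_def)
      then show ?thesis using 5 left[OF w Y] j(1) jm by auto
    qed
    moreover have "\<forall>q. branch j w w q < m" by (rule bound) (use w jm in \<open>simp_all add: good_def\<close>)
    ultimately show ?thesis by blast
  qed
qed

lemma ex_encodes:
  assumes "A \<subseteq> {..<m}" "card A = k"
  shows "\<exists>Y. encodes A Y"
proof -
  let ?l = "sorted_list_of_set A"
  have fin: "finite A" using assms(1) finite_subset by blast
  have l: "length ?l = k" "set ?l = A" "sorted_wrt (<) ?l" using fin assms(2) by auto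
  have less: "?l ! i < m" if "i < k" for i using l that assms(1) nth_mem[of i ?l] by auto
  define Y where "Y i = (if i = 0 then 0 else if i \<le> k then ?l ! (i - 1) + 1 else m + 1)" for i
  have "Y i < Y i'" if "i < i'" "i' \<le> k + 1" for i i'
    using that l less[of "i - 1"] sorted_wrt_nth_less[OF l(3), of "i - 1" "i' - 1"] by (auto simp: Y_def)
  moreover have "A = {y. \<exists>i. 1 \<le> i \<and> i \<le> k \<and> Y i = y + 1}"
  proof (intro equalityI subsetI CollectI)
    fix y assume "y \<in> A"
    then obtain i where "i < k" "?l ! i = y" using l by (metis in_set_conv_nth)
    then show "\<exists>i. 1 \<le> i \<and> i \<le> k \<and> Y i = y + 1" by (intro exI[of _ "Suc i"]) (simp add: Y_def)
  next
    fix y assume "y \<in> {y. \<exists>i. 1 \<le> i \<and> i \<le> k \<and> Y i = y + 1}"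
    then obtain i where "1 \<le> i" "i \<le> k" "?l ! (i - 1) = y" by (auto simp: Y_def)
    then show "y \<in> A" using l nth_mem[of "i - 1" ?l] by auto
  qed
  ultimately show ?thesis by (intro exI[of _ Y]) (simp add: encodes_def Y_def)
qed

lemma card_encodes:
  assumes "encodes A Y"
  shows "card A = k"
proof -
  have mono: "\<And>i i'. i < i' \<Longrightarrow> i' \<le> k + 1 \<Longrightarrow> Y i < Y i'" and "Y 0 = 0" using assms by (auto simp: encodes_def)
  have pos: "Y i \<ge> 1" if "1 \<le> i" "i \<le> k" for i using mono[of 0 i] that by simp
  have "inj_on (\<lambda>i. Y i - 1) {1..k}"
  proof (rule inj_onI)
    fix i i' assume i: "i \<in> {1..k}" "i' \<in> {1..k}" "Y i - 1 = Y i' - 1"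
    then have "Y i = Y i'" using pos[of i] pos[of i'] by simp
    then show "i = i'" using mono[of i i'] mono[of i' i] i by (cases i i' rule: linorder_cases) auto
  qed
  moreover have "A = (\<lambda>i. Y i - 1) ` {1..k}"
  proof (intro equalityI subsetI)
    fix y assume "y \<in> A"
    then obtain i where "1 \<le> i" "i \<le> k" "Y i = y + 1" using assms by (auto simp: encodes_def)
    then show "y \<in> (\<lambda>i. Y i - 1) ` {1..k}" by (intro image_eqI[of _ _ i]) auto
  next
    fix y assume "y \<in> (\<lambda>i. Y i - 1) ` {1..k}"
    then obtain i where i: "1 \<le> i" "i \<le> k" "y = Y i - 1" by auto
    then have "Y i = y + 1" using pos[of i] by simp
    then show "y \<in> A" using assms i unfolding encodes_def by blast
  qed
  ultimately show ?thesis by (simp add: card_image)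
qed

text \<open>\<open>t\<close> consists of \<open>k + 2\<close> indices for the chosen inputs and the
  two end values, and of \<open>2 * 2 ^ n\<close> witness positions. Tuples of the fixed length
  \<open>q\<close> suffice because \<open>ok_info\<close> is antimonotone: shorter lists are padded
  with index 0. A length of at least 2 is required to compare pairs.\<close>

theorem sat_iff_ok_info:
  assumes val: "\<And>A. is_val A (F A)" and m: "0 < m" "wft (m - 1) \<le> 1" "dep (m - 1) < n"
    and q: "n + 2 ^ n \<le> q" "2 \<le> q"
  defines "t \<equiv> k + 2 + 2 * 2 ^ n"
  shows "(\<exists>A. A \<subseteq> {v. v < m \<and> inp v} \<and> card A = k \<and> F A (m - 1)) \<longleftrightarrow>
    (\<exists>Y. (\<forall>i. Y i < m + 2) \<and> (\<forall>Q. length Q = q \<longrightarrow> set Q \<subseteq> {..<t} \<longrightarrow> ok_info n (info Y Q)))"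
    (is "?L \<longleftrightarrow> (\<exists>Y. ?R Y)")
proof
  assume ?L
  then obtain A where A: "A \<subseteq> {v. v < m \<and> inp v}" "card A = k" "F A (m - 1)" by blast
  have "A \<subseteq> {..<m}" using A(1) by auto
  then obtain X where X: "encodes A X" using ex_encodes A(2) by blast
  obtain w where w: "\<forall>q. w q < m" "\<And>\<rho> Y a c. encodes A Y \<Longrightarrow> \<rho> \<le> (\<lambda>i v. v = Y i) \<Longrightarrow>
    (\<forall>q. Y (k + 2 + (a * q + c)) = w q) \<Longrightarrow> check n \<rho> (m - 1) True a c"
    using check_complete[OF val m(1), of "m - 1" A True n] m(1) A(3) by auto
  define Y where "Y i = (if i \<le> k + 1 then X i else w (i - (k + 2)))" for i
  have enc: "encodes A Y" using X unfolding encodes_def Y_def by auto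
  have mono: "\<And>i i'. i < i' \<Longrightarrow> i' \<le> k + 1 \<Longrightarrow> Y i < Y i'" and ends: "Y 0 = 0" "Y (k + 1) = m + 1"
    using enc by (auto simp: encodes_def)
  have "Y i < m + 2" for i
  proof (cases "i \<le> k + 1")
    case True
    then show ?thesis using mono[of i "k + 1"] ends by (cases "i = k + 1") auto
  next
    case False
    then show ?thesis using w(1)[rule_format, of "i - (k + 2)"] by (simp add: Y_def)
  qed
  moreover have "ok_info n (info Y Q)" for Q
    unfolding ok_info_def
  proof (intro conjI allI impI)
    fix i v i' v' assume "info Y Q i v" "info Y Q i' v'" "i < i'" "i' \<le> k + 1"
    then show "v < v'" using mono by (simp add: info_def)
  next
    fix i v assume v: "info Y Q i v"
    show "i = 0 \<Longrightarrow> v = 0" "i = k + 1 \<Longrightarrow> v = m + 1" using v ends by (simp_all add: info_def)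
    assume i: "1 \<le> i \<and> i \<le> k"
    then have pos: "1 \<le> Y i" using mono[of 0 i] ends by simp
    then have "Y i - 1 \<in> A" using enc i unfolding encodes_def by force
    then show "1 \<le> v" "v \<le> m" "inp (v - 1)" using A(1) v pos by (auto simp: info_def)
  next
    show "check n (info Y Q) (m - 1) True 1 0"
      by (rule w(2)[OF enc]) (auto simp: info_def le_fun_def Y_def)
  qed
  ultimately show "\<exists>Y. ?R Y" by blast
next
  assume "\<exists>Y. ?R Y"
  then obtain Y where Y: "\<And>Q. length Q = q \<Longrightarrow> set Q \<subseteq> {..<t} \<Longrightarrow> ok_info n (info Y Q)" by blast
  have ok: "ok_info n (info Y Q)" if "length Q \<le> q" "set Q \<subseteq> {..<t}" for Q
  proof -
    let ?Q = "Q @ replicate (q - length Q) 0"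
    have "ok_info n (info Y ?Q)" by (rule Y) (use that in \<open>auto simp: t_def\<close>)
    then show ?thesis using ok_info_antimono[OF info_mono[of Q ?Q Y]] by simp
  qed
  have mono: "Y i < Y i'" if "i < i'" "i' \<le> k + 1" for i i'
    using ok[of "[i, i']"] that q(2) unfolding ok_info_def info_def t_def by auto
  have single: "(i = 0 \<longrightarrow> Y i = 0) \<and> (i = k + 1 \<longrightarrow> Y i = m + 1) \<and>
    (1 \<le> i \<and> i \<le> k \<longrightarrow> 1 \<le> Y i \<and> Y i \<le> m \<and> inp (Y i - 1))" if "i \<le> k + 1" for i
  proof -
    have "ok_info n (info Y [i])" by (rule ok) (use that q(2) in \<open>auto simp: t_def\<close>)
    moreover have "info Y [i] i (Y i)" by (simp add: info_def)
    ultimately show ?thesis by (rule ok_infoD)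
  qed
  have ends: "Y 0 = 0" "Y (k + 1) = m + 1" using single[of 0] single[of "k + 1"] by simp_all
  have inputs: "1 \<le> Y i \<and> Y i \<le> m \<and> inp (Y i - 1)" if "1 \<le> i" "i \<le> k" for i
    using single[of i] that by simp
  define A where "A = {y. \<exists>i. 1 \<le> i \<and> i \<le> k \<and> Y i = y + 1}"
  have enc: "encodes A Y" using mono ends by (simp add: encodes_def A_def)
  have "A \<subseteq> {v. v < m \<and> inp v}"
  proof
    fix y assume "y \<in> A"
    then obtain i where i: "1 \<le> i" "i \<le> k" "Y i = y + 1" by (auto simp: A_def)
    then show "y \<in> {v. v < m \<and> inp v}" using inputs[OF i(1,2)] by auto
  qed
  moreover have "F A (m - 1)"
  proof (rule ccontr)
    assume "\<not> F A (m - 1)"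
    then obtain Q where Q: "length Q \<le> n + 2 ^ n" "set Q \<subseteq> {..<k + 2 + 2 * 2 ^ n}" "\<not> check n (info Y Q) (m - 1) True 1 0"
      using check_sound[OF enc val, of "m - 1" n True 1 0 "2 * 2 ^ n"] m by auto
    then have "ok_info n (info Y Q)" using q(1) by (intro ok) (auto simp: t_def)
    then show False using Q(3) by (simp add: ok_info_def)
  qed
  ultimately show ?L using card_encodes[OF enc] by blast
qed

end

section \<open>Definable functions\<close>

type_synonym env = "(bool list \<times> nat) \<times> (nat \<Rightarrow> nat)"

definition bits :: "env \<Rightarrow> bool list" where "bits e = fst (fst e)"
definition par :: "env \<Rightarrow> nat" where "par e = snd (fst e)"
definition peek :: "env \<Rightarrow> nat" where "peek e = snd e 0"
definition pop :: "env \<Rightarrow> env" where "pop e = (fst e, \<lambda>i. snd e (Suc i))"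

lemma bits_pop: "bits (pop e) = bits e" and par_pop: "par (pop e) = par e"
  by (simp_all add: bits_def par_def pop_def)

definition definable :: "(env \<Rightarrow> nat) \<Rightarrow> bool" where
  "definable F \<longleftrightarrow> (\<exists>t. \<forall>x k st. tval x k t st = F ((x, k), st))"

definition definableb :: "(env \<Rightarrow> bool) \<Rightarrow> bool" where
  "definableb P \<longleftrightarrow> definable (\<lambda>e. of_bool (P e))"

named_theorems defin

lemma definable_const [defin]: "definable (\<lambda>_. n)"
  unfolding definable_def by (intro exI[of _ "Num n"]) simp

lemma definable_var: "definable (\<lambda>e. snd e i)"
  unfolding definable_def by (intro exI[of _ "Var i"]) simp

lemma definable_peek [defin]: "definable peek"
  unfolding peek_def[abs_def] by (rule definable_var)

lemma definable_len [defin]: "definable (\<lambda>e. length (bits e))"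
  unfolding definable_def by (intro exI[of _ Len]) (simp add: bits_def)

lemma definable_par [defin]: "definable (\<lambda>e. par e)"
  unfolding definable_def by (intro exI[of _ Par]) (simp add: par_def)

lemma definable_pop: "definable F \<Longrightarrow> definable (\<lambda>e. F (pop e))"
  unfolding definable_def
proof (elim exE)
  fix t assume "\<forall>x k st. tval x k t st = F ((x, k), st)"
  then show "\<exists>t. \<forall>x k st. tval x k t st = F (pop ((x, k), st))"
    by (intro exI[of _ "Pop t"]) (simp add: pop_def)
qed

lemma definable_add [defin]: "definable F \<Longrightarrow> definable G \<Longrightarrow> definable (\<lambda>e. F e + G e)"
  unfolding definable_def by (metis tval.simps(6))

lemma definable_diff [defin]: "definable F \<Longrightarrow> definable G \<Longrightarrow> definable (\<lambda>e. F e - G e)"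
  unfolding definable_def by (metis tval.simps(7))

text \<open>Inside a sum the bound variable is \<open>peek e\<close> and the outer environment is
  \<open>pop e\<close>. This is de Bruijn indexing, written so that functions with bound variables
  can be treated by rules.\<close>

lemma definable_sum [defin]:
  assumes "definable F" "definable (\<lambda>e. G (pop e) (peek e))"
  shows "definable (\<lambda>e. \<Sum>i<F e. G e i)"
proof -
  obtain t u where t: "\<And>x k st. tval x k t st = F ((x, k), st)"
    and u: "\<And>x k st. tval x k u st = G (pop ((x, k), st)) (peek ((x, k), st))"
    using assms by (auto simp: definable_def)
  have "tval x k (Sum t u) st = (\<Sum>i<F ((x, k), st). G ((x, k), st) i)" for x k st
    by (simp add: t u pop_def peek_def)
  then show ?thesis unfolding definable_def by blast
qed

lemma definableb_bit [defin]: "definable F \<Longrightarrow> definableb (\<lambda>e. F e < length (bits e) \<and> bits e ! F e)"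
  unfolding definable_def definableb_def
proof (elim exE)
  fix t assume "\<forall>x k st. tval x k t st = F ((x, k), st)"
  then show "\<exists>t. \<forall>x k st. tval x k t st = of_bool (F ((x, k), st) < length (bits ((x, k), st)) \<and> bits ((x, k), st) ! F ((x, k), st))"
    by (intro exI[of _ "Bit t"]) (simp add: bits_def)
qed

lemma definable_Suc [defin]: "definable F \<Longrightarrow> definable (\<lambda>e. Suc (F e))"
  using definable_add[OF _ definable_const[of 1], of F] by simp

lemma definable_cong: "definable F \<Longrightarrow> (\<And>e. G e = F e) \<Longrightarrow> definable G"
  by presburger

lemma definableb_not [defin]: "definableb P \<Longrightarrow> definableb (\<lambda>e. \<not> P e)"
  unfolding definableb_def by (rule definable_cong[OF definable_diff[OF definable_const[of 1]]]) auto

lemma definableb_conj [defin]: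
  assumes "definableb P" "definableb Q"
  shows "definableb (\<lambda>e. P e \<and> Q e)"
proof -
  have "definable (\<lambda>e. (of_bool (P e) + of_bool (Q e)) - 1)"
    using assms unfolding definableb_def by (intro defin)
  then show ?thesis unfolding definableb_def by (rule definable_cong) auto
qed

lemma definableb_cong: "definableb P \<Longrightarrow> (\<And>e. Q e = P e) \<Longrightarrow> definableb Q"
  by presburger

lemma definableb_disj [defin]:
  assumes "definableb P" "definableb Q"
  shows "definableb (\<lambda>e. P e \<or> Q e)"
proof -
  have "definableb (\<lambda>e. \<not> (\<not> P e \<and> \<not> Q e))" using assms by (intro defin)
  then show ?thesis by (rule definableb_cong) auto
qed

lemma definableb_imp [defin]:
  assumes "definableb P" "definableb Q"
  shows "definableb (\<lambda>e. P e \<longrightarrow> Q e)"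
proof -
  have "definableb (\<lambda>e. \<not> P e \<or> Q e)" using assms by (intro defin)
  then show ?thesis by (rule definableb_cong) auto
qed

lemma definableb_const [defin]: "definableb (\<lambda>_. b)"
  unfolding definableb_def by (rule definable_const)

lemma definableb_if [defin]:
  assumes "definableb P" "definableb Q" "definableb R"
  shows "definableb (\<lambda>e. if P e then Q e else R e)"
proof -
  have "definableb (\<lambda>e. (P e \<longrightarrow> Q e) \<and> (\<not> P e \<longrightarrow> R e))" using assms by (intro defin)
  then show ?thesis by (rule definableb_cong) auto
qed

lemma definableb_less [defin]:
  assumes "definable F" "definable G"
  shows "definableb (\<lambda>e. F e < G e)"
proof -
  have "definable (\<lambda>e. 1 - (1 - (G e - F e)))" using assms by (intro defin)
  then show ?thesis unfolding definableb_def by (rule definable_cong) auto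
qed

lemma definableb_le [defin]:
  assumes "definable F" "definable G"
  shows "definableb (\<lambda>e. F e \<le> G e)"
proof -
  have "definableb (\<lambda>e. \<not> G e < F e)" using assms by (intro defin)
  then show ?thesis by (rule definableb_cong) auto
qed

lemma definableb_eq [defin]:
  assumes "definable F" "definable G"
  shows "definableb (\<lambda>e. F e = G e)"
proof -
  have "definableb (\<lambda>e. F e \<le> G e \<and> G e \<le> F e)" using assms by (intro defin)
  then show ?thesis by (rule definableb_cong) auto
qed

lemma definable_of_bool [defin]: "definableb P \<Longrightarrow> definable (\<lambda>e. of_bool (P e))"
  by (simp add: definableb_def)

lemma definableb_ex [defin]:
  assumes "definable F" "definableb (\<lambda>e. P (pop e) (peek e))"
  shows "definableb (\<lambda>e. \<exists>i<F e. P e i)"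
proof -
  have "definableb (\<lambda>e. 0 < (\<Sum>i<F e. of_bool (P e i) :: nat))"
    using assms by (intro defin)
  moreover have "0 < (\<Sum>i<n. of_bool (Q i) :: nat) \<longleftrightarrow> (\<exists>i<n. Q i)" for n :: nat and Q
    by (induction n) (auto simp: less_Suc_eq)
  ultimately show ?thesis by simp
qed

lemma definableb_all [defin]:
  assumes "definable F" "definableb (\<lambda>e. P (pop e) (peek e))"
  shows "definableb (\<lambda>e. \<forall>i<F e. P e i)"
proof -
  have "definableb (\<lambda>e. \<not> (\<exists>i<F e. \<not> P e i))" using assms by (intro defin)
  then show ?thesis by simp
qed

lemma definable_mult [defin]:
  assumes "definable F" "definable G"
  shows "definable (\<lambda>e. F e * G e)"
proof -
  have "definable (\<lambda>e. \<Sum>i<F e. G e)" using assms definable_pop by (intro defin)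
  then show ?thesis by simp
qed

lemma definable_if [defin]:
  assumes "definableb P" "definable F" "definable G"
  shows "definable (\<lambda>e. if P e then F e else G e)"
proof -
  have "definable (\<lambda>e. of_bool (P e) * F e + of_bool (\<not> P e) * G e)" using assms by (intro defin)
  then show ?thesis by (rule definable_cong) auto
qed

lemma definable_power [defin]: "definable F \<Longrightarrow> definable (\<lambda>e. F e ^ n)"
  by (induction n) (simp_all add: definable_const definable_mult)

section \<open>Division, constant ranges and digits\<close>

text \<open>The quotient counts the positive multiples of \<open>b\<close> up to \<open>a\<close>;
  this expresses division on a machine that does not have it.\<close>

lemma div_as_sum: "a div b = (\<Sum>i<a. of_bool (0 < b \<and> (i + 1) * b \<le> a))" for a b :: nat
proof (cases "b = 0")
  case False
  have "(i + 1) * b \<le> a \<longleftrightarrow> i < a div b" for i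
    using False by (simp add: less_eq_div_iff_mult_less_eq Suc_le_eq[symmetric])
  then have "(\<Sum>i<a. of_bool (0 < b \<and> (i + 1) * b \<le> a)) = card ({..<a} \<inter> {i. i < a div b})"
    using False by (simp add: sum.If_cases of_bool_def)
  also have "{..<a} \<inter> {i. i < a div b} = {..<a div b}" using div_le_dividend[of a b] by (auto intro: less_le_trans)
  finally show ?thesis by simp
qed simp

lemma definable_div [defin]:
  assumes "definable F" "definable G"
  shows "definable (\<lambda>e. F e div G e)"
  unfolding div_as_sum using assms definable_pop by (intro defin)

lemma definable_mod [defin]:
  assumes "definable F" "definable G"
  shows "definable (\<lambda>e. F e mod G e)"
  unfolding minus_div_mult_eq_mod[symmetric] using assms by (intro defin)

lemma definableb_ex_const:
  assumes "\<And>j. definableb (\<lambda>e. P e j)"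
  shows "definableb (\<lambda>e. \<exists>j<n::nat. P e j)"
proof (induction n)
  case (Suc n)
  have "definableb (\<lambda>e. (\<exists>j<n. P e j) \<or> P e n)" by (intro definableb_disj assms Suc)
  then show ?case by (rule definableb_cong) (auto simp: less_Suc_eq)
qed (simp add: defin)

lemma definableb_all_const:
  assumes "\<And>j. definableb (\<lambda>e. P e j)"
  shows "definableb (\<lambda>e. \<forall>j<n::nat. P e j)"
proof -
  have "definableb (\<lambda>e. \<exists>j<n. \<not> P e j)" by (intro definableb_ex_const definableb_not assms)
  then have "definableb (\<lambda>e. \<not> (\<exists>j<n. \<not> P e j))" by (rule definableb_not)
  then show ?thesis by simp
qed

text \<open>Powers are definable for constant exponents, hence \<open>digit\<close> for constant
  positions. A computed position is treated by a case distinction over constantly many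
  values.\<close>

lemma definable_select:
  assumes "\<And>j. definable (\<lambda>e. F e j)" "definable J"
  shows "definable (\<lambda>e. if J e < n then F e (J e) else 0)"
proof (induction n)
  case (Suc n)
  have "definable (\<lambda>e. if J e = n then F e n else if J e < n then F e (J e) else 0)"
    by (intro definable_if definableb_eq definable_const assms Suc)
  moreover have "(if J e = n then F e n else if J e < n then F e (J e) else 0) = (if J e < Suc n then F e (J e) else 0)" for e
    by simp
  ultimately show ?case by simp
qed (simp add: defin)

definition digit :: "nat \<Rightarrow> nat \<Rightarrow> nat \<Rightarrow> nat" where
  "digit b a j = a div b ^ j mod b"

lemma definable_digit [defin]: "definable B \<Longrightarrow> definable A \<Longrightarrow> definable (\<lambda>e. digit (B e) (A e) j)"
  unfolding digit_def by (intro defin)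

fun number :: "nat \<Rightarrow> (nat \<Rightarrow> nat) \<Rightarrow> nat \<Rightarrow> nat" where
  "number b f 0 = 0"
| "number b f (Suc n) = f 0 + b * number b (\<lambda>i. f (Suc i)) n"

lemma number_less: "(\<And>i. i < n \<Longrightarrow> f i < b) \<Longrightarrow> number b f n < b ^ n"
proof (induction n arbitrary: f)
  case (Suc n)
  have "f 0 < b" using Suc.prems by simp
  moreover have "number b (\<lambda>i. f (Suc i)) n < b ^ n" using Suc by simp
  then have "b * (number b (\<lambda>i. f (Suc i)) n + 1) \<le> b * b ^ n" by (intro mult_left_mono) auto
  ultimately show ?case by (simp add: distrib_left)
qed simp

lemma digit_number: "(\<And>i. i < n \<Longrightarrow> f i < b) \<Longrightarrow> j < n \<Longrightarrow> digit b (number b f n) j = f j"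
proof (induction n arbitrary: f j)
  case (Suc n)
  have "f 0 < b" using Suc.prems by simp
  show ?case
  proof (cases j)
    case 0
    then show ?thesis using \<open>f 0 < b\<close> by (simp add: digit_def)
  next
    case (Suc j')
    then have "digit b (number b (\<lambda>i. f (Suc i)) n) j' = f j" using Suc.IH[of "\<lambda>i. f (Suc i)" j'] Suc.prems by simp
    moreover have "(f 0 + b * number b (\<lambda>i. f (Suc i)) n) div b = number b (\<lambda>i. f (Suc i)) n"
      using \<open>f 0 < b\<close> by simp
    ultimately show ?thesis using Suc by (simp add: digit_def div_mult2_eq)
  qed
qed simp

lemma digit_less: "0 < b \<Longrightarrow> digit b a j < b"
  by (simp add: digit_def)

section \<open>Reading circuits\<close>

definition bit_at :: "bool list \<Rightarrow> nat \<Rightarrow> bool" where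
  "bit_at x i \<longleftrightarrow> i < length x \<and> x ! i"

text \<open>A position counts as long as no bit up to it is False, so the sum is the length of the
  unary prefix.\<close>

definition gates :: "bool list \<Rightarrow> nat" where
  "gates x = (\<Sum>i<length x. of_bool (\<forall>j<Suc i. bit_at x j))"

definition entry :: "bool list \<Rightarrow> nat \<Rightarrow> nat \<Rightarrow> bool" where
  "entry x v j = bit_at x (gates x + 1 + v * (gates x + 2) + j)"

definition gate_inp :: "bool list \<Rightarrow> nat \<Rightarrow> bool" where "gate_inp x v \<longleftrightarrow> \<not> entry x v 0 \<and> \<not> entry x v 1"
definition gate_neg :: "bool list \<Rightarrow> nat \<Rightarrow> bool" where "gate_neg x v \<longleftrightarrow> \<not> entry x v 0 \<and> entry x v 1"
definition gate_con :: "bool list \<Rightarrow> nat \<Rightarrow> bool" where "gate_con x v \<longleftrightarrow> entry x v 0 \<and> \<not> entry x v 1"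
definition gate_prd :: "bool list \<Rightarrow> nat \<Rightarrow> nat \<Rightarrow> bool" where "gate_prd x v j \<longleftrightarrow> j < gates x \<and> entry x v (2 + j)"

lemma definableb_bit_at [defin]: "definable F \<Longrightarrow> definableb (\<lambda>e. bit_at (bits e) (F e))"
  unfolding bit_at_def by (rule definableb_bit)

lemma definable_gates [defin]: "definable (\<lambda>e. gates (bits e))"
  unfolding gates_def by (rule definable_sum definable_len | simp only: bits_pop | intro defin)+

section \<open>The reduction\<close>

lemma definableb_eq_const [defin]: "definableb P \<Longrightarrow> definableb (\<lambda>e. P e = b)"
  by (cases b) (simp_all add: definableb_not)

lemma definableb_ex_le [defin]:
  assumes "definable F" "definableb (\<lambda>e. P (pop e) (peek e))"
  shows "definableb (\<lambda>e. \<exists>i\<le>F e. P e i)"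
  using definableb_ex[OF definable_Suc[OF assms(1)] assms(2)] by (simp add: less_Suc_eq_le)

lemma definableb_gate [defin]:
  assumes "definable V"
  shows "definableb (\<lambda>e. gate_inp (bits e) (V e))" "definableb (\<lambda>e. gate_neg (bits e) (V e))"
    "definableb (\<lambda>e. gate_con (bits e) (V e))" 
  unfolding gate_inp_def gate_neg_def gate_con_def entry_def by (intro defin assms)+

lemma definableb_prd [defin]:
  "definable V \<Longrightarrow> definable J \<Longrightarrow> definableb (\<lambda>e. gate_prd (bits e) (V e) (J e))"
  unfolding gate_prd_def entry_def by (intro defin)

section \<open>Definability of the local checks\<close>

locale reduction =
  fixes d p :: nat
begin

text \<open>The depth must be strictly below the fuel. The number \<open>q\<close> is the
  certificate size of \<open>check_sound\<close>.\<close>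

definition fuel :: nat where "fuel = Suc d"
definition q :: nat where "q = fuel + 2 ^ fuel"
definition indices :: "nat \<Rightarrow> nat" where "indices k = k + 2 + 2 * 2 ^ fuel"
definition vals :: "bool list \<Rightarrow> nat" where "vals x = gates x + 2"

text \<open>A tuple of \<open>q\<close> indices is one number \<open>u\<close> in base
  \<open>indices k\<close>, and the tuple of their values one number \<open>a\<close> in base
  \<open>vals x\<close>. So a tuple can be a single node and its contents a single value.\<close>

definition rho :: "bool list \<Rightarrow> nat \<Rightarrow> nat \<Rightarrow> nat \<Rightarrow> nat \<Rightarrow> nat \<Rightarrow> bool" where
  "rho x k u a i v \<longleftrightarrow> (\<exists>j<q. digit (indices k) u j = i \<and> digit (vals x) a j = v)"

definition chosen :: "bool list \<Rightarrow> nat \<Rightarrow> nat \<Rightarrow> nat \<Rightarrow> nat \<Rightarrow> bool" where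
  "chosen x k u a v = circ.chosen k (rho x k u a) v"
definition unchosen :: "bool list \<Rightarrow> nat \<Rightarrow> nat \<Rightarrow> nat \<Rightarrow> nat \<Rightarrow> bool" where
  "unchosen x k u a v = circ.unchosen k (rho x k u a) v"
definition forced :: "bool list \<Rightarrow> nat \<Rightarrow> nat \<Rightarrow> nat \<Rightarrow> nat \<Rightarrow> nat \<Rightarrow> bool \<Rightarrow> bool" where
  "forced x k n u a v b = circ.forced (gates x) k (gate_inp x) (gate_neg x) (gate_con x) (gate_prd x) n (rho x k u a) v b"
definition check :: "bool list \<Rightarrow> nat \<Rightarrow> nat \<Rightarrow> nat \<Rightarrow> nat \<Rightarrow> nat \<Rightarrow> bool \<Rightarrow> nat \<Rightarrow> nat \<Rightarrow> bool" where
  "check x k n u a v b r c = circ.check (gates x) k (gate_inp x) (gate_neg x) (gate_con x) (gate_prd x) n (rho x k u a) v b r c"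
definition ok_info :: "bool list \<Rightarrow> nat \<Rightarrow> (nat \<Rightarrow> nat \<Rightarrow> bool) \<Rightarrow> bool" where
  "ok_info x k \<rho> = circ.ok_info (gates x) k (gate_inp x) (gate_neg x) (gate_con x) (gate_prd x) fuel \<rho>"

lemma definable_indices [defin]: "definable (\<lambda>e. indices (par e))"
  unfolding indices_def by (intro defin)

lemma definable_vals [defin]: "definable (\<lambda>e. vals (bits e))"
  unfolding vals_def by (intro defin)

lemma definableb_chosen:
  assumes "definable U" "definable A" "definable V"
  shows "definableb (\<lambda>e. chosen (bits e) (par e) (U e) (A e) (V e))"
proof -
  have "chosen x k u a v \<longleftrightarrow> (\<exists>j<q. 1 \<le> digit (indices k) u j \<and> digit (indices k) u j \<le> k \<and> digit (vals x) a j = v + 1)" for x k u a v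
    by (auto simp: chosen_def circ.chosen_def rho_def)
  then show ?thesis by (simp only:) (intro definableb_ex_const defin assms)
qed

lemma definableb_unchosen:
  assumes "definable U" "definable A" "definable V"
  shows "definableb (\<lambda>e. unchosen (bits e) (par e) (U e) (A e) (V e))"
proof -
  have "unchosen x k u a v \<longleftrightarrow> (\<exists>j<q. \<exists>j'<q. digit (indices k) u j \<le> k \<and> digit (indices k) u j' = Suc (digit (indices k) u j) \<and>
      digit (vals x) a j < v + 1 \<and> v + 1 < digit (vals x) a j')" for x k u a v
    unfolding unchosen_def circ.unchosen_def rho_def by metis
  then show ?thesis by (simp only:) (intro definableb_ex_const defin assms)
qed

text \<open>The fuel is a constant of the reduction, so induction on it unrolls the recursion into a
  fixed term. The same holds for \<open>definableb_check\<close>.\<close>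

lemma definableb_forced:
  assumes "definable U" "definable A" "definable V"
  shows "definableb (\<lambda>e. forced (bits e) (par e) n (U e) (A e) (V e) b)"
  using assms
proof (induction n arbitrary: U A V b)
  case 0
  show ?case by (simp add: forced_def circ.forced.simps definableb_const)
next
  case (Suc n)
  have eq: "forced x k (Suc n) u a v b = (if gate_inp x v then (if b then chosen x k u a v else unchosen x k u a v)
      else if gate_neg x v then \<exists>j<gates x. gate_prd x v j \<and> forced x k n u a j (\<not> b)
      else if gate_con x v = b then \<forall>j<gates x. gate_prd x v j \<longrightarrow> forced x k n u a j b
      else \<exists>j<gates x. gate_prd x v j \<and> forced x k n u a j b)" for x k u a v
    by (simp add: forced_def circ.forced.simps chosen_def unchosen_def)
  have child: "definableb (\<lambda>e. forced (bits e) (par e) n (U (pop e)) (A (pop e)) (peek e) b)" for b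
    using Suc.IH[of "\<lambda>e. U (pop e)" "\<lambda>e. A (pop e)" peek b] Suc.prems by (simp add: definable_pop definable_peek)
  have prd: "definableb (\<lambda>e. gate_prd (bits e) (V (pop e)) (peek e))"
    using Suc.prems(3) by (intro defin definable_pop)
  show ?case unfolding eq
    by (intro definableb_if definableb_ex definableb_all definableb_const definableb_gate definableb_eq_const
        definableb_chosen definableb_unchosen definable_gates Suc.prems; simp only: bits_pop par_pop; intro definableb_conj definableb_imp child prd)
qed

lemma definableb_check:
  assumes "definable U" "definable A" "definable V" "definable R" "definable Q"
  shows "definableb (\<lambda>e. check (bits e) (par e) n (U e) (A e) (V e) b (R e) (Q e))"
  using assms
proof (induction n arbitrary: U A V b R Q)
  case 0
  show ?case by (simp add: check_def circ.check.simps definableb_const)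
next
  case (Suc n)
  have fan: "circ.fanin (gates x) (gate_prd x) v = (\<Sum>j<gates x. of_bool (gate_prd x v j))" for x v
    by (simp add: circ.fanin_def of_bool_def sum.If_cases Int_def conj_commute)
  \<comment> \<open>The pairs related by \<open>rho\<close> are indexed by the \<open>q\<close>
    digit positions, which removes the unbounded quantifier over witnesses.\<close>
  have wit: "(\<forall>w. rho x k u a i w \<longrightarrow> P w) \<longleftrightarrow> (\<forall>j<q. digit (indices k) u j = i \<longrightarrow> P (digit (vals x) a j))" for x k u a i P
    by (auto simp: rho_def)
  have eq: "check x k (Suc n) u a v b r c =
     (if gate_inp x v then (if b then \<not> unchosen x k u a v else \<not> chosen x k u a v)
      else if gate_neg x v then \<forall>j<gates x. gate_prd x v j \<longrightarrow> check x k n u a j (\<not> b) (2 * r) (r + c)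
      else if gate_con x v = b then
        (if (\<Sum>j<gates x. of_bool (gate_prd x v j)) \<le> (2::nat) then
           \<forall>j<gates x. gate_prd x v j \<longrightarrow> (if \<exists>j'<j. gate_prd x v j' then check x k n u a j b (2 * r) (2 * r + c)
                                                 else check x k n u a j b (2 * r) (r + c))
         else \<forall>j<gates x. gate_prd x v j \<longrightarrow> \<not> forced x k n u a j (\<not> b))
      else \<forall>j<q. digit (indices k) u j = k + 2 + c \<longrightarrow> digit (vals x) a j < gates x \<and> gate_prd x v (digit (vals x) a j) \<and>
        check x k n u a (digit (vals x) a j) b (2 * r) (r + c))" for x k u a v r c
    unfolding check_def circ.check.simps chosen_def unchosen_def forced_def fan wit by (rule refl)
  note pops = definable_pop[OF Suc.prems(1)] definable_pop[OF Suc.prems(2)] definable_pop[OF Suc.prems(3)]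
    definable_pop[OF Suc.prems(4)] definable_pop[OF Suc.prems(5)]
  have child: "definableb (\<lambda>e. check (bits e) (par e) n (U (pop e)) (A (pop e)) (peek e) b (R' e) (Q' e))"
    if "definable R'" "definable Q'" for R' Q' b
    by (rule Suc.IH[of "\<lambda>e. U (pop e)" "\<lambda>e. A (pop e)" peek R' Q']) (intro pops definable_peek that)+
  have frc: "definableb (\<lambda>e. forced (bits e) (par e) n (U (pop e)) (A (pop e)) (peek e) b)" for b
    by (rule definableb_forced) (intro pops definable_peek)+
  have prd: "definableb (\<lambda>e. gate_prd (bits e) (V (pop e)) (peek e))"
    by (intro definableb_prd pops definable_peek)
  have prd': "definableb (\<lambda>e. gate_prd (bits e) (V (pop (pop e))) (peek e))"
    by (intro definableb_prd definable_pop[OF pops(3)] definable_peek)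
  have wits: "definableb (\<lambda>e. check (bits e) (par e) n (U e) (A e) (digit (vals (bits e)) (A e) j) b (2 * R e) (R e + Q e))" for j
    by (rule Suc.IH) (intro defin Suc.prems)+
  have 1: "definableb (\<lambda>e. \<forall>j<gates (bits e). gate_prd (bits e) (V e) j \<longrightarrow> check (bits e) (par e) n (U e) (A e) j (\<not> b) (2 * R e) (R e + Q e))"
    by (intro definableb_all definable_gates; simp only: bits_pop par_pop) (intro definableb_imp prd child defin pops)
  have 2: "definableb (\<lambda>e. \<forall>j<gates (bits e). gate_prd (bits e) (V e) j \<longrightarrow>
      (if \<exists>j'<j. gate_prd (bits e) (V e) j' then check (bits e) (par e) n (U e) (A e) j b (2 * R e) (2 * R e + Q e)
       else check (bits e) (par e) n (U e) (A e) j b (2 * R e) (R e + Q e)))"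
    by (intro definableb_all definable_gates; simp only: bits_pop par_pop)
      (intro definableb_imp definableb_if prd child definableb_ex definable_peek; (simp only: bits_pop par_pop)?; intro prd' defin pops)
  have 3: "definableb (\<lambda>e. \<forall>j<gates (bits e). gate_prd (bits e) (V e) j \<longrightarrow> \<not> forced (bits e) (par e) n (U e) (A e) j (\<not> b))"
    by (intro definableb_all definable_gates; simp only: bits_pop par_pop) (intro definableb_imp definableb_not prd frc)
  have 4: "definableb (\<lambda>e. (\<Sum>j<gates (bits e). of_bool (gate_prd (bits e) (V e) j)) \<le> (2::nat))"
    by (intro definableb_le definable_const definable_sum definable_gates; simp only: bits_pop par_pop) (intro definable_of_bool prd)
  have 5: "definableb (\<lambda>e. \<forall>j<q. digit (indices (par e)) (U e) j = par e + 2 + Q e \<longrightarrow> digit (vals (bits e)) (A e) j < gates (bits e) \<and>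
      gate_prd (bits e) (V e) (digit (vals (bits e)) (A e) j) \<and>
      check (bits e) (par e) n (U e) (A e) (digit (vals (bits e)) (A e) j) b (2 * R e) (R e + Q e))"
    by (intro definableb_all_const definableb_imp definableb_conj wits) (intro defin Suc.prems)+
  show ?case unfolding eq
    by (intro definableb_if 1 2 3 4 5 definableb_not definableb_const definableb_gate definableb_eq_const
        definableb_chosen definableb_unchosen Suc.prems)
qed

lemma definableb_ok_info:
  assumes "definable U" "definable A"
  shows "definableb (\<lambda>e. ok_info (bits e) (par e) (rho (bits e) (par e) (U e) (A e)))"
proof -
  have all: "(\<forall>i v. rho x k u a i v \<longrightarrow> P i v) \<longleftrightarrow> (\<forall>j<q. P (digit (indices k) u j) (digit (vals x) a j))" for x k u a P
    by (auto simp: rho_def)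
  have eq: "ok_info x k (rho x k u a) \<longleftrightarrow>
     (\<forall>j<q. \<forall>j'<q. digit (indices k) u j < digit (indices k) u j' \<longrightarrow> digit (indices k) u j' \<le> k + 1 \<longrightarrow> digit (vals x) a j < digit (vals x) a j') \<and>
     (\<forall>j<q. (digit (indices k) u j = 0 \<longrightarrow> digit (vals x) a j = 0) \<and> (digit (indices k) u j = k + 1 \<longrightarrow> digit (vals x) a j = gates x + 1) \<and>
        (1 \<le> digit (indices k) u j \<and> digit (indices k) u j \<le> k \<longrightarrow>
          1 \<le> digit (vals x) a j \<and> digit (vals x) a j \<le> gates x \<and> gate_inp x (digit (vals x) a j - 1))) \<and>
     check x k fuel u a (gates x - 1) True 1 0" for x k u a
    unfolding ok_info_def circ.ok_info_def all check_def by (rule refl)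
  show ?thesis unfolding eq
    by (intro definableb_conj definableb_check definableb_all_const definableb_imp) (intro defin assms)+
qed

section \<open>Nodes and arcs of the constraint system\<close>

text \<open>The cut-off makes computed positions definable. Position \<open>q\<close> arises at key
  arcs, whose channel is \<open>2 * q\<close>; there the default is 0.\<close>

definition digit' :: "nat \<Rightarrow> nat \<Rightarrow> nat \<Rightarrow> nat" where
  "digit' b a j = (if j < q then digit b a j else 0)"

lemma definable_digit' [defin]: "definable B \<Longrightarrow> definable A \<Longrightarrow> definable J \<Longrightarrow> definable (\<lambda>e. digit' (B e) (A e) (J e))"
  unfolding digit'_def using definable_select[of "\<lambda>e j. digit (B e) (A e) j" J q] definable_digit by blast

text \<open>
  Node \<open>0\<close> is the key, the nodes \<open>1 + i\<close> hold the value of index \<open>i\<close>, and the nodes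
  \<open>1 + indices k + u\<close> hold the values of the \<open>q\<close> indices that are the digits of \<open>u\<close>,
  with the value \<open>0\<close> as a neutral position. For each tuple \<open>u\<close> there are arcs
  \<open>u * (2 * q + 1) + c\<close> in both directions between the tuple and its \<open>j\<close>-th index for
  \<open>c = 2 * j, 2 * j + 1\<close>, and an arc from the key for \<open>c = 2 * q\<close>.
\<close>

definition tuples :: "nat \<Rightarrow> nat" where "tuples k = indices k ^ q"
definition mains :: "nat \<Rightarrow> nat" where "mains k = 1 + indices k + tuples k"
definition arcs :: "nat \<Rightarrow> nat" where "arcs k = tuples k * (2 * q + 1)"
text \<open>Above \<open>p\<close> to exclude short cycles, and at least 2 whatever \<open>p\<close>
  is.\<close>

definition len :: nat where "len = p + 2"
definition width :: "bool list \<Rightarrow> nat" where "width x = vals x ^ q + 1"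
definition chan :: "nat \<Rightarrow> nat" where "chan e = e mod (2 * q + 1)"
definition hub :: "nat \<Rightarrow> nat \<Rightarrow> nat" where
  "hub k e = 1 + digit' (indices k) (e div (2 * q + 1)) (chan e div 2)"
definition tuple :: "nat \<Rightarrow> nat \<Rightarrow> nat" where
  "tuple k e = 1 + indices k + e div (2 * q + 1)"
definition src :: "nat \<Rightarrow> nat \<Rightarrow> nat" where
  "src k e = (if chan e = 2 * q then 0 else if chan e mod 2 = 0 then tuple k e else hub k e)"
definition dst :: "nat \<Rightarrow> nat \<Rightarrow> nat" where
  "dst k e = (if chan e = 2 * q then tuple k e else if chan e mod 2 = 0 then hub k e else tuple k e)"
definition out :: "bool list \<Rightarrow> nat \<Rightarrow> nat \<Rightarrow> nat" where
  "out x e a = (if chan e = 2 * q then of_bool (a = 1) else if chan e mod 2 = 0 then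
     (if a = 0 then 0 else digit' (vals x) (a - 1) (chan e div 2)) else a)"
text \<open>A neutral tuple accepts every value of an index, since \<open>width x\<close> exceeds
  all of them; this is the exemption in \<open>solution_imp_sequence\<close>. On a key arc truth
  values are compared, so a key at 1 forces the tuple out of its neutral position.\<close>

definition inn :: "bool list \<Rightarrow> nat \<Rightarrow> nat \<Rightarrow> nat" where
  "inn x e a = (if chan e = 2 * q then of_bool (\<not> a = 0) else if chan e mod 2 = 0 then a
     else if a = 0 then width x else digit' (vals x) (a - 1) (chan e div 2))"
definition ok :: "bool list \<Rightarrow> nat \<Rightarrow> nat \<Rightarrow> nat \<Rightarrow> bool" where
  "ok x k c a \<longleftrightarrow> (if c = 0 then a < 3 else if c \<le> indices k then True
     else a = 0 \<or> ok_info x k (rho x k (c - (1 + indices k)) (a - 1)))"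

lemma indices_pos: "0 < indices k" by (simp add: indices_def)
lemma vals_ge: "2 \<le> vals x" by (simp add: vals_def)
lemma q_ge: "2 \<le> q"
proof -
  have "(2::nat) ^ Suc d = 2 * 2 ^ d" "1 \<le> (2::nat) ^ d" by simp_all
  then show ?thesis unfolding q_def fuel_def by linarith
qed
lemma digit'_less: "0 < b \<Longrightarrow> digit' b a j < b" by (simp add: digit'_def digit_less)
lemma vals_less: "vals x < width x"
  using q_ge vals_ge[of x] self_le_power[of "vals x" q] by (simp add: width_def)
lemma chan_le: "chan e \<le> 2 * q"
  unfolding chan_def using mod_less_divisor[of "2 * q + 1" e] by linarith

lemma token_graph: "token_graph (mains k) (arcs k) len (width x) (src k) (dst k) (out x) (ok x k)"
proof
  show "0 < mains k" by (simp add: mains_def)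
  show "3 \<le> width x" using vals_less[of x] vals_ge[of x] by simp
  show "2 \<le> len" by (simp add: len_def)
  have hub: "hub k e < mains k" for e using digit'_less[OF indices_pos, of k] by (simp add: hub_def mains_def trans_less_add1)
  have tuple: "tuple k e < mains k" if "e < arcs k" for e
    using that by (simp add: tuple_def mains_def arcs_def less_mult_imp_div_less)
  show "src k e < mains k" if "e < arcs k" for e using hub tuple[OF that] by (simp add: src_def mains_def)
  show "dst k e < mains k" if "e < arcs k" for e using hub tuple[OF that] by (simp add: dst_def)
  show "dst k e \<noteq> 0" if "e < arcs k" for e by (simp add: dst_def hub_def tuple_def)
  show "out x e 0 = 0" if "e < arcs k" for e by (simp add: out_def)
  show "out x e a = 0" if "e < arcs k" "src k e = 0" "a \<noteq> 1" for e a
    using that by (simp add: src_def out_def hub_def tuple_def split: if_splits)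
  show "out x e a < width x" if "e < arcs k" "a < width x" for e a
  proof -
    have "digit' (vals x) b j < width x" for b j
      using digit'_less[of "vals x"] vals_ge[of x] vals_less[of x] by (meson less_le_trans less_trans zero_less_numeral)
    moreover have "(1::nat) < width x" using vals_ge[of x] vals_less[of x] by simp
    ultimately show ?thesis using that by (simp add: out_def of_bool_def)
  qed
  show "ok x k c 0" if "c < mains k" for c by (simp add: ok_def)
  show "ok x k 0 a \<longleftrightarrow> a < 3" for a by (simp add: ok_def)
qed

definition adj :: "bool list \<Rightarrow> nat \<Rightarrow> nat \<Rightarrow> nat \<Rightarrow> nat \<Rightarrow> nat \<Rightarrow> bool" where
  "adj x k = token_graph.adj (mains k) (arcs k) len (width x) (src k) (dst k) (out x) (inn x) (ok x k)"
definition classes :: "nat \<Rightarrow> nat" where "classes k = mains k + arcs k * len"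
definition verts :: "bool list \<Rightarrow> nat \<Rightarrow> nat" where "verts x k = classes k * width x"

lemma definable_arith [defin]: "definable (\<lambda>e. tuples (par e))" "definable (\<lambda>e. mains (par e))"
  "definable (\<lambda>e. arcs (par e))" "definable (\<lambda>e. width (bits e))" "definable (\<lambda>e. classes (par e))"
  "definable (\<lambda>e. verts (bits e) (par e))"
  unfolding verts_def classes_def arcs_def mains_def tuples_def width_def by (intro defin)+

lemma definable_src [defin]: "definable A \<Longrightarrow> definable (\<lambda>e. src (par e) (A e))"
  and definable_dst [defin]: "definable A \<Longrightarrow> definable (\<lambda>e. dst (par e) (A e))"
  unfolding src_def dst_def hub_def tuple_def chan_def by (intro defin; assumption)+

lemma definable_out [defin]: "definable A \<Longrightarrow> definable B \<Longrightarrow> definable (\<lambda>e. out (bits e) (A e) (B e))"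
  and definable_inn [defin]: "definable A \<Longrightarrow> definable B \<Longrightarrow> definable (\<lambda>e. inn (bits e) (A e) (B e))"
  unfolding out_def inn_def chan_def by (intro defin; assumption)+

lemma definableb_ok [defin]:
  "definable A \<Longrightarrow> definable B \<Longrightarrow> definableb (\<lambda>e. ok (bits e) (par e) (A e) (B e))"
  unfolding ok_def by (intro defin definableb_ok_info)

text \<open>Unfolding the constants of the locale leaves bounded quantifiers over arcs and
  positions, and their ranges are definable.\<close>

lemma definableb_adj:
  assumes "definable A" "definable B" "definable A'" "definable B'"
  shows "definableb (\<lambda>e. adj (bits e) (par e) (A e) (B e) (A' e) (B' e))"
proof -
  define node where "node k = token_graph.node (mains k) len (src k) (dst k)" for k
  define conflict where "conflict x k = token_graph.conflict (mains k) (arcs k) len (src k) (dst k) (out x) (inn x)" for x k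
  have node: "node k e l = (if l = 0 then src k e else if l \<le> len then mains k + e * len + (l - 1) else dst k e)" for k e l
    unfolding node_def token_graph.node_def[OF token_graph] by (rule refl)
  have conflict: "conflict x k c a c' a' \<longleftrightarrow> (\<exists>e<arcs k. \<exists>l\<le>len. node k e l = c \<and> node k e (Suc l) = c' \<and>
      (if Suc l \<le> len then a' else inn x e a') < (if l = 0 then out x e a else a))" for x k c a c' a'
    unfolding conflict_def node_def token_graph.conflict_def[OF token_graph] token_graph.in_val_def[OF token_graph]
      token_graph.out_val_def[OF token_graph] by (rule refl)
  have adj: "adj x k c a c' a' \<longleftrightarrow> (a < width x \<and> (c < mains k \<longrightarrow> ok x k c a)) \<and> (a' < width x \<and> (c' < mains k \<longrightarrow> ok x k c' a')) \<and>
     (if c = c' then \<not> a = a' \<and> (c = 0 \<longrightarrow> a = 1 \<or> a' = 1) else conflict x k c a c' a' \<or> conflict x k c' a' c a)" for x k c a c' a'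
    unfolding adj_def conflict_def token_graph.adj_def[OF token_graph] token_graph.valid_def[OF token_graph] by (rule refl)
  have conf: "definableb (\<lambda>e. conflict (bits e) (par e) (A e) (B e) (A' e) (B' e))"
    if "definable A" "definable B" "definable A'" "definable B'" for A B A' B'
  proof -
    note pops = that[THEN definable_pop, THEN definable_pop] definable_pop[OF definable_peek]
    show ?thesis unfolding conflict node
      by (intro definableb_ex definableb_ex_le defin; (simp only: bits_pop par_pop)?) (intro defin pops | simp only: bits_pop par_pop)+
  qed
  show ?thesis unfolding adj by (intro defin conf assms)
qed

end

section \<open>Decoding an encoded circuit\<close>

lemma concat_rows: "concat (map (\<lambda>i. map (f i) [0..<n]) [0..<l]) = map (\<lambda>i. f (i div n) (i mod n)) [0..<l * n]"
proof (induction l)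
  case (Suc l)
  have "[l * n..<l * n + n] = map (\<lambda>j. j + l * n) [0..<n]"
    using map_add_upt[of "l * n" n] by (simp add: add.commute)
  then have "map (\<lambda>i. f (i div n) (i mod n)) [l * n..<l * n + n] = map (f l) [0..<n]" by simp
  then show ?case using Suc upt_add_eq_append[of 0 "l * n" n] by (simp add: add.commute)
qed simp

lemma length_node_values: "length (node_values f C) = length C"
  unfolding node_values_def by (induction C rule: rev_induct) auto

lemma node_values_nth:
  "i < length C \<Longrightarrow> node_values f C ! i = f (take i (node_values f C)) (C ! i)"
proof (induction C rule: rev_induct)
  case (snoc g C)
  have step: "node_values f (C @ [g]) = node_values f C @ [f (node_values f C) g]" by (simp add: node_values_def)
  show ?case
  proof (cases "i < length C")
    case True
    then show ?thesis using snoc unfolding step by (simp add: nth_append length_node_values)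
  next
    case False
    then have "i = length C" using snoc.prems by simp
    then show ?thesis unfolding step by (simp add: length_node_values nth_append)
  qed
qed simp

definition row :: "gate \<Rightarrow> nat \<Rightarrow> bool" where
  "row g j = (if j < 2 then gate_kind g ! j else j - 2 \<in> preds g)"

lemma length_gate_kind: "length (gate_kind g) = 2" by (cases g) auto

lemma row_eq: "gate_kind g @ char_vector m (preds g) = map (row g) [0..<m + 2]"
  by (rule nth_equalityI) (auto simp: length_gate_kind nth_append row_def char_vector_def simp del: upt_Suc)

lemma encode_circuit_eq:
  fixes C defines "m \<equiv> length C"
  shows "encode_circuit C = unary m @ map (\<lambda>i. row (C ! (i div (m + 2))) (i mod (m + 2))) [0..<m * (m + 2)]"
proof -
  have "map (\<lambda>g. gate_kind g @ char_vector m (preds g)) C = map (\<lambda>i. map (row (C ! i)) [0..<m + 2]) [0..<m]"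
    by (rule nth_equalityI) (simp_all add: m_def row_eq)
  then show ?thesis unfolding encode_circuit_def m_def[symmetric] by (simp only: concat_rows[of "\<lambda>i. row (C ! i)"])
qed

lemma length_unary: "length (unary m) = m + 1" by (simp add: unary_def)

lemma nth_unary_append: "(unary m @ ys) ! i = (if i < m then True else if i = m then False else ys ! (i - (m + 1)))"
  by (auto simp: unary_def nth_append nth_Cons' )

definition depths :: "circuit \<Rightarrow> nat list" where
  "depths C = node_values (\<lambda>vs g. if g = Input_Gate then 0 else 1 + Max ((!) vs ` preds g)) C"

definition wefts :: "circuit \<Rightarrow> nat list" where
  "wefts C = node_values (\<lambda>vs g. if g = Input_Gate then 0
             else (if card (preds g) > 2 then 1 else 0) + Max ((!) vs ` preds g)) C"

context
  fixes C :: circuit and x :: "bool list"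
  assumes x: "x = encode_circuit C"
begin

text \<open>The first False in the encoding is the one that ends the unary prefix.\<close>

lemma gates_encode: "gates x = length C"
proof -
  let ?m = "length C"
  have len: "?m + 1 \<le> length x" by (simp add: x encode_circuit_eq length_unary)
  have nth: "x ! i = (i < ?m)" if "i \<le> ?m" for i using that unfolding x encode_circuit_eq nth_unary_append by simp
  have "(\<forall>j<Suc i. bit_at x j) \<longleftrightarrow> i < ?m" if i: "i < length x" for i
  proof
    assume all: "\<forall>j<Suc i. bit_at x j"
    show "i < ?m"
    proof (rule ccontr)
      assume "\<not> i < ?m"
      then have "x ! ?m" using all by (simp add: bit_at_def)
      then show False using nth[of ?m] by simp
    qed
  next
    assume "i < ?m"
    then show "\<forall>j<Suc i. bit_at x j" using nth len by (auto simp: bit_at_def)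
  qed
  then have "gates x = (\<Sum>i<length x. of_bool (i < ?m))" unfolding gates_def by (intro sum.cong) auto
  also have "\<dots> = card ({..<length x} \<inter> {i. i < ?m})" by (simp add: of_bool_def sum.If_cases)
  also have "{..<length x} \<inter> {i. i < ?m} = {..<?m}" using len by auto
  finally show ?thesis by simp
qed

lemma entry_encode:
  assumes "v < length C" "j < length C + 2"
  shows "entry x v j = row (C ! v) j"
proof -
  let ?m = "length C"
  let ?i = "v * (?m + 2) + j"
  have "?i < Suc v * (?m + 2)" using assms(2) by simp
  also have "\<dots> \<le> ?m * (?m + 2)" using assms(1) by (intro mult_le_mono1) simp
  finally have i: "?i < ?m * (?m + 2)" .
  have "?i div (?m + 2) = v" using assms(2) div_mult_self3[of "?m + 2" v j] by simp
  moreover have "?i mod (?m + 2) = j" using mod_less[OF assms(2)] by (simp only: mod_mult_self3)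
  moreover have "x ! (?m + 1 + ?i) = row (C ! (?i div (?m + 2))) (?i mod (?m + 2))" "?m + 1 + ?i < length x"
    using i unfolding x encode_circuit_eq nth_unary_append by (simp_all add: length_unary)
  ultimately show ?thesis unfolding entry_def gates_encode bit_at_def by (simp add: add.assoc)
qed

context
  assumes wf: "wf_circuit C"
begin

lemma gate_encode:
  assumes "v < length C"
  shows "gate_inp x v \<longleftrightarrow> C ! v = Input_Gate" "gate_neg x v \<longleftrightarrow> (\<exists>j. C ! v = Not_Gate j)"
    "gate_con x v \<longleftrightarrow> (\<exists>J. C ! v = And_Gate J)" "gate_prd x v j \<longleftrightarrow> j \<in> preds (C ! v)"
proof -
  have "entry x v 0 = gate_kind (C ! v) ! 0" "entry x v 1 = gate_kind (C ! v) ! 1"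
    using assms by (simp_all add: entry_encode row_def)
  then show "gate_inp x v \<longleftrightarrow> C ! v = Input_Gate" "gate_neg x v \<longleftrightarrow> (\<exists>j. C ! v = Not_Gate j)"
    "gate_con x v \<longleftrightarrow> (\<exists>J. C ! v = And_Gate J)"
    unfolding gate_inp_def gate_neg_def gate_con_def by (cases "C ! v"; simp)+
  have "preds (C ! v) \<subseteq> {..<v}" using wf assms by (simp add: wf_circuit_def)
  then have "j < length C" if "j \<in> preds (C ! v)" using that assms by auto
  then show "gate_prd x v j \<longleftrightarrow> j \<in> preds (C ! v)"
    unfolding gate_prd_def gates_encode using assms by (auto simp: entry_encode row_def)
qed

lemma preds_props:
  assumes "v < length C"
  shows "preds (C ! v) \<subseteq> {..<v}" "finite (preds (C ! v))" "C ! v \<noteq> Input_Gate \<Longrightarrow> preds (C ! v) \<noteq> {}"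
proof -
  have *: "preds (C ! v) \<subseteq> {..<v}" "legal_fanin (C ! v)" using wf assms by (auto simp: wf_circuit_def)
  then show "preds (C ! v) \<subseteq> {..<v}" "finite (preds (C ! v))" using finite_subset by auto
  show "C ! v \<noteq> Input_Gate \<Longrightarrow> preds (C ! v) \<noteq> {}" using *(2) by (cases "C ! v") auto
qed

text \<open>The recursion for depth and weft sees only the values of earlier nodes. Predecessors are
  earlier nodes, so these are their final values.\<close>

lemma Max_preds:
  fixes vs :: "nat list"
  assumes "v < length C" "j \<in> preds (C ! v)" "length vs = length C"
  shows "vs ! j \<le> Max ((!) (take v vs) ` preds (C ! v))"
proof -
  have "j < v" using preds_props(1)[OF assms(1)] assms(2) by auto
  then have "vs ! j = take v vs ! j" by simp
  then show ?thesis using preds_props(2)[OF assms(1)] assms(2) by (simp add: Max_ge)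
qed

lemma depths_less:
  assumes "v < length C" "C ! v \<noteq> Input_Gate" "j \<in> preds (C ! v)"
  shows "depths C ! j < depths C ! v"
proof -
  have len: "length (depths C) = length C" by (simp add: depths_def length_node_values)
  have "depths C ! v = 1 + Max ((!) (take v (depths C)) ` preds (C ! v))"
    using node_values_nth[OF assms(1), of "\<lambda>vs g. if g = Input_Gate then 0 else 1 + Max ((!) vs ` preds g)"] assms(2)
    unfolding depths_def by (simp only: assms(2) if_False)
  then show ?thesis using Max_preds[OF assms(1,3) len] by simp
qed

lemma wefts_le:
  assumes "v < length C" "C ! v \<noteq> Input_Gate" "j \<in> preds (C ! v)"
  shows "wefts C ! j + (if card (preds (C ! v)) > 2 then 1 else 0) \<le> wefts C ! v"
proof -
  have len: "length (wefts C) = length C" by (simp add: wefts_def length_node_values)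
  have "wefts C ! v = (if card (preds (C ! v)) > 2 then 1 else 0) + Max ((!) (take v (wefts C)) ` preds (C ! v))"
    using node_values_nth[OF assms(1), of "\<lambda>vs g. if g = Input_Gate then 0
             else (if card (preds g) > 2 then 1 else 0) + Max ((!) vs ` preds g)"] assms(2)
    unfolding wefts_def by (simp only: assms(2) if_False)
  then show ?thesis using Max_preds[OF assms(1,3) len] by simp
qed

lemma fanin_encode: "v < length C \<Longrightarrow> circ.fanin (gates x) (gate_prd x) v = card (preds (C ! v))"
proof -
  assume v: "v < length C"
  have "{j. j < gates x \<and> gate_prd x v j} = preds (C ! v)"
    using preds_props(1)[OF v] v by (auto simp: gates_encode gate_encode)
  then show ?thesis by (simp add: circ.fanin_def)
qed

lemma circ_sem_encode: "circ_sem (gates x) (gate_inp x) (gate_neg x) (gate_prd x) ((!) (depths C)) ((!) (wefts C))"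
proof
  fix v assume "v < gates x"
  then have v: "v < length C" by (simp add: gates_encode)
  note enc = gate_encode[OF v]
  show "j < gates x" if "gate_prd x v j" for j using that by (simp add: gate_prd_def)
  show "\<exists>j. \<forall>j'. gate_prd x v j' = (j' = j)" if "\<not> gate_inp x v" "gate_neg x v" using that enc by auto
  show "\<exists>j. gate_prd x v j" if "\<not> gate_inp x v" using that enc preds_props(3)[OF v] by auto
  show "depths C ! j < depths C ! v" if "\<not> gate_inp x v" "gate_prd x v j" for j
    using that enc depths_less[OF v] by simp
  show "wefts C ! j \<le> wefts C ! v" if "\<not> gate_inp x v" "gate_prd x v j" for j
    using that enc wefts_le[OF v, of j] by simp
  show "wefts C ! j < wefts C ! v" if "\<not> gate_inp x v" "2 < circ.fanin (gates x) (gate_prd x) v" "gate_prd x v j" for j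
    using that enc wefts_le[OF v, of j] by (simp add: fanin_encode[OF v])
qed

lemma is_val_encode:
  "circ_sem.is_val (gates x) (gate_inp x) (gate_neg x) (gate_con x) (gate_prd x) A (\<lambda>v. node_values (gate_value A) C ! v)"
  unfolding circ_sem.is_val_def[OF circ_sem_encode]
proof (intro allI impI)
  fix v assume "v < gates x"
  then have v: "v < length C" by (simp add: gates_encode)
  let ?f = "\<lambda>v. node_values (gate_value A) C ! v"
  have "?f v = gate_value A (take v (node_values (gate_value A) C)) (C ! v)" by (rule node_values_nth[OF v])
  moreover have "take v (node_values (gate_value A) C) ! j = ?f j" if "j \<in> preds (C ! v)" for j
    using preds_props(1)[OF v] that by auto
  ultimately show "?f v = (if gate_inp x v then v \<in> A else if gate_neg x v then \<exists>j. gate_prd x v j \<and> \<not> ?f j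
     else if gate_con x v then \<forall>j. gate_prd x v j \<longrightarrow> ?f j else \<exists>j. gate_prd x v j \<and> ?f j)"
    unfolding gate_encode[OF v] using v by (cases "C ! v") (auto simp: length_node_values)
qed

end

end

section \<open>Satisfiability, consistent values and sliding sequences\<close>

locale reduction_instance = reduction +
  fixes x :: "bool list" and k :: nat

sublocale reduction_instance \<subseteq> G: token_graph "mains k" "arcs k" len "width x" "src k" "dst k" "out x" "inn x" "ok x k"
  by (rule token_graph)

context reduction_instance
begin

text \<open>The right-hand side of \<open>sat_iff_ok_info\<close>, where the circuit and the graph
  meet.\<close>

definition feasible :: "(nat \<Rightarrow> nat) \<Rightarrow> bool" where
  "feasible Y \<longleftrightarrow> (\<forall>i. Y i < vals x) \<and> (\<forall>Q. length Q = q \<longrightarrow> set Q \<subseteq> {..<indices k} \<longrightarrow> ok_info x k (info Y Q))"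

lemma sat_iff_feasible:
  assumes "x = encode_circuit C" "wf_circuit C" "circuit_weft C \<le> 1" "circuit_depth C \<le> d"
  shows "(\<exists>A \<subseteq> input_nodes C. card A = k \<and> circuit_value C A) \<longleftrightarrow> (\<exists>Y. feasible Y)"
proof -
  let ?m = "length C"
  have m: "0 < ?m" using assms(2) by (simp add: wf_circuit_def)
  have gates: "gates x = ?m" using assms(1) by (rule gates_encode)
  interpret S: circ_sem "gates x" k "gate_inp x" "gate_neg x" "gate_con x" "gate_prd x" "(!) (depths C)" "(!) (wefts C)"
    by (rule circ_sem_encode[OF assms(1,2)])
  have last: "last (node_values f C) = node_values f C ! (?m - 1)" for f :: "'v list \<Rightarrow> gate \<Rightarrow> 'v"
    using m by (metis last_conv_nth length_node_values length_greater_0_conv)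
  have "circuit_weft C = wefts C ! (gates x - 1)" "circuit_depth C = depths C ! (gates x - 1)"
    unfolding circuit_weft_def circuit_depth_def wefts_def depths_def last gates by (rule refl)+
  then have "wefts C ! (gates x - 1) \<le> 1" "depths C ! (gates x - 1) < fuel"
    using assms(3,4) by (simp_all add: fuel_def)
  then have "(\<exists>A. A \<subseteq> {v. v < gates x \<and> gate_inp x v} \<and> card A = k \<and> node_values (gate_value A) C ! (gates x - 1)) \<longleftrightarrow>
    (\<exists>Y. (\<forall>i. Y i < gates x + 2) \<and> (\<forall>Q. length Q = q \<longrightarrow> set Q \<subseteq> {..<k + 2 + 2 * 2 ^ fuel} \<longrightarrow> S.ok_info fuel (info Y Q)))"
    using S.sat_iff_ok_info[OF is_val_encode[OF assms(1,2)], of fuel q] m q_ge unfolding q_def gates by simp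
  moreover have "{v. v < gates x \<and> gate_inp x v} = input_nodes C"
    using gate_encode(1)[OF assms(1,2)] by (auto simp: gates input_nodes_def)
  ultimately show ?thesis
    by (simp add: feasible_def vals_def indices_def ok_info_def circuit_value_def last gates conj_commute)
qed

lemma arc:
  assumes "u < tuples k" "c \<le> 2 * q"
  shows "u * (2 * q + 1) + c < arcs k" "chan (u * (2 * q + 1) + c) = c" "(u * (2 * q + 1) + c) div (2 * q + 1) = u"
proof -
  have "u * (2 * q + 1) + c < Suc u * (2 * q + 1)" using assms(2) by simp
  also have "\<dots> \<le> tuples k * (2 * q + 1)" using assms(1) by (intro mult_le_mono1) simp
  finally show "u * (2 * q + 1) + c < arcs k" by (simp add: arcs_def)
  have c: "c < 2 * q + 1" using assms(2) by simp
  then show "chan (u * (2 * q + 1) + c) = c" unfolding chan_def by (metis add.commute mod_less mod_mult_self1)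
  show "(u * (2 * q + 1) + c) div (2 * q + 1) = u" using c by (metis add.commute div_less div_mult_self1 add_0 less_zeroE)
qed

text \<open>With the key at 1 no tuple is neutral, and the two opposite arcs make each component
  equal to the value of its index node. Every list of \<open>q\<close> indices is the digit list of
  some \<open>u\<close>, so validity of the tuple nodes gives consistency of all of them.\<close>

lemma solution_imp_feasible:
  assumes "G.solution y"
  shows "\<exists>Y. feasible Y"
proof -
  let ?t = "indices k"
  have valid: "\<And>c. c < mains k \<Longrightarrow> G.valid c (y c)" and key: "y 0 = 1"
    and arcs: "\<And>e. e < arcs k \<Longrightarrow> out x e (y (src k e)) \<le> inn x e (y (dst k e))"
    using assms by (simp_all add: G.solution_def)
  define a where "a u = y (1 + ?t + u)" for u
  have nz: "a u \<noteq> 0" if u: "u < tuples k" for u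
    using arcs[OF arc(1)[OF u order_refl]] key
    unfolding src_def dst_def out_def inn_def tuple_def arc(2,3)[OF u order_refl] a_def by (auto simp: of_bool_def split: if_splits)
  have eq: "digit (vals x) (a u - 1) j = y (1 + digit ?t u j)" if u: "u < tuples k" and j: "j < q" for u j
  proof (rule antisym)
    have c: "2 * j \<le> 2 * q" "2 * j \<noteq> 2 * q" "Suc (2 * j) \<le> 2 * q" "Suc (2 * j) \<noteq> 2 * q" using j by (simp, simp, simp, presburger)
    show "digit (vals x) (a u - 1) j \<le> y (1 + digit ?t u j)"
      using arcs[OF arc(1)[OF u c(1)]] nz[OF u] c(2) j
      unfolding src_def dst_def out_def inn_def tuple_def hub_def digit'_def arc(2,3)[OF u c(1)] a_def by simp
    show "y (1 + digit ?t u j) \<le> digit (vals x) (a u - 1) j"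
      using arcs[OF arc(1)[OF u c(3)]] nz[OF u] c(4) j
      unfolding src_def dst_def out_def inn_def tuple_def hub_def digit'_def arc(2,3)[OF u c(3)] a_def by simp
  qed
  define Y where "Y i = (if i < ?t then y (1 + i) else 0)" for i
  have num: "number ?t f q < tuples k \<and> (\<forall>j<q. digit ?t (number ?t f q) j = f j)" if "\<And>j. j < q \<Longrightarrow> f j < ?t" for f
    using number_less[of q f ?t] digit_number[of q f ?t] that by (simp add: tuples_def)
  \<comment> \<open>Index nodes themselves admit all values below \<open>width x\<close>. The tuple
    with \<open>i\<close> in every component supplies the bound, as digits are smaller than the
    base.\<close>
  have "Y i < vals x" for i
  proof (cases "i < ?t")
    case True
    let ?u = "number ?t (\<lambda>_. i) q"
    have "?u < tuples k" "digit ?t ?u 0 = i" using num[of "\<lambda>_. i"] True q_ge by auto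
    then have "Y i = digit (vals x) (a ?u - 1) 0" using eq[of ?u 0] True q_ge by (simp add: Y_def)
    then show ?thesis using digit_less vals_ge[of x] by simp
  next
    case False
    then show ?thesis using vals_ge[of x] by (simp add: Y_def)
  qed
  moreover have "ok_info x k (info Y Q)" if Q: "length Q = q" "set Q \<subseteq> {..<?t}" for Q
  proof -
    let ?u = "number ?t ((!) Q) q"
    have mem: "Q ! j < ?t" if "j < q" for j
    proof -
      have "Q ! j \<in> set Q" using that Q(1) by simp
      then show ?thesis using Q(2) by auto
    qed
    have u: "?u < tuples k" "\<And>j. j < q \<Longrightarrow> digit ?t ?u j = Q ! j" using num[of "(!) Q"] mem by auto
    have "info Y Q \<le> rho x k ?u (a ?u - 1)"
    proof (intro le_funI le_boolI)
      fix i v assume "info Y Q i v"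
      then obtain j where j: "j < q" "Q ! j = i" "v = Y i" using Q(1) by (auto simp: info_def in_set_conv_nth)
      then have "digit (vals x) (a ?u - 1) j = v" using eq[OF u(1), of j] u(2) mem[OF j(1)] by (simp add: Y_def)
      then show "rho x k ?u (a ?u - 1) i v" using j u(2) by (auto simp: rho_def)
    qed
    moreover have "1 + ?t + ?u < mains k" using u(1) by (simp add: mains_def)
    from valid[OF this] have "ok_info x k (rho x k ?u (a ?u - 1))"
      using nz[OF u(1)] \<open>1 + ?t + ?u < mains k\<close> by (simp add: G.valid_def ok_def a_def)
    ultimately show ?thesis unfolding ok_info_def by (rule circ.ok_info_antimono)
  qed
  ultimately show ?thesis unfolding feasible_def by blast
qed

lemma feasible_imp_solution:
  assumes "feasible Y"
  shows "\<exists>y. G.solution y"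
proof -
  let ?t = "indices k"
  have Y: "\<And>i. Y i < vals x" "\<And>Q. length Q = q \<Longrightarrow> set Q \<subseteq> {..<?t} \<Longrightarrow> ok_info x k (info Y Q)"
    using assms by (simp_all add: feasible_def)
  define a where "a u = number (vals x) (\<lambda>j. Y (digit ?t u j)) q" for u
  have a: "a u < vals x ^ q" "\<And>j. j < q \<Longrightarrow> digit (vals x) (a u) j = Y (digit ?t u j)" for u
    unfolding a_def using number_less[of q "\<lambda>j. Y (digit ?t u j)" "vals x"] digit_number[of q "\<lambda>j. Y (digit ?t u j)" "vals x"] Y(1)
    by simp_all
  define y where "y c = (if c = 0 then 1 else if c \<le> ?t then Y (c - 1) else 1 + a (c - (1 + ?t)))" for c
  have y_hub: "y (1 + i) = Y i" if "i < ?t" for i using that by (simp add: y_def)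
  have y_tuple: "y (1 + ?t + u) = 1 + a u" for u by (simp add: y_def)
  have ok: "ok_info x k (rho x k u (a u))" for u
  proof -
    let ?Q = "map (digit ?t u) [0..<q]"
    have "rho x k u (a u) = info Y ?Q"
      using a(2) by (auto simp: rho_def info_def fun_eq_iff)
    moreover have "set ?Q \<subseteq> {..<?t}" using digit_less[OF indices_pos] by auto
    ultimately show ?thesis using Y(2)[of ?Q] by simp
  qed
  have "G.valid c (y c)" if "c < mains k" for c
  proof -
    consider "c = 0" | "c \<noteq> 0" "c \<le> ?t" | u where "c = 1 + ?t + u"
      by (metis le_add_diff_inverse not_less_eq_eq plus_1_eq_Suc)
    then show ?thesis
    proof cases
      case 1
      then show ?thesis using vals_less[of x] vals_ge[of x] by (simp add: G.valid_def ok_def y_def)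
    next
      case 2
      then show ?thesis using less_trans[OF Y(1) vals_less] by (simp add: G.valid_def ok_def y_def)
    next
      case 3
      moreover have "1 + a u < width x" using a(1)[of u] by (simp add: width_def)
      ultimately show ?thesis using ok[of u] y_tuple[of u] by (simp add: G.valid_def ok_def)
    qed
  qed
  moreover have "y 0 = 1" by (simp add: y_def)
  moreover have "out x e (y (src k e)) \<le> inn x e (y (dst k e))" if "e < arcs k" for e
  proof -
    let ?u = "e div (2 * q + 1)" and ?j = "chan e div 2"
    have eq: "digit' (vals x) (a ?u) ?j = y (hub k e)" if "chan e \<noteq> 2 * q"
    proof -
      have j: "?j < q" using chan_le[of e] that by auto
      have "digit ?t ?u ?j < ?t" using digit_less[OF indices_pos] .
      then show ?thesis using a(2)[OF j] y_hub j by (simp add: digit'_def hub_def)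
    qed
    have "y (tuple k e) = 1 + a ?u" unfolding tuple_def by (rule y_tuple)
    then show ?thesis using eq \<open>y 0 = 1\<close> by (simp add: src_def dst_def out_def inn_def)
  qed
  ultimately show ?thesis by (intro exI[of _ y]) (simp add: G.solution_def)
qed

lemma K_eq: "G.K = classes k" by (simp add: G.K_def classes_def)

lemma verts_eq: "G.K * width x = verts x k" by (simp add: K_eq verts_def)

lemma sequence_iff:
  "(\<exists>l I. sliding_sequence {..<verts x k} G.edges (classes k) G.start G.target l I) \<longleftrightarrow> (\<exists>Y. feasible Y)"
proof
  assume "\<exists>l I. sliding_sequence {..<verts x k} G.edges (classes k) G.start G.target l I"
  then obtain l I where "sliding_sequence {..<verts x k} G.edges (classes k) G.start G.target l I" by blast
  then have "\<exists>y. G.solution y" using G.sequence_imp_solution unfolding K_eq verts_def[symmetric] by blast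
  then show "\<exists>Y. feasible Y" using solution_imp_feasible by blast
next
  assume "\<exists>Y. feasible Y"
  then obtain y where y: "G.solution y" using feasible_imp_solution by blast
  \<comment> \<open>By increasing rank: paths from indices to tuples, index nodes, paths from tuples
    to indices, tuple nodes, key paths, key. A path takes \<open>len\<close> ranks and its source
    the next one. The paths to tuples may come first because their ends are exempt while the tuples
    are neutral.\<close>
  define rk where "rk c = (if c = 0 then 3 * len + 3 else if c \<le> indices k then len + 1 else 2 * len + 2)" for c
  define ar where "ar e = (if chan e = 2 * q then 2 * len + 2 else if chan e mod 2 = 0 then len + 1 else 0)" for e
  have "hub k e \<le> indices k" for e using digit'_less[OF indices_pos[of k]] by (simp add: hub_def Suc_le_eq)
  then have "rk (hub k e) = len + 1" for e by (simp add: rk_def hub_def)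
  moreover have "rk (tuple k e) = 2 * len + 2" for e by (simp add: rk_def tuple_def)
  moreover have "rk 0 = 3 * len + 3" by (simp add: rk_def)
  ultimately have "rk (dst k e) \<le> ar e \<or> width x \<le> inn x e 0" "ar e + len < rk (src k e)" for e
    by (auto simp: ar_def src_def dst_def inn_def)
  then show "\<exists>l I. sliding_sequence {..<verts x k} G.edges (classes k) G.start G.target l I"
    using G.solution_imp_sequence[OF y, of rk ar] unfolding K_eq verts_def[symmetric] by blast
qed

lemma sliding_instance: "sliding_instance p (verts x k) G.edges G.start G.target (classes k)"
proof -
  have good: "G.good (\<lambda>_. 0)" "G.good ((\<lambda>_. 0)(0 := 2))" by (rule G.good_start; simp)+
  have "1 \<le> classes k" by (simp add: classes_def mains_def)
  moreover have "C4_to_Cp_free p {..<G.K * width x} G.edges" by (rule G.C4_to_Cp_free) (simp add: len_def)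
  ultimately show ?thesis
    using G.simple_graph G.independent_tokens[OF good(1)] G.independent_tokens[OF good(2)] G.card_tokens[OF good(1)] G.card_tokens[OF good(2)]
    unfolding sliding_instance_def G.start_def G.target_def K_eq verts_def[symmetric] by simp
qed

section \<open>The encoded instance bit by bit\<close>

text \<open>A description by position, since \<open>output_prog\<close> evaluates one term for each
  output bit.\<close>

definition out_bit :: "nat \<Rightarrow> bool" where
  "out_bit i = (if i < verts x k then True else if i = verts x k then False
     else if i - (verts x k + 1) < verts x k * verts x k then
       adj x k ((i - (verts x k + 1)) div verts x k div width x) ((i - (verts x k + 1)) div verts x k mod width x)
         ((i - (verts x k + 1)) mod verts x k div width x) ((i - (verts x k + 1)) mod verts x k mod width x)
     else if i - (verts x k + 1) - verts x k * verts x k < verts x k then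
       (i - (verts x k + 1) - verts x k * verts x k) mod width x = 0
     else (i - (verts x k + 1) - verts x k * verts x k - verts x k) mod width x =
       (if (i - (verts x k + 1) - verts x k * verts x k - verts x k) div width x = 0 then 2 else 0))"

definition out_length :: nat where
  "out_length = verts x k + 1 + verts x k * verts x k + verts x k + verts x k"

lemma encode_eq: "encode_sliding (verts x k) G.edges G.start G.target = map out_bit [0..<out_length]"
proof -
  let ?n = "verts x k"
  have div: "v div width x < G.K" if "v < ?n" for v using that unfolding verts_eq[symmetric] by (rule less_mult_imp_div_less)
  have edge: "{v, w} \<in> G.edges \<longleftrightarrow> adj x k (v div width x) (v mod width x) (w div width x) (w mod width x)" if "v < ?n" "w < ?n" for v w
    using that unfolding G.edges_iff adj_def verts_eq by simp
  have S: "v \<in> G.start \<longleftrightarrow> v mod width x = 0" if "v < ?n" for v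
    using div[OF that] G.in_tokens_iff[OF G.good_start, of "\<lambda>_. 0" v] by (simp add: G.start_def)
  have T: "v \<in> G.target \<longleftrightarrow> v mod width x = (if v div width x = 0 then 2 else 0)" if "v < ?n" for v
    using div[OF that] G.in_tokens_iff[OF G.good_start, of "(\<lambda>_. 0)(0 := 2)" v] by (simp add: G.target_def)
  have rows: "concat (map (\<lambda>i. char_vector ?n {j. {i, j} \<in> G.edges}) [0..<?n]) =
    map (\<lambda>i. {i div ?n, i mod ?n} \<in> G.edges) [0..<?n * ?n]"
    unfolding char_vector_def using concat_rows[of "\<lambda>i j. {i, j} \<in> G.edges" ?n ?n] by simp
  show ?thesis
  proof (rule nth_equalityI)
    show len: "length (encode_sliding ?n G.edges G.start G.target) = length (map out_bit [0..<out_length])"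
      by (simp add: encode_sliding_def rows length_unary out_length_def)
    fix i assume "i < length (encode_sliding ?n G.edges G.start G.target)"
    then have i: "i < out_length" unfolding len by simp
    let ?i1 = "i - (?n + 1)" let ?i2 = "?i1 - ?n * ?n" let ?i3 = "?i2 - ?n"
    have "encode_sliding ?n G.edges G.start G.target ! i = (if i < ?n then True else if i = ?n then False
      else if ?i1 < ?n * ?n then {?i1 div ?n, ?i1 mod ?n} \<in> G.edges else if ?i2 < ?n then ?i2 \<in> G.start else ?i3 \<in> G.target)"
      using i unfolding encode_sliding_def rows nth_unary_append
      by (auto simp: nth_append char_vector_def out_length_def)
    also have "\<dots> = out_bit i"
    proof -
      have "?i1 div ?n < ?n" "?i1 mod ?n < ?n" if "?i1 < ?n * ?n"
        using that by (simp add: less_mult_imp_div_less, cases "?n = 0", simp_all)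
      moreover have "?i3 < ?n" if "\<not> i < ?n" "i \<noteq> ?n" "\<not> ?i1 < ?n * ?n" "\<not> ?i2 < ?n" using that i by (simp add: out_length_def)
      ultimately show ?thesis using edge S T by (simp add: out_bit_def)
    qed
    finally show "encode_sliding ?n G.edges G.start G.target ! i = map out_bit [0..<out_length] ! i" using i by simp
  qed
qed

end

section \<open>Running time and correctness of the reduction\<close>

lemma definable_term:
  assumes "definable F"
  obtains t where "\<And>x k st. tval x k t st = F ((x, k), st)"
  using assms by (auto simp: definable_def)

text \<open>Applied with the empty input, this bounds the new parameter by a function of
  \<open>k\<close> alone.\<close>

lemma tval_bound: "\<exists>c. \<forall>x k. tval x k t (\<lambda>_. 0) \<le> (length x + k + 2) ^ c"
proof -
  obtain c where c: "evaluates t c" using evaluates_ex by blast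
  have "tval x k t (\<lambda>_. 0) \<le> (length x + k + 2) ^ c" for x k
  proof -
    let ?s = "\<lambda>b i. if b = ''n'' then length x else if b = ''k'' then k else if b = ''x'' then of_bool (x ! i) else 0"
    have "represents x k (\<lambda>_. 0) (\<lambda>_. 0) 1 ?s" by (simp add: represents_def)
    from evaluatesD[OF c _ _ _ this, of "length x + k + 2"] show ?thesis by auto
  qed
  then show ?thesis by blast
qed

definition reduction_output :: "nat \<Rightarrow> nat \<Rightarrow> bool list \<Rightarrow> nat \<Rightarrow> bool list" where
  "reduction_output d p x k = map (reduction_instance.out_bit d p x k) [0..<reduction_instance.out_length d p x k]"

lemma reduction_program:
  "\<exists>prog c. \<forall>x k s. holds_output s x k \<longrightarrow>
     (\<exists>t s'. exec prog s t s' \<and> holds_output s' (reduction_output d p x k) (reduction.classes d p k) \<and>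
        t + length (reduction_output d p x k) \<le> (length x + k + 2) ^ c)"
proof -
  interpret reduction d p .
  have len: "definable (\<lambda>e. reduction_instance.out_length d p (bits e) (par e))"
    unfolding reduction_instance.out_length_def by (intro defin)
  have bit: "definableb (\<lambda>e. reduction_instance.out_bit d p (bits e) (par e) (peek e))"
    unfolding reduction_instance.out_bit_def by (intro defin definableb_adj)
  have cls: "definable (\<lambda>e. classes (par e))" by (intro defin)
  obtain lt where lt: "\<And>x k st. tval x k lt st = reduction_instance.out_length d p x k"
    using definable_term[OF len] by (auto simp: bits_def par_def)
  obtain bt where bt: "\<And>x k st. tval x k bt st = of_bool (reduction_instance.out_bit d p x k (st 0))"
    using definable_term[OF bit[unfolded definableb_def]] by (auto simp: bits_def par_def peek_def)
  obtain kt where kt: "\<And>x k st. tval x k kt st = classes k"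
    using definable_term[OF cls] by (auto simp: par_def)
  obtain c where c: "\<And>x k s y. holds_output s x k \<Longrightarrow> length y = tval x k lt (\<lambda>_. 0) \<Longrightarrow>
     (\<forall>i<length y. tval x k bt (case_nat i (\<lambda>_. 0)) = of_bool (y ! i)) \<Longrightarrow>
     \<exists>t s'. exec (output_prog lt bt kt) s t s' \<and> holds_output s' y (tval x k kt (\<lambda>_. 0)) \<and>
        t + length y \<le> (length x + k + 2) ^ c"
    using output_prog_correct[of lt bt kt] by blast
  have "\<exists>t s'. exec (output_prog lt bt kt) s t s' \<and> holds_output s' (reduction_output d p x k) (classes k) \<and>
        t + length (reduction_output d p x k) \<le> (length x + k + 2) ^ c" if "holds_output s x k" for x k s
    using c[OF that, of "reduction_output d p x k"] by (simp add: lt bt kt reduction_output_def)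
  then show ?thesis by blast
qed

text \<open>Both the time factor and the parameter bound of the composed reduction have this
  form.\<close>

lemma computable_power: "computable f \<Longrightarrow> computable g \<Longrightarrow> computable (\<lambda>k. (f k + g k + 2) ^ c)"
proof -
  assume fg: "computable f" "computable g"
  have "definable (\<lambda>e. (snd e 0 + snd e 1 + 2) ^ c)" by (intro defin definable_var)
  then obtain t where "\<And>x k st. tval x k t st = (st 0 + st 1 + 2) ^ c" by (rule definable_term) auto
  then show ?thesis using computable_combine[OF fg, of t] by (simp add: env0_def)
qed

lemma classes_bound: "\<exists>c. \<forall>k. reduction.classes d p k \<le> (k + 2) ^ c"
proof -
  interpret reduction d p .
  have "definable (\<lambda>e. classes (par e))" by (intro defin)
  then obtain t where t: "\<And>x k st. tval x k t st = classes k" by (rule definable_term) (auto simp: par_def)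
  obtain c where "\<And>x k. tval x k t (\<lambda>_. 0) \<le> (length x + k + 2) ^ c" using tval_bound by blast
  from this[of "[]"] show ?thesis unfolding t by auto
qed

text \<open>Membership speaks of some circuit with this encoding; injectivity identifies it with the
  given one. \<open>token_sliding_iff\<close> relies on the same argument for graphs.\<close>

lemma weighted_circuit_sat_iff:
  assumes "wf_circuit C" "circuit_weft C \<le> t" "circuit_depth C \<le> d"
  shows "(encode_circuit C, k) \<in> yes_instances (weighted_circuit_sat t d) \<longleftrightarrow>
    (\<exists>A \<subseteq> input_nodes C. card A = k \<and> circuit_value C A)"
  using assms encode_circuit_inj[OF assms(1)] by (auto simp: weighted_circuit_sat_def)

lemma token_sliding_iff:
  assumes "sliding_instance p n E S T k"
  shows "(encode_sliding n E S T, k) \<in> instances (token_sliding p)"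
    and "(encode_sliding n E S T, k) \<in> yes_instances (token_sliding p) \<longleftrightarrow> (\<exists>l I. sliding_sequence {..<n} E k S T l I)"
proof -
  show "(encode_sliding n E S T, k) \<in> instances (token_sliding p)"
    using assms by (auto simp: token_sliding_def)
  have inj: "n' = n \<and> E' = E \<and> S' = S \<and> T' = T"
    if "sliding_instance p n' E' S' T' k'" "encode_sliding n E S T = encode_sliding n' E' S' T'" for n' E' S' T' k'
    using encode_sliding_inj[of n E S T n' E' S' T'] assms that
    by (auto simp: sliding_instance_def independent_set_def)
  show "(encode_sliding n E S T, k) \<in> yes_instances (token_sliding p) \<longleftrightarrow> (\<exists>l I. sliding_sequence {..<n} E k S T l I)"
  proof
    assume "(encode_sliding n E S T, k) \<in> yes_instances (token_sliding p)"
    then obtain n' E' S' T' l I where *: "encode_sliding n E S T = encode_sliding n' E' S' T'"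
      "sliding_instance p n' E' S' T' k" "sliding_sequence {..<n'} E' k S' T' l I"
      by (auto simp: token_sliding_def)
    then show "\<exists>l I. sliding_sequence {..<n} E k S T l I" using inj[OF *(2,1)] by blast
  next
    assume seq: "\<exists>l I. sliding_sequence {..<n} E k S T l I"
    show "(encode_sliding n E S T, k) \<in> yes_instances (token_sliding p)"
      unfolding token_sliding_def param_problem.simps mem_Collect_eq
      by (intro exI[of _ n] exI[of _ E] exI[of _ S] exI[of _ T] exI[of _ k] conjI refl assms seq)
  qed
qed

lemma reduction_correct:
  assumes "(x, k) \<in> instances (weighted_circuit_sat 1 d)"
  shows "(reduction_output d p x k, reduction.classes d p k) \<in> instances (token_sliding p)"
    and "(x, k) \<in> yes_instances (weighted_circuit_sat 1 d) \<longleftrightarrow>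
      (reduction_output d p x k, reduction.classes d p k) \<in> yes_instances (token_sliding p)"
proof -
  interpret reduction_instance d p x k .
  obtain C where C: "x = encode_circuit C" "wf_circuit C" "circuit_weft C \<le> 1" "circuit_depth C \<le> d"
    using assms by (auto simp: weighted_circuit_sat_def)
  have out: "reduction_output d p x k = encode_sliding (verts x k) G.edges G.start G.target"
    unfolding encode_eq reduction_output_def by (rule refl)
  show "(reduction_output d p x k, classes k) \<in> instances (token_sliding p)"
    unfolding out by (rule token_sliding_iff(1)[OF sliding_instance])
  show "(x, k) \<in> yes_instances (weighted_circuit_sat 1 d) \<longleftrightarrow>
      (reduction_output d p x k, classes k) \<in> yes_instances (token_sliding p)"
    unfolding out token_sliding_iff(2)[OF sliding_instance] sequence_iff
    using weighted_circuit_sat_iff[OF C(2-4), of k] sat_iff_feasible[OF C] C(1) by simp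
qed

theorem theorem21:
  fixes p :: nat
  assumes "p \<ge> 4"
  shows "W_hard 1 (token_sliding p)"
  unfolding W_hard_def
proof
  fix P assume "P \<in> W_class 1"
  \<comment> \<open>The depth bound belongs to the problem \<open>P\<close>, so the second program
    and its exponents may depend on it.\<close>
  then obtain d where "P \<le>\<^sub>f\<^sub>p\<^sub>t weighted_circuit_sat 1 d" by (auto simp: W_class_def)
  then obtain c f g e where fg: "computable f" "computable g"
    and red: "\<And>x k. (x, k) \<in> instances P \<Longrightarrow>
      \<exists>y k'. transforms_within c (x, k) (y, k') (f k * (length x + 1) ^ e) \<and> k' \<le> g k \<and>
        (y, k') \<in> instances (weighted_circuit_sat 1 d) \<and>
        ((x, k) \<in> yes_instances P \<longleftrightarrow> (y, k') \<in> yes_instances (weighted_circuit_sat 1 d))"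
    unfolding fpt_reducible_def by blast
  obtain prog b where prog: "\<And>x k s. holds_output s x k \<Longrightarrow>
     \<exists>t s'. exec prog s t s' \<and> holds_output s' (reduction_output d p x k) (reduction.classes d p k) \<and>
        t + length (reduction_output d p x k) \<le> (length x + k + 2) ^ b"
    using reduction_program[of d p] by blast
  obtain b' where b': "\<And>k. reduction.classes d p k \<le> (k + 2) ^ b'" using classes_bound by blast
  let ?F = "\<lambda>k. f k + g k + 2"
  show "P \<le>\<^sub>f\<^sub>p\<^sub>t token_sliding p"
    unfolding fpt_reducible_def
  proof (rule exI[of _ "Seq c prog"], rule exI[of _ "\<lambda>k. ?F k ^ (b + 2)"], rule exI[of _ "\<lambda>k. ?F k ^ b'"],
      rule exI[of _ "e * (b + 2)"], intro conjI allI impI)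
    show "computable (\<lambda>k. ?F k ^ (b + 2))" "computable (\<lambda>k. ?F k ^ b')" using computable_power[OF fg] by blast+
    fix x k assume "(x, k) \<in> instances P"
    from red[OF this] obtain y k' where y: "transforms_within c (x, k) (y, k') (f k * (length x + 1) ^ e)" "k' \<le> g k"
      "(y, k') \<in> instances (weighted_circuit_sat 1 d)"
      "(x, k) \<in> yes_instances P \<longleftrightarrow> (y, k') \<in> yes_instances (weighted_circuit_sat 1 d)" by blast
    \<comment> \<open>\<open>?Z\<close> dominates the time of the first program and the size of its
      result together with the parameter, and it is still a function of \<open>k\<close> times a
      power of the length. The second program takes at most \<open>?Z ^ b\<close>; both times are at
      most \<open>?Z ^ Suc b\<close>, and a further factor \<open>?Z\<close> absorbs the 2 from
      their sum.\<close>
    let ?z = "reduction_output d p y k'" and ?B = "f k * (length x + 1) ^ e" and ?Z = "?F k * (length x + 1) ^ e"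
    obtain t s where s: "exec c (init_state x k) t s" "holds_output s y k'" "t + length y \<le> ?B"
      using y(1) by (auto simp: transforms_within_def)
    obtain t' s' where s': "exec prog s t' s'" "holds_output s' ?z (reduction.classes d p k')"
      "t' + length ?z \<le> (length y + k' + 2) ^ b" using prog[OF s(2)] by blast
    have pos: "1 \<le> (length x + 1) ^ e" by simp
    then have "(g k + 2) * 1 \<le> (g k + 2) * (length x + 1) ^ e" by (rule mult_le_mono2)
    then have "?B + (g k + 2) \<le> ?B + (g k + 2) * (length x + 1) ^ e" by simp
    also have "\<dots> = ?Z" by (simp only: distrib_right add.assoc)
    finally have Z: "?B + (g k + 2) \<le> ?Z" .
    then have "length y + k' + 2 \<le> ?Z" using s(3) y(2) by linarith
    then have "t' + length ?z \<le> ?Z ^ b" using s'(3) power_mono[of "length y + k' + 2" ?Z b] by linarith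
    moreover have Z2: "2 \<le> ?Z" using Z by linarith
    moreover have "?Z ^ b \<le> ?Z ^ Suc b" "?Z ^ 1 \<le> ?Z ^ Suc b" using Z2 by (intro power_increasing; simp)+
    then have "?Z ^ b \<le> ?Z ^ Suc b" "?Z \<le> ?Z ^ Suc b" by simp_all
    moreover have "t \<le> ?Z" using s(3) Z by linarith
    ultimately have "t + (t' + length ?z) \<le> 2 * ?Z ^ Suc b" by linarith
    also have "\<dots> \<le> ?Z * ?Z ^ Suc b" using Z2 by (rule mult_le_mono1)
    also have "\<dots> = ?Z ^ (b + 2)" by simp
    also have "\<dots> = ?F k ^ (b + 2) * (length x + 1) ^ (e * (b + 2))"
      by (simp only: power_mult_distrib power_mult)
    finally have "t + t' + length ?z \<le> ?F k ^ (b + 2) * (length x + 1) ^ (e * (b + 2))" by simp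
    moreover have "exec (Seq c prog) (init_state x k) (t + t') s'" using s(1) s'(1) by (rule exec.Seq)
    ultimately have within: "transforms_within (Seq c prog) (x, k) (?z, reduction.classes d p k')
      (?F k ^ (b + 2) * (length x + 1) ^ (e * (b + 2)))"
      using s'(2) unfolding transforms_within_def by auto
    have "reduction.classes d p k' \<le> (k' + 2) ^ b'" by (rule b')
    also have "\<dots> \<le> ?F k ^ b'" using y(2) by (intro power_mono) auto
    finally have "reduction.classes d p k' \<le> ?F k ^ b'" .
    then show "\<exists>y k'. transforms_within (Seq c prog) (x, k) (y, k') (?F k ^ (b + 2) * (length x + 1) ^ (e * (b + 2))) \<and>
      k' \<le> ?F k ^ b' \<and> (y, k') \<in> instances (token_sliding p) \<and>
      ((x, k) \<in> yes_instances P \<longleftrightarrow> (y, k') \<in> yes_instances (token_sliding p))"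
      using within reduction_correct[OF y(3), of p] y(4) by blast
  qed
qed

end
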